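(* Let $F:(M^m,g)\to(B^n,g')$ be a conformal submersion between Riemannian manifolds with connected fibers and dilation $\lambda:M\to\mathbb{R}^+$, and let $f:M\to\mathbb{R}$ be a smooth function. Then $F$ is a Clairaut conformal submersion with $r=e^f$ if and only if all of the following hold: the gradient $\nabla f$ is horizontal; the fibers of $F$ are totally umbilical with mean curvature vector field $H=-\nabla f$; and $\lambda$ is constant along the fibers of $F$.
   Context: All manifolds, maps and functions are smooth; $\dim M=m$, $\dim B=n$. For a submersion $F:(M,g)\to(B,g')$, the vertical distribution is $\ker F_\ast$ (tangent to the fibers $F^{-1}(\{q\})$) and the horizontal distribution is its $g$-orthogonal complement $(\ker F_\ast)^\perp$; $\nu$ and $\mathcal{H}$ denote the orthogonal projections onto them. $F$ is a conformal submersion with dilation $\lambda:M\to\mathbb{R}^+$ if $g'(F_\ast X,F_\ast Y)=\lambda^2 g(X,Y)$ for all horizontal $X,Y$. A conformal submersion $F$ is a Clairaut conformal submersion with function $r:M\to\mathbb{R}^+$ if for every geodesic $\alpha$ on $(M,g)$ the function $t\mapsto r(\alpha(t))\sin\omega(t)$ is constant, where $\omega(t)\in[0,\pi/2]$ is the angle between $\dot\alpha(t)$ and the horizontal space at $\alpha(t)$ (so $\sin\omega(t)=\|\nu\dot\alpha(t)\|/\|\dot\alpha(t)\|$). $\nabla$ is the Levi-Civita connection of $g$, and $\nabla f$ is the $g$-gradient of $f$. The fibers are totally umbilical with mean curvature vector field $H$ (a horizontal field) if $\mathcal{H}\nabla_U V=g(U,V)H$ for all vertical fields $U,V$. "Constant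 along the fibers" means constant on each fiber. *)

theory Defs
  imports "HOL-Analysis.Analysis" "HOL-Library.Function_Algebras"
begin

subsection \<open>Smooth maps between Euclidean spaces\<close>

text \<open>Only meant for open \<open>S\<close>: all derivatives are full derivatives in the ambient space.\<close>

primrec Ck_on :: "nat \<Rightarrow> 'a::euclidean_space set \<Rightarrow> ('a \<Rightarrow> 'b::euclidean_space) \<Rightarrow> bool" where
  "Ck_on 0 S f \<longleftrightarrow> continuous_on S f"
| "Ck_on (Suc k) S f \<longleftrightarrow>
     (\<forall>x\<in>S. f differentiable (at x)) \<and>
     (\<forall>v. Ck_on k S (\<lambda>x. frechet_derivative f (at x) v))"

definition smooth_on :: "'a::euclidean_space set \<Rightarrow> ('a \<Rightarrow> 'b::euclidean_space) \<Rightarrow> bool" where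
  "smooth_on S f \<longleftrightarrow> (\<forall>k. Ck_on k S f)"


subsection \<open>Smooth manifolds\<close>

text \<open>
  The underlying set of a manifold is the whole type \<open>'m\<close> and its dimension is \<open>DIM('a)\<close>.
  A chart is a pair of an open domain and a coordinate map; the values of the
  coordinate map outside the domain are irrelevant. An atlas need not be maximal.
\<close>

type_synonym ('m, 'a) chart = "'m set \<times> ('m \<Rightarrow> 'a)"

abbreviation cdom :: "('m, 'a) chart \<Rightarrow> 'm set" where
  "cdom \<equiv> fst"

abbreviation cmap :: "('m, 'a) chart \<Rightarrow> 'm \<Rightarrow> 'a" where
  "cmap \<equiv> snd"

definition cinv :: "('m, 'a) chart \<Rightarrow> 'a \<Rightarrow> 'm" where
  "cinv c = inv_into (cdom c) (cmap c)"

definition is_chart :: "('m::topological_space, 'a::euclidean_space) chart \<Rightarrow> bool" where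
  "is_chart c \<longleftrightarrow> open (cdom c) \<and> open (cmap c ` cdom c) \<and>
     homeomorphism (cdom c) (cmap c ` cdom c) (cmap c) (cinv c)"

definition smooth_manifold ::
  "('m::{t2_space, second_countable_topology}, 'a::euclidean_space) chart set \<Rightarrow> bool" where
  "smooth_manifold A \<longleftrightarrow>
     (\<forall>c\<in>A. is_chart c) \<and> (\<Union>c\<in>A. cdom c) = UNIV \<and>
     (\<forall>c\<in>A. \<forall>d\<in>A. smooth_on (cmap c ` (cdom c \<inter> cdom d)) (cmap d \<circ> cinv c))"

definition smooth_fun ::
  "('m, 'a::euclidean_space) chart set \<Rightarrow> ('m \<Rightarrow> real) \<Rightarrow> bool" where
  "smooth_fun A f \<longleftrightarrow> (\<forall>c\<in>A. smooth_on (cmap c ` cdom c) (f \<circ> cinv c))"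

definition smooth_map ::
  "('m::topological_space, 'a::euclidean_space) chart set \<Rightarrow>
   ('n::topological_space, 'b::euclidean_space) chart set \<Rightarrow> ('m \<Rightarrow> 'n) \<Rightarrow> bool" where
  "smooth_map A B F \<longleftrightarrow> continuous_on UNIV F \<and>
     (\<forall>c\<in>A. \<forall>d\<in>B.
        smooth_on (cmap c ` (cdom c \<inter> F -` cdom d)) (cmap d \<circ> F \<circ> cinv c))"


subsection \<open>Tangent vectors\<close>

instantiation "fun" :: (type, real_vector) real_vector
begin

definition scaleR_fun_def: "scaleR r f = (\<lambda>x. r *\<^sub>R f x)"

instance
  by standard (auto simp: scaleR_fun_def fun_eq_iff scaleR_add_right scaleR_add_left)

end

text \<open>
  A tangent vector at \<open>p\<close> is the family of its coordinate vectors, one for each chart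
  around \<open>p\<close>, related by the derivatives of the transition maps. The entries of the
  family at all other charts are set to \<open>0\<close>, so that equality of tangent vectors is
  equality of families, and the vector space operations are pointwise.
\<close>

type_synonym ('m, 'a) tvec = "('m, 'a) chart \<Rightarrow> 'a"

definition charts_at :: "('m, 'a) chart set \<Rightarrow> 'm \<Rightarrow> ('m, 'a) chart set" where
  "charts_at A p = {c \<in> A. p \<in> cdom c}"

definition tangent_space ::
  "('m, 'a::euclidean_space) chart set \<Rightarrow> 'm \<Rightarrow> ('m, 'a) tvec set" where
  "tangent_space A p =
     {v. (\<forall>c\<in>charts_at A p. \<forall>d\<in>charts_at A p.
            v d = frechet_derivative (cmap d \<circ> cinv c) (at (cmap c p)) (v c)) \<and>
         (\<forall>c. c \<notin> charts_at A p \<longrightarrow> v c = 0)}"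

text \<open>The tangent vector at \<open>p\<close> with coordinate vector \<open>u\<close> in the chart \<open>c\<close>.\<close>

definition tvec_of ::
  "('m, 'a::euclidean_space) chart set \<Rightarrow> ('m, 'a) chart \<Rightarrow> 'm \<Rightarrow> 'a \<Rightarrow> ('m, 'a) tvec" where
  "tvec_of A c p u =
     (\<lambda>d. if d \<in> charts_at A p
          then frechet_derivative (cmap d \<circ> cinv c) (at (cmap c p)) u else 0)"

text \<open>
  An arbitrary chart around \<open>p\<close>. It is only used where the resulting geometric object
  does not depend on the choice.
\<close>

definition chart_at :: "('m, 'a) chart set \<Rightarrow> 'm \<Rightarrow> ('m, 'a) chart" where
  "chart_at A p = (SOME c. c \<in> charts_at A p)"

definition pushforward ::
  "('m, 'a::euclidean_space) chart set \<Rightarrow> ('n, 'b::euclidean_space) chart set \<Rightarrow>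
   ('m \<Rightarrow> 'n) \<Rightarrow> 'm \<Rightarrow> ('m, 'a) tvec \<Rightarrow> ('n, 'b) tvec" where
  "pushforward A B F p v =
     (let c = chart_at A p in
      (\<lambda>d. if d \<in> charts_at B (F p)
           then frechet_derivative (cmap d \<circ> F \<circ> cinv c) (at (cmap c p)) (v c) else 0))"

definition dfun ::
  "('m, 'a::euclidean_space) chart set \<Rightarrow> ('m \<Rightarrow> real) \<Rightarrow> 'm \<Rightarrow> ('m, 'a) tvec \<Rightarrow> real" where
  "dfun A f p v =
     (let c = chart_at A p in frechet_derivative (f \<circ> cinv c) (at (cmap c p)) (v c))"

definition smooth_vfield ::
  "('m, 'a::euclidean_space) chart set \<Rightarrow> ('m \<Rightarrow> ('m, 'a) tvec) \<Rightarrow> bool" where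
  "smooth_vfield A X \<longleftrightarrow> (\<forall>p. X p \<in> tangent_space A p) \<and>
     (\<forall>c\<in>A. smooth_on (cmap c ` cdom c) (\<lambda>x. X (cinv c x) c))"

definition smooth_curve ::
  "('m::topological_space, 'a::euclidean_space) chart set \<Rightarrow> real set \<Rightarrow> (real \<Rightarrow> 'm) \<Rightarrow> bool" where
  "smooth_curve A I \<alpha> \<longleftrightarrow> continuous_on I \<alpha> \<and>
     (\<forall>c\<in>A. smooth_on (I \<inter> \<alpha> -` cdom c) (cmap c \<circ> \<alpha>))"

definition velocity ::
  "('m, 'a::euclidean_space) chart set \<Rightarrow> (real \<Rightarrow> 'm) \<Rightarrow> real \<Rightarrow> ('m, 'a) tvec" where
  "velocity A \<alpha> t =
     (\<lambda>c. if c \<in> charts_at A (\<alpha> t) then vector_derivative (cmap c \<circ> \<alpha>) (at t) else 0)"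


subsection \<open>Riemannian metrics\<close>

type_synonym ('m, 'a) metric = "'m \<Rightarrow> ('m, 'a) tvec \<Rightarrow> ('m, 'a) tvec \<Rightarrow> real"

text \<open>The metric in the coordinates of a chart; \<open>x\<close> is a point of the image of the chart.\<close>

definition metric_coords ::
  "('m, 'a::euclidean_space) chart set \<Rightarrow> ('m, 'a) metric \<Rightarrow> ('m, 'a) chart \<Rightarrow>
   'a \<Rightarrow> 'a \<Rightarrow> 'a \<Rightarrow> real" where
  "metric_coords A g c x u v =
     g (cinv c x) (tvec_of A c (cinv c x) u) (tvec_of A c (cinv c x) v)"

definition riemannian_metric ::
  "('m, 'a::euclidean_space) chart set \<Rightarrow> ('m, 'a) metric \<Rightarrow> bool" where
  "riemannian_metric A g \<longleftrightarrow>
     (\<forall>p. \<forall>u\<in>tangent_space A p. \<forall>v\<in>tangent_space A p. \<forall>w\<in>tangent_space A p. \<forall>a.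
        g p (u + v) w = g p u w + g p v w \<and>
        g p (a *\<^sub>R u) w = a * g p u w \<and>
        g p u v = g p v u) \<and>
     (\<forall>p. \<forall>u\<in>tangent_space A p. u \<noteq> 0 \<longrightarrow> g p u u > 0) \<and>
     (\<forall>c\<in>A. \<forall>u v. smooth_on (cmap c ` cdom c) (\<lambda>x. metric_coords A g c x u v))"

definition riemannian_manifold ::
  "('m::{t2_space, second_countable_topology}, 'a::euclidean_space) chart set \<Rightarrow>
   ('m, 'a) metric \<Rightarrow> bool" where
  "riemannian_manifold A g \<longleftrightarrow> smooth_manifold A \<and> riemannian_metric A g"

definition gnorm :: "('m, 'a) metric \<Rightarrow> 'm \<Rightarrow> ('m, 'a) tvec \<Rightarrow> real" where
  "gnorm g p v = sqrt (g p v v)"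

text \<open>The angle between a vector and the zero vector is \<open>\<pi>/2\<close>, because \<open>x / 0 = 0\<close>.\<close>

definition gangle :: "('m, 'a) metric \<Rightarrow> 'm \<Rightarrow> ('m, 'a) tvec \<Rightarrow> ('m, 'a) tvec \<Rightarrow> real" where
  "gangle g p u v = arccos (g p u v / (gnorm g p u * gnorm g p v))"

definition gradient ::
  "('m, 'a::euclidean_space) chart set \<Rightarrow> ('m, 'a) metric \<Rightarrow> ('m \<Rightarrow> real) \<Rightarrow>
   'm \<Rightarrow> ('m, 'a) tvec" where
  "gradient A g f p =
     (THE w. w \<in> tangent_space A p \<and> (\<forall>v\<in>tangent_space A p. g p w v = dfun A f p v))"


subsection \<open>Levi-Civita connection and geodesics\<close>

text \<open>
  \<open>christoffel A g c p u v\<close> is the coordinate vector of \<open>\<nabla>\<^sub>U V\<close> at \<open>p\<close> for the fields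
  \<open>U\<close>, \<open>V\<close> with constant coordinate vectors \<open>u\<close>, \<open>v\<close> in the chart \<open>c\<close>. Since such fields
  commute, symmetry says that \<open>\<nabla>\<close> is torsion-free; the last condition says that \<open>\<nabla>\<close> is
  compatible with the metric.
\<close>

definition christoffel ::
  "('m, 'a::euclidean_space) chart set \<Rightarrow> ('m, 'a) metric \<Rightarrow> ('m, 'a) chart \<Rightarrow> 'm \<Rightarrow>
   'a \<Rightarrow> 'a \<Rightarrow> 'a" where
  "christoffel A g c p =
     (THE \<Gamma>. bilinear \<Gamma> \<and> (\<forall>u v. \<Gamma> u v = \<Gamma> v u) \<and>
        (\<forall>w u v. frechet_derivative (\<lambda>x. metric_coords A g c x u v) (at (cmap c p)) w =
           metric_coords A g c (cmap c p) (\<Gamma> w u) v +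
           metric_coords A g c (cmap c p) u (\<Gamma> w v)))"

text \<open>The covariant derivative \<open>\<nabla>\<^sub>X Y\<close>.\<close>

definition cov_deriv ::
  "('m, 'a::euclidean_space) chart set \<Rightarrow> ('m, 'a) metric \<Rightarrow>
   ('m \<Rightarrow> ('m, 'a) tvec) \<Rightarrow> ('m \<Rightarrow> ('m, 'a) tvec) \<Rightarrow> 'm \<Rightarrow> ('m, 'a) tvec" where
  "cov_deriv A g X Y p =
     (let c = chart_at A p in
      tvec_of A c p
        (frechet_derivative (\<lambda>x. Y (cinv c x) c) (at (cmap c p)) (X p c) +
         christoffel A g c p (X p c) (Y p c)))"

text \<open>The covariant derivative of a vector field \<open>V\<close> along a curve \<open>\<alpha>\<close>.\<close>

definition cov_deriv_along ::
  "('m, 'a::euclidean_space) chart set \<Rightarrow> ('m, 'a) metric \<Rightarrow> (real \<Rightarrow> 'm) \<Rightarrow>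
   (real \<Rightarrow> ('m, 'a) tvec) \<Rightarrow> real \<Rightarrow> ('m, 'a) tvec" where
  "cov_deriv_along A g \<alpha> V t =
     (let c = chart_at A (\<alpha> t) in
      tvec_of A c (\<alpha> t)
        (vector_derivative (\<lambda>s. V s c) (at t) +
         christoffel A g c (\<alpha> t) (velocity A \<alpha> t c) (V t c)))"

definition geodesic ::
  "('m::topological_space, 'a::euclidean_space) chart set \<Rightarrow> ('m, 'a) metric \<Rightarrow>
   real set \<Rightarrow> (real \<Rightarrow> 'm) \<Rightarrow> bool" where
  "geodesic A g I \<alpha> \<longleftrightarrow> open I \<and> is_interval I \<and> smooth_curve A I \<alpha> \<and>
     (\<forall>t\<in>I. cov_deriv_along A g \<alpha> (velocity A \<alpha>) t = 0)"


subsection \<open>Conformal submersions\<close>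

definition submersion ::
  "('m::topological_space, 'a::euclidean_space) chart set \<Rightarrow>
   ('n::topological_space, 'b::euclidean_space) chart set \<Rightarrow> ('m \<Rightarrow> 'n) \<Rightarrow> bool" where
  "submersion A B F \<longleftrightarrow> smooth_map A B F \<and>
     (\<forall>p. pushforward A B F p ` tangent_space A p = tangent_space B (F p))"

definition vertical ::
  "('m, 'a::euclidean_space) chart set \<Rightarrow> ('n, 'b::euclidean_space) chart set \<Rightarrow>
   ('m \<Rightarrow> 'n) \<Rightarrow> 'm \<Rightarrow> ('m, 'a) tvec set" where
  "vertical A B F p = {v \<in> tangent_space A p. pushforward A B F p v = 0}"

definition horizontal ::
  "('m, 'a::euclidean_space) chart set \<Rightarrow> ('m, 'a) metric \<Rightarrow>
   ('n, 'b::euclidean_space) chart set \<Rightarrow> ('m \<Rightarrow> 'n) \<Rightarrow> 'm \<Rightarrow> ('m, 'a) tvec set" where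
  "horizontal A g B F p =
     {v \<in> tangent_space A p. \<forall>u\<in>vertical A B F p. g p v u = 0}"

definition hproj ::
  "('m, 'a::euclidean_space) chart set \<Rightarrow> ('m, 'a) metric \<Rightarrow>
   ('n, 'b::euclidean_space) chart set \<Rightarrow> ('m \<Rightarrow> 'n) \<Rightarrow>
   'm \<Rightarrow> ('m, 'a) tvec \<Rightarrow> ('m, 'a) tvec" where
  "hproj A g B F p v =
     (THE w. w \<in> horizontal A g B F p \<and> v - w \<in> vertical A B F p)"

definition conformal_submersion ::
  "('m::topological_space, 'a::euclidean_space) chart set \<Rightarrow> ('m, 'a) metric \<Rightarrow>
   ('n::topological_space, 'b::euclidean_space) chart set \<Rightarrow> ('n, 'b) metric \<Rightarrow>
   ('m \<Rightarrow> 'n) \<Rightarrow> ('m \<Rightarrow> real) \<Rightarrow> bool" where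
  "conformal_submersion A g B g' F lam \<longleftrightarrow>
     submersion A B F \<and> smooth_fun A lam \<and> (\<forall>p. lam p > 0) \<and>
     (\<forall>p. \<forall>X\<in>horizontal A g B F p. \<forall>Y\<in>horizontal A g B F p.
        g' (F p) (pushforward A B F p X) (pushforward A B F p Y) = (lam p)\<^sup>2 * g p X Y)"

text \<open>
  The angle between a vector and the horizontal space is the angle between the vector
  and its horizontal projection. By the convention for \<open>gangle\<close>, it is \<open>\<pi>/2\<close> for
  vertical vectors.
\<close>

definition horizontal_angle ::
  "('m, 'a::euclidean_space) chart set \<Rightarrow> ('m, 'a) metric \<Rightarrow>
   ('n, 'b::euclidean_space) chart set \<Rightarrow> ('m \<Rightarrow> 'n) \<Rightarrow> 'm \<Rightarrow> ('m, 'a) tvec \<Rightarrow> real" where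
  "horizontal_angle A g B F p v = gangle g p v (hproj A g B F p v)"

definition clairaut_conformal_submersion ::
  "('m::topological_space, 'a::euclidean_space) chart set \<Rightarrow> ('m, 'a) metric \<Rightarrow>
   ('n::topological_space, 'b::euclidean_space) chart set \<Rightarrow> ('n, 'b) metric \<Rightarrow>
   ('m \<Rightarrow> 'n) \<Rightarrow> ('m \<Rightarrow> real) \<Rightarrow> ('m \<Rightarrow> real) \<Rightarrow> bool" where
  "clairaut_conformal_submersion A g B g' F lam r \<longleftrightarrow>
     conformal_submersion A g B g' F lam \<and> smooth_fun A r \<and> (\<forall>p. r p > 0) \<and>
     (\<forall>I \<alpha>. geodesic A g I \<alpha> \<longrightarrow>
        (\<lambda>t. r (\<alpha> t) * sin (horizontal_angle A g B F (\<alpha> t) (velocity A \<alpha> t))) constant_on I)"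

definition fibers_totally_umbilical ::
  "('m::topological_space, 'a::euclidean_space) chart set \<Rightarrow> ('m, 'a) metric \<Rightarrow>
   ('n::topological_space, 'b::euclidean_space) chart set \<Rightarrow> ('m \<Rightarrow> 'n) \<Rightarrow>
   ('m \<Rightarrow> ('m, 'a) tvec) \<Rightarrow> bool" where
  "fibers_totally_umbilical A g B F H \<longleftrightarrow>
     smooth_vfield A H \<and> (\<forall>p. H p \<in> horizontal A g B F p) \<and>
     (\<forall>U V. smooth_vfield A U \<and> (\<forall>p. U p \<in> vertical A B F p) \<and>
            smooth_vfield A V \<and> (\<forall>p. V p \<in> vertical A B F p) \<longrightarrow>
        (\<forall>p. hproj A g B F p (cov_deriv A g U V p) = g p (U p) (V p) *\<^sub>R H p))"

end

theory Submission
  imports Defs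
begin

text \<open>
  Let \<open>K = \<lambda>\<^sup>-\<^sup>2 F\<^sup>* g'\<close>, so that \<open>K(v, v)\<close> is the squared length of the horizontal part of \<open>v\<close> and
  \<open>\<parallel>v\<parallel>\<^sup>2 sin\<^sup>2 \<omega> = g(v, v) - K(v, v)\<close>. A geodesic has constant speed, so \<open>e\<^sup>f sin \<omega>\<close> is constant along
  every geodesic iff \<open>2 df(v) (g(v, v) - K(v, v)) = (\<nabla>\<^sub>v K)(v, v)\<close> for every tangent vector \<open>v\<close>.
  Write \<open>v = u + a\<close> with \<open>u\<close> vertical and \<open>a\<close> horizontal. The tensor \<open>\<nabla>K\<close> vanishes on two vertical
  and on two horizontal arguments, \<open>(\<nabla>\<^sub>u K)(u, a) = - g(\<nabla>\<^sub>u u, a)\<close>, and differentiating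
  \<open>F\<^sup>* g' = \<lambda>\<^sup>2 K\<close> gives \<open>(\<nabla>\<^sub>a K)(a, u) = d(ln \<lambda>)(u) g(a, a)\<close>. The condition thus becomes
  \<open>(df(u) + df(a)) g(u, u) = - g(\<nabla>\<^sub>u u, a) + d(ln \<lambda>)(u) g(a, a)\<close>, and comparing the terms of equal
  bidegree in \<open>u\<close> and \<open>a\<close> separates the three conditions of the theorem.
\<close>


subsection \<open>Calculus of smooth maps\<close>

text \<open>The tensor K is built from \<lambda>, \<open>g'\<close> and the differential of F alone,
  so its smoothness and its derivatives can be computed in coordinates. The horizontal projection,
  given only by a description, is recovered from it as the solution hp of g(hp a, b) = K(a, b).
  Passing between points and global objects costs most of the work. A condition on all geodesics
  constrains every tangent vector only if each is the velocity of some geodesic; this takes an ODE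
  theorem and the transformation law of the Christoffel symbols, as a solution found in one chart
  must satisfy the geodesic equation in whichever chart \<open>chart_at\<close> selects along the
  way. Umbilicity quantifies over globally defined vertical fields, so vertical vectors are extended
  by bump functions. That d\<lambda> vanishes on vertical vectors gives constancy on a fiber by
  straightening it locally and using that it is connected. In the comparison of bidegrees a = 0
  yields df(u) = 0, the sign change of u isolates the term in d\<lambda>, and a nonzero horizontal
  vector, available since dim B > 0, yields d\<lambda>(u) = 0.\<close>

abbreviation FD :: "('a::real_normed_vector \<Rightarrow> 'b::real_normed_vector) \<Rightarrow> 'a \<Rightarrow> 'a \<Rightarrow> 'b" where
  "FD f x \<equiv> frechet_derivative f (at x)"

lemma Ck_on_cong:
  assumes "open S" "\<And>x. x \<in> S \<Longrightarrow> f x = g x"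
  shows "Ck_on k S f \<longleftrightarrow> Ck_on k S g"
  using assms(2)
proof (induction k arbitrary: f g)
  case 0
  then show ?case by (simp cong: continuous_on_cong_simp)
next
  case (Suc k)
  have ev: "f' differentiable (at x) \<Longrightarrow> g' differentiable (at x)"
    if "\<And>x. x \<in> S \<Longrightarrow> f' x = g' x" "x \<in> S" for f' g' :: "'a \<Rightarrow> 'b" and x
    using that assms(1) unfolding differentiable_def
    by (metis has_derivative_transform_within_open)
  have fd: "FD f x = FD g x" if "x \<in> S" for x
  proof (cases "f differentiable (at x)")
    case True
    then show ?thesis
      using frechet_derivative_transform_within_open[of f x S g] assms(1) that Suc.prems by blast
  next
    case False
    \<comment> \<open>Where neither map is differentiable, both derivatives are \<open>SOME\<close>
      of the same everywhere false predicate, so the two \<open>FD\<close> values still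
      coincide.\<close>
    then have "\<not> g differentiable (at x)" using ev[of g f x] Suc.prems that by metis
    with False show ?thesis
      unfolding frechet_derivative_def differentiable_def by meson
  qed
  have "Ck_on k S (\<lambda>x. FD f x v) \<longleftrightarrow>
        Ck_on k S (\<lambda>x. FD g x v)" for v
    by (rule Suc.IH) (simp add: fd)
  moreover have "(\<forall>x\<in>S. f differentiable (at x)) \<longleftrightarrow> (\<forall>x\<in>S. g differentiable (at x))"
    using ev[of f g] ev[of g f] Suc.prems by metis
  ultimately show ?case by simp
qed

lemma Ck_on_subset: "Ck_on k S f \<Longrightarrow> T \<subseteq> S \<Longrightarrow> Ck_on k T f"
  by (induction k arbitrary: f) (auto intro: continuous_on_subset)

lemma Ck_on_imp_continuous_on: "Ck_on k S f \<Longrightarrow> continuous_on S f"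
  by (cases k) (auto intro!: continuous_at_imp_continuous_on differentiable_imp_continuous_within)

lemma Ck_on_SucD: "Ck_on (Suc k) S f \<Longrightarrow> Ck_on k S f"
proof (induction k arbitrary: f)
  case 0
  then show ?case using Ck_on_imp_continuous_on[of "Suc 0" S f] by simp
next
  case (Suc k)
  then show ?case by simp
qed

lemma Ck_on_SucI:
  assumes "open S" "\<And>x. x \<in> S \<Longrightarrow> (f has_derivative f' x) (at x)"
    "\<And>v. Ck_on k S (\<lambda>x. f' x v)"
  shows "Ck_on (Suc k) S f"
proof -
  have "FD f x = f' x" if "x \<in> S" for x
    using assms(2)[OF that] by (metis frechet_derivative_at)
  then have "Ck_on k S (\<lambda>x. FD f x v)" for v
    using assms(3)[of v] Ck_on_cong[OF assms(1), of "\<lambda>x. FD f x v" "\<lambda>x. f' x v"]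
    by simp
  then show ?thesis using assms(2) by (auto simp: differentiable_def)
qed

lemma Ck_on_SucE:
  assumes "Ck_on (Suc k) S f" "x \<in> S"
  shows "(f has_derivative FD f x) (at x)"
  using assms by (simp add: frechet_derivative_works[symmetric])

lemma Ck_on_const: "open S \<Longrightarrow> Ck_on k S (\<lambda>x. c)"
proof (induction k arbitrary: c)
  case (Suc k)
  then show ?case by (intro Ck_on_SucI[where f' = "\<lambda>x v. 0"]) auto
qed simp

lemma Ck_on_linear:
  assumes "open S" "linear f"
  shows "Ck_on k S f"
proof (cases k)
  case 0
  then show ?thesis using assms by (simp add: linear_continuous_on linear_conv_bounded_linear)
next
  case (Suc j)
  have "Ck_on (Suc j) S f"
    using assms by (intro Ck_on_SucI[where f' = "\<lambda>x. f"] Ck_on_const)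
      (auto intro: linear_imp_has_derivative)
  with Suc show ?thesis by simp
qed

lemma Ck_on_add:
  assumes "open S" "Ck_on k S f" "Ck_on k S g"
  shows "Ck_on k S (\<lambda>x. f x + g x)"
  using assms(2,3)
proof (induction k arbitrary: f g)
  case 0
  then show ?case by (simp add: continuous_on_add)
next
  case (Suc k)
  show ?case
    by (rule Ck_on_SucI[OF assms(1), where f' =
          "\<lambda>x v. FD f x v + FD g x v"])
      (use Suc.prems in \<open>auto intro!: has_derivative_add Ck_on_SucE[OF Suc.prems(1)]
         Ck_on_SucE[OF Suc.prems(2)] Suc.IH\<close>)
qed

lemma Ck_on_sum:
  assumes "open S" "finite I" "\<And>i. i \<in> I \<Longrightarrow> Ck_on k S (f i)"
  shows "Ck_on k S (\<lambda>x. \<Sum>i\<in>I. f i x)"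
  using assms(2,3)
  by (induction I rule: finite_induct) (auto intro: Ck_on_const Ck_on_add assms(1))

text \<open>The product rule writes the derivative as a sum of two values of the same bilinear map
  at C^k arguments, so the induction closes.\<close>

lemma Ck_on_bilinear:
  fixes prod :: "'a::euclidean_space \<Rightarrow> 'b::euclidean_space \<Rightarrow> 'c::euclidean_space"
  assumes "open S" "bounded_bilinear prod" "Ck_on k S f" "Ck_on k S g"
  shows "Ck_on k S (\<lambda>x. prod (f x) (g x))"
  using assms(3,4)
proof (induction k arbitrary: f g)
  case 0
  then show ?case using assms(2) by (simp add: bounded_bilinear.continuous_on)
next
  case (Suc k)
  note k = Ck_on_SucD[OF Suc.prems(1)] Ck_on_SucD[OF Suc.prems(2)]
  show ?case
    by (rule Ck_on_SucI[OF assms(1), where f' =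
          "\<lambda>x v. prod (f x) (FD g x v) + prod (FD f x v) (g x)"])
      (use Suc.prems k in \<open>auto intro!: bounded_bilinear.FDERIV[OF assms(2)] Ck_on_SucE[OF Suc.prems(1)]
         Ck_on_SucE[OF Suc.prems(2)] Suc.IH Ck_on_add assms(1)\<close>)
qed

lemmas Ck_on_scaleR = Ck_on_bilinear[OF _ bounded_bilinear_scaleR]
lemmas Ck_on_mult = Ck_on_bilinear[OF _ bounded_bilinear_mult]
lemmas Ck_on_inner = Ck_on_bilinear[OF _ bounded_bilinear_inner]

lemma linear_expand:
  fixes f :: "'a::euclidean_space \<Rightarrow> 'b::real_vector"
  assumes "linear f"
  shows "f v = (\<Sum>b\<in>Basis. (v \<bullet> b) *\<^sub>R f b)"
proof -
  have "f v = f (\<Sum>b\<in>Basis. (v \<bullet> b) *\<^sub>R b)" by (simp add: euclidean_representation)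
  also have "\<dots> = (\<Sum>b\<in>Basis. (v \<bullet> b) *\<^sub>R f b)"
    by (simp only: linear_sum[OF assms] linear_scale[OF assms])
  finally show ?thesis .
qed

text \<open>In the chain rule the direction \<open>FD f x v\<close> moves with \<open>x\<close>,
  while \<open>Ck_on\<close> speaks of fixed directions. Expanding it in \<open>Basis\<close> leaves
  a finite sum of products of C^k functions.\<close>

lemma Ck_on_compose:
  assumes "open S" "open T" "f ` S \<subseteq> T" "Ck_on k T g" "Ck_on k S f"
  shows "Ck_on k S (\<lambda>x. g (f x))"
  using assms(4,5)
proof (induction k arbitrary: g)
  case 0
  then show ?case using assms(3) by (auto intro: continuous_on_compose2)
next
  case (Suc k)
  show ?case
  proof (rule Ck_on_SucI[OF assms(1), where f' =
          "\<lambda>x v. \<Sum>b\<in>Basis. (FD f x v \<bullet> b) *\<^sub>R FD g (f x) b"])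
    fix x assume x: "x \<in> S"
    then have fx: "f x \<in> T" using assms(3) by auto
    note dg = Ck_on_SucE[OF Suc.prems(1) fx]
    have "((\<lambda>x. g (f x)) has_derivative
      (\<lambda>v. FD g (f x) (FD f x v))) (at x)"
      by (rule has_derivative_compose[OF Ck_on_SucE[OF Suc.prems(2) x] dg])
    also have "(\<lambda>v. FD g (f x) (FD f x v)) =
      (\<lambda>v. \<Sum>b\<in>Basis. (FD f x v \<bullet> b) *\<^sub>R FD g (f x) b)"
      by (rule ext) (rule linear_expand[OF has_derivative_linear[OF dg]])
    finally show "((\<lambda>x. g (f x)) has_derivative
      (\<lambda>v. \<Sum>b\<in>Basis. (FD f x v \<bullet> b) *\<^sub>R FD g (f x) b)) (at x)" .
  next
    fix v
    have "Ck_on k S (\<lambda>x. FD g (f x) b)" for b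
      using Suc.IH[OF spec[OF conjunct2[OF Suc.prems(1)[unfolded Ck_on.simps]]] Ck_on_SucD[OF Suc.prems(2)]] .
    then show "Ck_on k S (\<lambda>x. \<Sum>b\<in>Basis. (FD f x v \<bullet> b) *\<^sub>R FD g (f x) b)"
      using spec[OF conjunct2[OF Suc.prems(2)[unfolded Ck_on.simps]]]
      by (intro Ck_on_sum Ck_on_scaleR Ck_on_inner Ck_on_const assms(1) finite_Basis)
  qed
qed

lemma Ck_on_Union:
  assumes "\<And>S. S \<in> F \<Longrightarrow> open S" "\<And>S. S \<in> F \<Longrightarrow> Ck_on k S f"
  shows "Ck_on k (\<Union>F) f"
  using assms(2)
proof (induction k arbitrary: f)
  case 0
  then show ?case using continuous_on_open_Union[of F f] assms(1) by auto
next
  case (Suc k)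
  then show ?case by simp
qed

lemma smooth_on_cong:
  assumes "open S" "\<And>x. x \<in> S \<Longrightarrow> f x = g x"
  shows "smooth_on S f \<longleftrightarrow> smooth_on S g"
  unfolding smooth_on_def by (metis Ck_on_cong assms)

lemma smooth_on_subset: "smooth_on S f \<Longrightarrow> T \<subseteq> S \<Longrightarrow> smooth_on T f"
  unfolding smooth_on_def using Ck_on_subset by blast

lemma smooth_on_imp_continuous_on: "smooth_on S f \<Longrightarrow> continuous_on S f"
  unfolding smooth_on_def using Ck_on_imp_continuous_on by blast

lemma smooth_on_has_derivative:
  assumes "smooth_on S f" "x \<in> S"
  shows "(f has_derivative FD f x) (at x)"
  using assms Ck_on_SucE unfolding smooth_on_def by blast

lemma smooth_on_differentiable: "smooth_on S f \<Longrightarrow> x \<in> S \<Longrightarrow> f differentiable (at x)"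
  using smooth_on_has_derivative differentiable_def by blast

lemma smooth_on_linear_frechet: "smooth_on S f \<Longrightarrow> x \<in> S \<Longrightarrow> linear (FD f x)"
  using smooth_on_has_derivative has_derivative_linear by blast

lemma smooth_on_frechet_derivative:
  "smooth_on S f \<Longrightarrow> smooth_on S (\<lambda>x. FD f x v)"
  unfolding smooth_on_def by (metis Ck_on.simps(2))

lemma smooth_on_const: "open S \<Longrightarrow> smooth_on S (\<lambda>x. c)"
  unfolding smooth_on_def using Ck_on_const by blast

lemma smooth_on_linear: "open S \<Longrightarrow> linear f \<Longrightarrow> smooth_on S f"
  unfolding smooth_on_def using Ck_on_linear by blast

lemma smooth_on_add:
  "open S \<Longrightarrow> smooth_on S f \<Longrightarrow> smooth_on S g \<Longrightarrow> smooth_on S (\<lambda>x. f x + g x)"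
  unfolding smooth_on_def using Ck_on_add by blast

lemma smooth_on_sum:
  "open S \<Longrightarrow> finite I \<Longrightarrow> (\<And>i. i \<in> I \<Longrightarrow> smooth_on S (f i)) \<Longrightarrow> smooth_on S (\<lambda>x. \<Sum>i\<in>I. f i x)"
  unfolding smooth_on_def using Ck_on_sum by blast

lemma smooth_on_scaleR:
  "open S \<Longrightarrow> smooth_on S f \<Longrightarrow> smooth_on S g \<Longrightarrow> smooth_on S (\<lambda>x. f x *\<^sub>R g x)"
  unfolding smooth_on_def using Ck_on_scaleR by blast

lemma smooth_on_mult:
  fixes f g :: "'a::euclidean_space \<Rightarrow> real"
  shows "open S \<Longrightarrow> smooth_on S f \<Longrightarrow> smooth_on S g \<Longrightarrow> smooth_on S (\<lambda>x. f x * g x)"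
  unfolding smooth_on_def using Ck_on_mult by blast

lemma smooth_on_inner:
  "open S \<Longrightarrow> smooth_on S f \<Longrightarrow> smooth_on S g \<Longrightarrow> smooth_on S (\<lambda>x. f x \<bullet> g x)"
  unfolding smooth_on_def using Ck_on_inner by blast

lemma smooth_on_compose:
  "open S \<Longrightarrow> open T \<Longrightarrow> f ` S \<subseteq> T \<Longrightarrow> smooth_on T g \<Longrightarrow> smooth_on S f \<Longrightarrow>
    smooth_on S (\<lambda>x. g (f x))"
  unfolding smooth_on_def using Ck_on_compose by blast

lemma smooth_on_minus:
  fixes f :: "'a::euclidean_space \<Rightarrow> 'b::euclidean_space"
  assumes "open S" "smooth_on S f"
  shows "smooth_on S (\<lambda>x. - f x)"
  using smooth_on_compose[OF assms(1) open_UNIV _ smooth_on_linear[OF open_UNIV linear_uminus] assms(2)]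
  by simp

lemma smooth_on_diff:
  fixes f :: "'a::euclidean_space \<Rightarrow> 'b::euclidean_space"
  assumes "open S" "smooth_on S f" "smooth_on S g"
  shows "smooth_on S (\<lambda>x. f x - g x)"
  using smooth_on_add[OF assms(1,2) smooth_on_minus[OF assms(1,3)]] by simp

lemma smooth_on_Union:
  "(\<And>S. S \<in> F \<Longrightarrow> open S) \<Longrightarrow> (\<And>S. S \<in> F \<Longrightarrow> smooth_on S f) \<Longrightarrow> smooth_on (\<Union>F) f"
  unfolding smooth_on_def using Ck_on_Union by blast

text \<open>The derivative is a polynomial in \<open>inverse\<close> itself, so each degree of
  smoothness yields the next.\<close>

lemma smooth_on_inverse: "smooth_on (- {0::real}) inverse"
proof -
  have "Ck_on k (- {0::real}) inverse" for k
  proof (induction k)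
    case 0
    then show ?case by (auto intro!: continuous_intros)
  next
    case (Suc k)
    show ?case
      by (rule Ck_on_SucI[where f' = "\<lambda>x v. - (inverse x * v * inverse x)"])
        (auto intro!: has_derivative_inverse' Ck_on_mult Ck_on_const Suc
           Ck_on_compose[OF _ open_UNIV _ Ck_on_linear[OF open_UNIV linear_uminus]] simp: open_delete)
  qed
  then show ?thesis by (simp add: smooth_on_def)
qed

lemma smooth_on_exp: "smooth_on UNIV (exp :: real \<Rightarrow> real)"
proof -
  have "Ck_on k UNIV (exp :: real \<Rightarrow> real)" for k
  proof (induction k)
    case 0
    then show ?case by (auto intro!: continuous_intros)
  next
    case (Suc k)
    have "((exp::real\<Rightarrow>real) has_derivative (\<lambda>v. exp x * v)) (at x)" for x
      using DERIV_exp[of x] by (simp add: has_field_derivative_def)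
    then show ?case
      by (intro Ck_on_SucI[where f' = "\<lambda>x v. exp x * v"] Ck_on_mult Ck_on_const Suc) auto
  qed
  then show ?thesis by (simp add: smooth_on_def)
qed

subsection \<open>Derivatives of fields of linear and bilinear maps\<close>

text \<open>The product rule for a moving linear map at a moving vector. The map is differentiated
  at fixed arguments only; expanding \<open>a s\<close> in \<open>Basis\<close> reduces the claim to
  products with scalars.\<close>

lemma has_derivative_linear_field:
  fixes g :: "'t::real_normed_vector \<Rightarrow> 'a::euclidean_space \<Rightarrow> 'c::real_normed_vector"
  assumes g: "\<And>i. ((\<lambda>s. g s i) has_derivative (\<lambda>h. g' h i)) (at t)"
    and lg': "\<And>h. linear (g' h)" and T: "open T" "t \<in> T" and lg: "\<And>s. s \<in> T \<Longrightarrow> linear (g s)"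
    and a: "(a has_derivative a') (at t)"
  shows "((\<lambda>s. g s (a s)) has_derivative (\<lambda>h. g' h (a t) + g t (a' h))) (at t)"
proof -
  have "((\<lambda>s. \<Sum>i\<in>Basis. (a s \<bullet> i) *\<^sub>R g s i) has_derivative
      (\<lambda>h. \<Sum>i\<in>Basis. (a t \<bullet> i) *\<^sub>R g' h i + (a' h \<bullet> i) *\<^sub>R g t i)) (at t)"
    by (intro has_derivative_sum has_derivative_scaleR g has_derivative_inner_left a)
  moreover have "(\<Sum>i\<in>Basis. (a t \<bullet> i) *\<^sub>R g' h i + (a' h \<bullet> i) *\<^sub>R g t i) = g' h (a t) + g t (a' h)" for h
    by (simp add: sum.distrib linear_expand[OF lg', symmetric] linear_expand[OF lg[OF T(2)], symmetric])
  ultimately have "((\<lambda>s. \<Sum>i\<in>Basis. (a s \<bullet> i) *\<^sub>R g s i) has_derivative (\<lambda>h. g' h (a t) + g t (a' h))) (at t)"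
    by simp
  then show ?thesis
    by (rule has_derivative_transform_within_open[OF _ T]) (simp add: linear_expand[OF lg, symmetric])
qed

lemma linear_frechet_field:
  fixes g :: "'s::real_normed_vector \<Rightarrow> 'a::real_vector \<Rightarrow> 'c::real_normed_vector"
  assumes "open S" "y \<in> S" "\<And>s. s \<in> S \<Longrightarrow> linear (g s)" "\<And>i. (\<lambda>s. g s i) differentiable (at y)"
  shows "linear (\<lambda>i. FD (\<lambda>s. g s i) y h)"
proof
  have d: "((\<lambda>s. g s i) has_derivative FD (\<lambda>s. g s i) y) (at y)" for i
    using assms(4) frechet_derivative_works by blast
  fix a b
  have "((\<lambda>s. g s (a + b)) has_derivative
      (\<lambda>h. FD (\<lambda>s. g s a) y h + FD (\<lambda>s. g s b) y h)) (at y)"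
    by (rule has_derivative_transform_within_open[OF has_derivative_add[OF d d] assms(1,2)])
      (simp add: linear_add assms(3))
  then show "FD (\<lambda>s. g s (a + b)) y h =
      FD (\<lambda>s. g s a) y h + FD (\<lambda>s. g s b) y h"
    by (simp add: frechet_derivative_at[symmetric])
next
  have d: "((\<lambda>s. g s i) has_derivative FD (\<lambda>s. g s i) y) (at y)" for i
    using assms(4) frechet_derivative_works by blast
  fix r :: real and a
  have "((\<lambda>s. g s (r *\<^sub>R a)) has_derivative
      (\<lambda>h. r *\<^sub>R FD (\<lambda>s. g s a) y h)) (at y)"
    by (rule has_derivative_transform_within_open[OF has_derivative_scaleR_right[OF d] assms(1,2)])
      (simp add: linear_scale assms(3))
  then show "FD (\<lambda>s. g s (r *\<^sub>R a)) y h =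
      r *\<^sub>R FD (\<lambda>s. g s a) y h"
    by (simp add: frechet_derivative_at[symmetric])
qed

text \<open>Two applications of \<open>has_derivative_linear_field\<close>, one per argument. It
  differentiates metrics and the form K in coordinates, both under changes of charts and along
  curves.\<close>

lemma has_derivative_bilinear_field:
  fixes H :: "'s::real_normed_vector \<Rightarrow> 'a::euclidean_space \<Rightarrow> 'b::euclidean_space \<Rightarrow> real"
  assumes S: "open S" "x t \<in> S" and H: "\<And>y. y \<in> S \<Longrightarrow> bilinear (H y)"
    and dH: "\<And>i j. (\<lambda>y. H y i j) differentiable (at (x t))"
    and x: "(x has_derivative x') (at t)" and a: "(a has_derivative a') (at t)"
    and b: "(b has_derivative b') (at t)"
  shows "((\<lambda>s. H (x s) (a s) (b s)) has_derivative
    (\<lambda>h. FD (\<lambda>y. H y (a t) (b t)) (x t) (x' h) + H (x t) (a' h) (b t) +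
      H (x t) (a t) (b' h))) (at t)"
proof -
  have "isCont x t" using x has_derivative_continuous by blast
  then obtain T where T: "open T" "t \<in> T" "\<And>s. s \<in> T \<Longrightarrow> x s \<in> S"
    using S by (metis continuous_at_open)
  have l1: "linear (\<lambda>i. H y i j)" and l2: "linear (\<lambda>j. H y i j)" if "y \<in> S" for y i j
    using H[OF that] by (auto simp: bilinear_def)
  have d: "((\<lambda>s. H (x s) i j) has_derivative
      (\<lambda>h. FD (\<lambda>y. H y i j) (x t) (x' h))) (at t)" for i j
    using has_derivative_compose[OF x] dH frechet_derivative_works by blast
  have d2: "((\<lambda>s. H (x s) (a s) j) has_derivative
      (\<lambda>h. FD (\<lambda>y. H y (a t) j) (x t) (x' h) + H (x t) (a' h) j)) (at t)" for j
    by (rule has_derivative_linear_field[of "\<lambda>s i. H (x s) i j"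
          "\<lambda>h i. FD (\<lambda>y. H y i j) (x t) (x' h)", OF d _ T(1,2) _ a])
      (auto intro!: linear_frechet_field[OF S] l1 dH T(3))
  show ?thesis
    by (rule has_derivative_linear_field[of "\<lambda>s. H (x s) (a s)"
          "\<lambda>h j. FD (\<lambda>y. H y (a t) j) (x t) (x' h) + H (x t) (a' h) j", OF d2 _ T(1,2) _ b])
      (auto intro!: linear_compose_add linear_frechet_field[OF S] l2 dH T(3) S)
qed

subsection \<open>Symmetry of the second derivative\<close>

text \<open>Two mean value theorems: one along \<open>u\<close> for the increment over
  \<open>t *\<^sub>R v\<close>, and one along \<open>v\<close> for the derivative of
  \<open>f\<close> in direction \<open>u\<close>.\<close>

lemma second_difference:
  fixes f :: "'a::euclidean_space \<Rightarrow> real"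
  assumes f: "smooth_on (ball x r) f" and t: "t > 0" "t * (norm u + norm v) < r"
  shows "\<exists>y. dist x y \<le> t * (norm u + norm v) \<and>
    f (x + t *\<^sub>R u + t *\<^sub>R v) - f (x + t *\<^sub>R u) - f (x + t *\<^sub>R v) + f x =
    t\<^sup>2 * FD (\<lambda>y. FD f y u) y v"
proof -
  have nrm: "norm (a *\<^sub>R u + b *\<^sub>R v) \<le> t * (norm u + norm v)"
    if "0 \<le> a" "a \<le> t" "0 \<le> b" "b \<le> t" for a b
  proof -
    have "norm (a *\<^sub>R u + b *\<^sub>R v) \<le> a * norm u + b * norm v"
      using norm_triangle_ineq[of "a *\<^sub>R u" "b *\<^sub>R v"] that by simp
    also have "\<dots> \<le> t * norm u + t * norm v"
      using that by (intro add_mono mult_right_mono) auto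
    finally show ?thesis by (simp add: algebra_simps)
  qed
  have inb: "x + a *\<^sub>R u + b *\<^sub>R v \<in> ball x r" "dist x (x + a *\<^sub>R u + b *\<^sub>R v) \<le> t * (norm u + norm v)"
    if "0 \<le> a" "a \<le> t" "0 \<le> b" "b \<le> t" for a b
  proof -
    have "dist x (x + a *\<^sub>R u + b *\<^sub>R v) = norm (a *\<^sub>R u + b *\<^sub>R v)"
      by (metis add.assoc add_diff_cancel_left' dist_commute dist_norm)
    then show "x + a *\<^sub>R u + b *\<^sub>R v \<in> ball x r" "dist x (x + a *\<^sub>R u + b *\<^sub>R v) \<le> t * (norm u + norm v)"
      using nrm[OF that] t(2) by simp_all
  qed
  let ?k = "\<lambda>s. f (x + s *\<^sub>R u + t *\<^sub>R v) - f (x + s *\<^sub>R u)"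
  let ?Df = "\<lambda>y. FD f y"
  have dk: "(?k has_real_derivative ?Df (x + s *\<^sub>R u + t *\<^sub>R v) u - ?Df (x + s *\<^sub>R u) u) (at s)"
    if "0 \<le> s" "s \<le> t" for s
  proof -
    have 1: "((\<lambda>s. x + s *\<^sub>R u + b *\<^sub>R v) has_derivative (\<lambda>h. h *\<^sub>R u)) (at s)" for b
      by (auto intro!: derivative_eq_intros)
    have 2: "((\<lambda>s. f (x + s *\<^sub>R u + b *\<^sub>R v)) has_derivative (\<lambda>h. ?Df (x + s *\<^sub>R u + b *\<^sub>R v) (h *\<^sub>R u))) (at s)"
      if b: "0 \<le> b" "b \<le> t" for b
      by (rule has_derivative_compose[OF 1 smooth_on_has_derivative[OF f]])
        (rule inb(1)[OF \<open>0 \<le> s\<close> \<open>s \<le> t\<close> b])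
    have l: "linear (?Df (x + s *\<^sub>R u + b *\<^sub>R v))" if b: "0 \<le> b" "b \<le> t" for b
      by (rule smooth_on_linear_frechet[OF f inb(1)[OF \<open>0 \<le> s\<close> \<open>s \<le> t\<close> b]])
    have "(?k has_derivative (\<lambda>h. ?Df (x + s *\<^sub>R u + t *\<^sub>R v) (h *\<^sub>R u) - ?Df (x + s *\<^sub>R u) (h *\<^sub>R u))) (at s)"
      using has_derivative_diff[OF 2[of t] 2[of 0]] t by simp
    moreover have "(\<lambda>h. ?Df (x + s *\<^sub>R u + t *\<^sub>R v) (h *\<^sub>R u) - ?Df (x + s *\<^sub>R u) (h *\<^sub>R u)) =
        (*) (?Df (x + s *\<^sub>R u + t *\<^sub>R v) u - ?Df (x + s *\<^sub>R u) u)"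
      using l[of t] l[of 0] t by (simp add: linear_scale fun_eq_iff algebra_simps)
    ultimately show ?thesis unfolding has_field_derivative_def by (simp only:)
  qed
  obtain \<xi> where \<xi>: "0 < \<xi>" "\<xi> < t"
    "?k t - ?k 0 = (t - 0) * (?Df (x + \<xi> *\<^sub>R u + t *\<^sub>R v) u - ?Df (x + \<xi> *\<^sub>R u) u)"
    using MVT2[OF t(1), of ?k "\<lambda>s. ?Df (x + s *\<^sub>R u + t *\<^sub>R v) u - ?Df (x + s *\<^sub>R u) u"] dk by blast
  let ?l = "\<lambda>s. ?Df (x + \<xi> *\<^sub>R u + s *\<^sub>R v) u"
  let ?D2 = "\<lambda>y. FD (\<lambda>y. ?Df y u) y v"
  have dl: "(?l has_real_derivative ?D2 (x + \<xi> *\<^sub>R u + s *\<^sub>R v)) (at s)" if s: "0 \<le> s" "s \<le> t" for s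
  proof -
    note in1 = inb(1)[OF less_imp_le[OF \<xi>(1)] less_imp_le[OF \<xi>(2)] s]
    note g = smooth_on_frechet_derivative[OF f, of u]
    have 1: "((\<lambda>s. x + \<xi> *\<^sub>R u + s *\<^sub>R v) has_derivative (\<lambda>h. h *\<^sub>R v)) (at s)"
      by (auto intro!: derivative_eq_intros)
    have "(\<lambda>h. FD (\<lambda>y. ?Df y u) (x + \<xi> *\<^sub>R u + s *\<^sub>R v) (h *\<^sub>R v)) =
        (*) (?D2 (x + \<xi> *\<^sub>R u + s *\<^sub>R v))"
      using smooth_on_linear_frechet[OF g in1] by (simp add: linear_scale fun_eq_iff)
    then show ?thesis
      using has_derivative_compose[OF 1 smooth_on_has_derivative[OF g in1]]
      unfolding has_field_derivative_def by (simp only:)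
  qed
  obtain \<eta> where \<eta>: "0 < \<eta>" "\<eta> < t" "?l t - ?l 0 = (t - 0) * ?D2 (x + \<xi> *\<^sub>R u + \<eta> *\<^sub>R v)"
    using MVT2[OF t(1), of ?l "\<lambda>s. ?D2 (x + \<xi> *\<^sub>R u + s *\<^sub>R v)"] dl by blast
  show ?thesis
    using \<xi>(3) \<eta>(3) inb(2)[of \<xi> \<eta>] \<xi>(1,2) \<eta>(1,2)
    by (intro exI[of _ "x + \<xi> *\<^sub>R u + \<eta> *\<^sub>R v"]) (simp add: power2_eq_square algebra_simps)
qed

text \<open>The second difference is symmetric in \<open>u\<close> and \<open>v\<close>, so the two
  mixed derivatives agree at suitable points arbitrarily close to \<open>x\<close>, hence at
  \<open>x\<close> by continuity.\<close>

lemma second_derivative_symmetric_real: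
  fixes f :: "'a::euclidean_space \<Rightarrow> real"
  assumes S: "open S" "x \<in> S" and f: "smooth_on S f"
  shows "FD (\<lambda>y. FD f y u) x v =
    FD (\<lambda>y. FD f y v) x u"
proof (rule ccontr)
  define a where "a = (\<lambda>y. FD (\<lambda>y. FD f y u) y v)"
  define b where "b = (\<lambda>y. FD (\<lambda>y. FD f y v) y u)"
  assume "\<not> ?thesis"
  then have e: "dist (a x) (b x) / 2 > 0" by (simp add: a_def b_def)
  have "smooth_on S a" "smooth_on S b"
    unfolding a_def b_def using f smooth_on_frechet_derivative by blast+
  then have "isCont a x" "isCont b x"
    using S smooth_on_imp_continuous_on continuous_on_eq_continuous_at by blast+
  then obtain d1 d2 where d: "d1 > 0" "d2 > 0"
    "\<And>y. dist y x < d1 \<Longrightarrow> dist (a y) (a x) < dist (a x) (b x) / 2"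
    "\<And>y. dist y x < d2 \<Longrightarrow> dist (b y) (b x) < dist (a x) (b x) / 2"
    using e unfolding continuous_at_eps_delta by metis
  obtain r where r: "r > 0" "ball x r \<subseteq> S" using S open_contains_ball by blast
  define m where "m = min (min d1 d2) r"
  \<comment> \<open>The summand 1 keeps the denominator positive when \<open>u\<close> and
    \<open>v\<close> are 0, and the factor 2 puts both intermediate points strictly within distance
    \<open>m\<close> of \<open>x\<close>.\<close>
  define t where "t = m / (2 * (norm u + norm v + 1))"
  have m: "m > 0" using d r by (simp add: m_def)
  have pos: "norm u + norm v + 1 > 0" by (simp add: add_nonneg_pos)
  have t: "t > 0" using m pos by (simp add: t_def)
  have "t * (norm u + norm v) \<le> t * (norm u + norm v + 1)" using t by simp
  also have "\<dots> = m / 2"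
  proof -
    have "m / (2 * q) * q = m / 2" if "q > 0" for q :: real using that by simp
    from this[OF pos] show ?thesis by (simp only: t_def)
  qed
  also have "\<dots> < m" using m by simp
  finally have tm: "t * (norm u + norm v) < m" .
  have fr: "smooth_on (ball x r) f" using f r smooth_on_subset by blast
  have tr: "t * (norm u + norm v) < r" "t * (norm v + norm u) < r" using tm by (simp_all add: m_def add.commute)
  obtain y where y: "dist x y \<le> t * (norm u + norm v)"
    "f (x + t *\<^sub>R u + t *\<^sub>R v) - f (x + t *\<^sub>R u) - f (x + t *\<^sub>R v) + f x = t\<^sup>2 * a y"
    unfolding a_def using second_difference[OF fr t tr(1)] by blast
  obtain z where z: "dist x z \<le> t * (norm v + norm u)"
    "f (x + t *\<^sub>R v + t *\<^sub>R u) - f (x + t *\<^sub>R v) - f (x + t *\<^sub>R u) + f x = t\<^sup>2 * b z"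
    unfolding b_def using second_difference[OF fr t tr(2)] by blast
  have "t\<^sup>2 * a y = t\<^sup>2 * b z"
    using y(2) z(2) by (simp add: algebra_simps)
  then have "a y = b z" using t by simp
  moreover have "dist (a y) (a x) < dist (a x) (b x) / 2" "dist (b z) (b x) < dist (a x) (b x) / 2"
  proof -
    have "dist y x < d1" "dist z x < d2"
      using y(1) z(1) tm by (auto simp: m_def dist_commute add.commute)
    then show "dist (a y) (a x) < dist (a x) (b x) / 2" "dist (b z) (b x) < dist (a x) (b x) / 2"
      using d by blast+
  qed
  ultimately show False by (smt (verit) dist_commute dist_triangle field_sum_of_halves)
qed

lemma frechet_derivative_inner_left:
  assumes "f differentiable (at y)"
  shows "FD (\<lambda>x. f x \<bullet> b) y v = FD f y v \<bullet> b"
proof -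
  have "(f has_derivative FD f y) (at y)"
    using assms frechet_derivative_works by blast
  from has_derivative_inner_left[OF this, of b] show ?thesis
    by (simp add: frechet_derivative_at[symmetric])
qed

lemma second_derivative_symmetric:
  fixes f :: "'a::euclidean_space \<Rightarrow> 'b::euclidean_space"
  assumes S: "open S" "x \<in> S" and f: "smooth_on S f"
  shows "FD (\<lambda>y. FD f y u) x v =
    FD (\<lambda>y. FD f y v) x u"
proof (rule euclidean_eqI)
  fix b :: 'b assume "b \<in> Basis"
  have fb: "smooth_on S (\<lambda>x. f x \<bullet> b)" by (intro smooth_on_inner smooth_on_const f S)
  have "FD (\<lambda>y. FD f y u) x v \<bullet> b =
      FD (\<lambda>y. FD (\<lambda>x. f x \<bullet> b) y u) x v" for u v
  proof -
    have d: "(\<lambda>y. FD f y u) differentiable (at x)"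
      using smooth_on_differentiable[OF smooth_on_frechet_derivative[OF f]] S by blast
    have "FD (\<lambda>y. FD f y u) x v \<bullet> b =
        FD (\<lambda>y. FD f y u \<bullet> b) x v"
      using frechet_derivative_inner_left[OF d] by simp
    also have "FD (\<lambda>y. FD f y u \<bullet> b) x =
        FD (\<lambda>y. FD (\<lambda>x. f x \<bullet> b) y u) x"
      by (rule frechet_derivative_transform_within_open[OF _ S])
        (auto simp: frechet_derivative_inner_left smooth_on_differentiable[OF f]
          intro!: differentiable_inner d)
    finally show ?thesis .
  qed
  then show "FD (\<lambda>y. FD f y u) x v \<bullet> b =
      FD (\<lambda>y. FD f y v) x u \<bullet> b"
    using second_derivative_symmetric_real[OF S fb] by simp
qed

subsection \<open>Smooth solutions of linear equations\<close>

lemma linear_combination_Basis: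
  fixes f :: "'b::euclidean_space \<Rightarrow> 'a::real_vector \<Rightarrow> real"
  assumes "\<And>b. linear (f b)"
  shows "linear (\<lambda>u. \<Sum>b\<in>Basis. f b u *\<^sub>R b)"
  by (rule linearI)
    (simp_all add: linear_add[OF assms] linear_scale[OF assms] scaleR_add_left sum.distrib scaleR_sum_right)

text \<open>Positive definiteness makes the map \<open>A\<close> with entries \<open>G u b\<close>
  injective, hence surjective by dimension. Gradients, Christoffel symbols and horizontal
  projections all come from this.\<close>

lemma bilinear_pos_def_solve:
  fixes G :: "'a::euclidean_space \<Rightarrow> 'a \<Rightarrow> real"
  assumes G: "bilinear G" "\<And>z. z \<noteq> 0 \<Longrightarrow> G z z > 0" and l: "linear l"
  shows "\<exists>!u. \<forall>z. G u z = l z"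
proof -
  have lG: "linear (\<lambda>u. G u z)" "linear (G u)" for u z using G(1) by (auto simp: bilinear_def)
  define A where "A = (\<lambda>u. \<Sum>b\<in>Basis. G u b *\<^sub>R b)"
  have A: "A u \<bullet> b = G u b" if "b \<in> Basis" for u b using that by (simp add: A_def)
  have eqI: "G u = l'" if "linear l'" "\<And>b. b \<in> Basis \<Longrightarrow> G u b = l' b" for u l'
  proof
    show "G u v = l' v" for v
      by (subst linear_expand[OF lG(2)], subst linear_expand[OF that(1)]) (simp add: that(2))
  qed
  have "linear A"
    unfolding A_def by (rule linear_combination_Basis) (rule lG(1))
  moreover have "inj A"
    unfolding linear_injective_0[OF \<open>linear A\<close>]
  proof (intro allI impI)
    fix u assume "A u = 0"
    then have "G u b = 0" if "b \<in> Basis" for b using A[OF that, of u] by simp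
    then have "G u u = 0" by (subst linear_expand[OF lG(2)]) simp
    then show "u = 0" using G(2)[of u] by fastforce
  qed
  ultimately have "surj A" by (simp add: linear_injective_imp_surjective)
  then obtain u where u: "A u = (\<Sum>b\<in>Basis. l b *\<^sub>R b)" by (metis surjD)
  have "G u = l"
    by (rule eqI[OF l]) (simp add: A[symmetric] u)
  moreover have "u' = u" if "\<forall>z. G u' z = l z" for u'
  proof -
    have "G (u' - u) (u' - u) = 0"
      using that \<open>G u = l\<close> by (simp add: linear_diff[OF lG(1)])
    then show ?thesis using G(2)[of "u' - u"] by fastforce
  qed
  ultimately show ?thesis by blast
qed

text \<open>A product rule that asks only continuity of \<open>\<alpha>\<close>: as
  \<open>\<beta>\<close> vanishes at \<open>x\<close>, replacing \<open>\<alpha> y\<close> by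
  \<open>\<alpha> x\<close> costs o(|y - x|). It breaks a circle in
  \<open>solve_differentiable\<close>, where the scalar factor is a coordinate of the very function
  whose differentiability is sought.\<close>

lemma has_derivative_scaleR_zero:
  fixes \<beta> :: "'s::real_normed_vector \<Rightarrow> 'b::real_normed_vector"
  assumes b: "(\<beta> has_derivative \<beta>') (at x)" "\<beta> x = 0" and a: "isCont \<alpha> x"
  shows "((\<lambda>y. \<alpha> y *\<^sub>R \<beta> y) has_derivative (\<lambda>h. \<alpha> x *\<^sub>R \<beta>' h)) (at x)"
proof -
  have bl: "bounded_linear \<beta>'" using b(1) has_derivative_bounded_linear by blast
  then obtain K where K: "K > 0" "\<And>h. norm (\<beta>' h) \<le> norm h * K" using bounded_linear.pos_bounded by blast
  have "((\<lambda>y. (\<alpha> y - \<alpha> x) *\<^sub>R \<beta> y) has_derivative (\<lambda>h. 0)) (at x)"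
    unfolding has_derivative_at_alt
  proof (intro conjI allI impI)
    fix e :: real assume e: "e > 0"
    \<comment> \<open>Near \<open>x\<close> the norm of \<open>\<beta> y\<close> is at most K + 1
      times |y - x|: \<open>K\<close> bounds the derivative and 1 the remainder.\<close>
    have "e / (K + 1) > 0" using e K by simp
    then obtain d1 where d1: "d1 > 0" "\<And>y. norm (y - x) < d1 \<Longrightarrow> \<bar>\<alpha> y - \<alpha> x\<bar> < e / (K + 1)"
      using a unfolding continuous_at_eps_delta dist_norm real_norm_def by metis
    obtain d2 where d2: "d2 > 0" "\<And>y. norm (y - x) < d2 \<Longrightarrow> norm (\<beta> y - \<beta> x - \<beta>' (y - x)) \<le> 1 * norm (y - x)"
      using b(1) unfolding has_derivative_at_alt by (meson zero_less_one)
    show "\<exists>d>0. \<forall>y. norm (y - x) < d \<longrightarrow>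
        norm ((\<alpha> y - \<alpha> x) *\<^sub>R \<beta> y - (\<alpha> x - \<alpha> x) *\<^sub>R \<beta> x - 0) \<le> e * norm (y - x)"
    proof (intro exI[of _ "min d1 d2"] conjI allI impI)
      fix y assume y: "norm (y - x) < min d1 d2"
      have "norm (\<beta> y) \<le> norm (\<beta> y - \<beta> x - \<beta>' (y - x)) + norm (\<beta>' (y - x))"
        using norm_triangle_ineq[of "\<beta> y - \<beta> x - \<beta>' (y - x)" "\<beta>' (y - x)"] b(2) by simp
      also have "\<dots> \<le> (K + 1) * norm (y - x)"
        using d2(2)[of y] K(2)[of "y - x"] y by (simp add: algebra_simps)
      finally have "norm (\<beta> y) \<le> (K + 1) * norm (y - x)" .
      then have "\<bar>\<alpha> y - \<alpha> x\<bar> * norm (\<beta> y) \<le> (e / (K + 1)) * ((K + 1) * norm (y - x))"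
        using d1(2)[of y] y by (intro mult_mono) auto
      then show "norm ((\<alpha> y - \<alpha> x) *\<^sub>R \<beta> y - (\<alpha> x - \<alpha> x) *\<^sub>R \<beta> x - 0) \<le> e * norm (y - x)"
        using K(1) by simp
    qed (use d1 d2 in auto)
  qed simp
  from has_derivative_add[OF has_derivative_scaleR_right[OF b(1), of "\<alpha> x"] this]
  show ?thesis by (simp add: algebra_simps)
qed

section \<open>Smooth dependence on x of the solution u(x) of G(x)(u(x), z) = w(x, z) for all
  z\<close>

context
  fixes G :: "'s::euclidean_space \<Rightarrow> 'a::euclidean_space \<Rightarrow> 'a \<Rightarrow> real" and S :: "'s set"
  assumes S: "open S" and bG: "\<And>x. x \<in> S \<Longrightarrow> bilinear (G x)"
    and pG: "\<And>x z. x \<in> S \<Longrightarrow> z \<noteq> 0 \<Longrightarrow> G x z z > 0"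
    and sG: "\<And>a b. smooth_on S (\<lambda>x. G x a b)"
begin

text \<open>Only the matrix at the fixed point \<open>x\<close> is inverted: A_x u = (A_x - A_y) u +
  A_y u, followed by a left inverse \<open>L\<close> of A_x. The correction has coefficients that
  vanish at y = x, which is what continuity and differentiability of solutions rest on.\<close>

lemma solve_fixed_point_form:
  assumes x: "x \<in> S"
  obtains L :: "'a \<Rightarrow> 'a" where "bounded_linear L"
    "\<And>y u w. y \<in> S \<Longrightarrow> (\<And>z. G y u z = w z) \<Longrightarrow>
       u = L ((\<Sum>i\<in>Basis. (u \<bullet> i) *\<^sub>R (\<Sum>b\<in>Basis. (G x i b - G y i b) *\<^sub>R b)) + (\<Sum>b\<in>Basis. w b *\<^sub>R b))"
proof -
  have lG: "linear (\<lambda>u. G y u z)" if "y \<in> S" for y z using bG[OF that] by (auto simp: bilinear_def)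
  define A where "A = (\<lambda>y u. \<Sum>b\<in>Basis. G y u b *\<^sub>R b)"
  have lA: "linear (A y)" if "y \<in> S" for y
    unfolding A_def by (rule linear_combination_Basis) (rule lG[OF that])
  have inj: "inj (A x)"
    unfolding linear_injective_0[OF lA[OF x]]
  proof (intro allI impI)
    fix u assume u: "A x u = 0"
    have "G x u b = A x u \<bullet> b" if "b \<in> Basis" for b using that by (simp add: A_def)
    then have "G x u b = 0" if "b \<in> Basis" for b using that u by simp
    moreover have "linear (G x u)" using bG[OF x] by (auto simp: bilinear_def)
    ultimately have "G x u u = 0" by (subst linear_expand[OF \<open>linear (G x u)\<close>]) simp
    then show "u = 0" using pG[OF x, of u] by fastforce
  qed
  then obtain L where L: "linear L" "L \<circ> A x = id"
    using linear_injective_left_inverse[OF lA[OF x]] by blast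
  show ?thesis
  proof
    show "bounded_linear L" using L(1) linear_conv_bounded_linear by blast
    fix y u w assume y: "y \<in> S" and w: "\<And>z. G y u z = w z"
    have Ay: "A y u = (\<Sum>b\<in>Basis. w b *\<^sub>R b)" by (simp add: A_def w)
    have "A x u - A y u = (\<Sum>i\<in>Basis. (u \<bullet> i) *\<^sub>R (A x i - A y i))"
      by (simp add: linear_expand[OF lA[OF x], of u] linear_expand[OF lA[OF y], of u]
          scaleR_diff_right sum_subtractf)
    also have "\<dots> = (\<Sum>i\<in>Basis. (u \<bullet> i) *\<^sub>R (\<Sum>b\<in>Basis. (G x i b - G y i b) *\<^sub>R b))"
      by (simp add: A_def scaleR_diff_left sum_subtractf)
    finally have "A x u = (\<Sum>i\<in>Basis. (u \<bullet> i) *\<^sub>R (\<Sum>b\<in>Basis. (G x i b - G y i b) *\<^sub>R b)) + (\<Sum>b\<in>Basis. w b *\<^sub>R b)"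
      by (simp add: Ay algebra_simps)
    then have "L (A x u) = L ((\<Sum>i\<in>Basis. (u \<bullet> i) *\<^sub>R (\<Sum>b\<in>Basis. (G x i b - G y i b) *\<^sub>R b)) + (\<Sum>b\<in>Basis. w b *\<^sub>R b))"
      by simp
    moreover have "L (A x u) = u" using L(2) by (metis comp_apply id_apply)
    ultimately show "u = L ((\<Sum>i\<in>Basis. (u \<bullet> i) *\<^sub>R (\<Sum>b\<in>Basis. (G x i b - G y i b) *\<^sub>R b)) + (\<Sum>b\<in>Basis. w b *\<^sub>R b))"
      by simp
  qed
qed

lemma solve_continuous:
  assumes cw: "\<And>z. continuous_on S (\<lambda>x. w x z)" and u: "\<And>x z. x \<in> S \<Longrightarrow> G x (u x) z = w x z"
  shows "continuous_on S u"
proof -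
  have "isCont u x" if x: "x \<in> S" for x
  proof -
    obtain L where L: "bounded_linear L"
      "\<And>y u w. y \<in> S \<Longrightarrow> (\<And>z. G y u z = w z) \<Longrightarrow>
         u = L ((\<Sum>i\<in>Basis. (u \<bullet> i) *\<^sub>R (\<Sum>b\<in>Basis. (G x i b - G y i b) *\<^sub>R b)) + (\<Sum>b\<in>Basis. w b *\<^sub>R b))"
      using solve_fixed_point_form[OF x] by blast
    note Ladd = linear_add[OF bounded_linear.linear[OF L(1)]] linear_diff[OF bounded_linear.linear[OF L(1)]]
    obtain K where K: "K > 0" "\<And>h. norm (L h) \<le> norm h * K" using L(1) bounded_linear.pos_bounded by blast
    define p where "p = (\<lambda>y. K * (\<Sum>i\<in>Basis. norm (\<Sum>b\<in>Basis. (G x i b - G y i b) *\<^sub>R b)))"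
    define q where "q = (\<lambda>y. K * norm ((\<Sum>b\<in>Basis. w y b *\<^sub>R b) - (\<Sum>b\<in>Basis. w x b *\<^sub>R b)))"
    have "isCont (\<lambda>y. G y i b) x" "isCont (\<lambda>y. w y b) x" for i b
      using smooth_on_imp_continuous_on[OF sG] cw x S continuous_on_eq_continuous_at by blast+
    then have "isCont p x" "isCont q x" unfolding p_def q_def by (auto intro!: continuous_intros)
    moreover have "p x = 0" "q x = 0" by (simp_all add: p_def q_def)
    ultimately have p0: "(p \<longlongrightarrow> 0) (at x)" and q0: "(q \<longlongrightarrow> 0) (at x)"
      by (metis isCont_def)+
    \<comment> \<open>The correction term contributes at most \<open>p y\<close> times |u y|. Once
      \<open>p y < 1/2\<close>, half of |u y - u x| is absorbed on the left, whence the factor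
      2.\<close>
    have key: "norm (u y - u x) \<le> 2 * (q y + p y * norm (u x))" if y: "y \<in> S" "p y < 1/2" for y
    proof -
      define N where "N = (\<Sum>i\<in>Basis. (u y \<bullet> i) *\<^sub>R (\<Sum>b\<in>Basis. (G x i b - G y i b) *\<^sub>R b))"
      have "u y = L (N + (\<Sum>b\<in>Basis. w y b *\<^sub>R b))"
        using L(2)[OF y(1) u[OF y(1)]] by (simp add: N_def)
      moreover have "u x = L (\<Sum>b\<in>Basis. w x b *\<^sub>R b)"
        using L(2)[OF x u[OF x]] by simp
      ultimately have "u y - u x = L N + L ((\<Sum>b\<in>Basis. w y b *\<^sub>R b) - (\<Sum>b\<in>Basis. w x b *\<^sub>R b))"
        by (simp add: Ladd)
      also have "norm \<dots> \<le> norm N * K + q y"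
        by (rule order_trans[OF norm_triangle_ineq add_mono[OF K(2)]]) (use K(2) in \<open>simp add: q_def mult.commute\<close>)
      also have "norm N \<le> (\<Sum>i\<in>Basis. norm (u y) * norm (\<Sum>b\<in>Basis. (G x i b - G y i b) *\<^sub>R b))"
        unfolding N_def by (rule sum_norm_le) (auto intro!: mult_right_mono simp: Basis_le_norm)
      then have "norm N * K \<le> p y * norm (u y)"
        using K(1) by (simp add: p_def sum_distrib_left[symmetric] mult.assoc mult.left_commute mult.commute)
      also have "p y * norm (u y) \<le> p y * (norm (u y - u x) + norm (u x))"
        using norm_triangle_sub[of "u y" "u x"] K(1)
        by (intro mult_left_mono) (auto simp: p_def sum_nonneg add.commute)
      finally have "norm (u y - u x) \<le> p y * norm (u y - u x) + p y * norm (u x) + q y"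
        by (simp add: algebra_simps)
      moreover have "p y * norm (u y - u x) \<le> 1/2 * norm (u y - u x)"
        using y(2) by (intro mult_right_mono) auto
      ultimately show ?thesis by (simp add: algebra_simps)
    qed
    have "\<forall>\<^sub>F y in at x. y \<in> S" using S x eventually_at_topological by blast
    moreover have "\<forall>\<^sub>F y in at x. p y < 1/2" using p0 by (rule order_tendstoD) simp
    ultimately have ev: "\<forall>\<^sub>F y in at x. norm (u y - u x) \<le> 2 * (q y + p y * norm (u x))"
      by eventually_elim (rule key)
    have "((\<lambda>y. 2 * (q y + p y * norm (u x))) \<longlongrightarrow> 2 * (0 + 0 * norm (u x))) (at x)"
      by (intro tendsto_intros p0 q0)
    then have "((\<lambda>y. u y - u x) \<longlongrightarrow> 0) (at x)"
      using Lim_null_comparison[OF ev] by simp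
    then show ?thesis by (simp add: isCont_def LIM_zero_iff)
  qed
  then show ?thesis by (simp add: continuous_at_imp_continuous_on)
qed

text \<open>In the fixed point form each coordinate of \<open>u\<close>, so far known only to be
  continuous, multiplies a differentiable coefficient that vanishes at \<open>x\<close>;
  \<open>has_derivative_scaleR_zero\<close> handles such products.\<close>

lemma solve_differentiable:
  assumes dw: "\<And>x z. x \<in> S \<Longrightarrow> (\<lambda>x. w x z) differentiable (at x)"
    and u: "\<And>x z. x \<in> S \<Longrightarrow> G x (u x) z = w x z" and x: "x \<in> S"
  shows "u differentiable (at x)"
proof -
  obtain L where L: "bounded_linear L"
    "\<And>y u w. y \<in> S \<Longrightarrow> (\<And>z. G y u z = w z) \<Longrightarrow>
       u = L ((\<Sum>i\<in>Basis. (u \<bullet> i) *\<^sub>R (\<Sum>b\<in>Basis. (G x i b - G y i b) *\<^sub>R b)) + (\<Sum>b\<in>Basis. w b *\<^sub>R b))"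
    using solve_fixed_point_form[OF x] by blast
  have "continuous_on S u"
    by (rule solve_continuous[OF _ u])
      (use dw in \<open>auto intro!: continuous_at_imp_continuous_on differentiable_imp_continuous_within\<close>)
  then have cu: "isCont (\<lambda>y. u y \<bullet> i) x" for i
    using S x by (auto simp: continuous_on_eq_continuous_at intro!: continuous_intros)
  have 1: "(\<lambda>y. (u y \<bullet> i) *\<^sub>R (\<Sum>b\<in>Basis. (G x i b - G y i b) *\<^sub>R b)) differentiable (at x)" for i
  proof -
    have "(\<lambda>y. \<Sum>b\<in>Basis. (G x i b - G y i b) *\<^sub>R b) differentiable (at x)"
      by (intro differentiable_sum finite_Basis ballI differentiable_scaleR differentiable_diff
          differentiable_const smooth_on_differentiable[OF sG x])
    then show ?thesis
      using has_derivative_scaleR_zero[OF _ _ cu] unfolding differentiable_def by fastforce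
  qed
  have "(\<lambda>y. L ((\<Sum>i\<in>Basis. (u y \<bullet> i) *\<^sub>R (\<Sum>b\<in>Basis. (G x i b - G y i b) *\<^sub>R b)) +
      (\<Sum>b\<in>Basis. w y b *\<^sub>R b))) differentiable (at x)"
  proof -
    have "(\<lambda>y. (\<Sum>i\<in>Basis. (u y \<bullet> i) *\<^sub>R (\<Sum>b\<in>Basis. (G x i b - G y i b) *\<^sub>R b)) +
        (\<Sum>b\<in>Basis. w y b *\<^sub>R b)) differentiable (at x)"
      by (intro differentiable_add differentiable_sum finite_Basis ballI 1 differentiable_scaleR
          differentiable_const dw x)
    then show ?thesis
      unfolding differentiable_def using bounded_linear.has_derivative[OF L(1)] by blast
  qed
  then obtain D where "((\<lambda>y. L ((\<Sum>i\<in>Basis. (u y \<bullet> i) *\<^sub>R (\<Sum>b\<in>Basis. (G x i b - G y i b) *\<^sub>R b)) +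
      (\<Sum>b\<in>Basis. w y b *\<^sub>R b))) has_derivative D) (at x)"
    unfolding differentiable_def by blast
  then have "(u has_derivative D) (at x)"
    by (rule has_derivative_transform_within_open[OF _ S x]) (rule L(2)[symmetric], auto intro: u)
  then show ?thesis by (auto simp: differentiable_def)
qed

text \<open>Differentiating the equation in direction \<open>v\<close> shows that the derivative of
  \<open>u\<close> solves a system with the same \<open>G\<close>, whose right side involves only
  \<open>u\<close> and first derivatives of \<open>w\<close> and \<open>G\<close>. Hence the
  induction is over all \<open>w\<close> and \<open>u\<close> at once.\<close>

lemma Ck_on_solve:
  assumes "\<And>z. Ck_on k S (\<lambda>x. w x z)" "\<And>x z. x \<in> S \<Longrightarrow> G x (u x) z = w x z"
  shows "Ck_on k S u"
  using assms
proof (induction k arbitrary: w u)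
  case 0
  then show ?case using solve_continuous[of w u] by simp
next
  case (Suc k)
  let ?D = "\<lambda>x v. FD u x v"
  have du: "(u has_derivative ?D x) (at x)" if "x \<in> S" for x
  proof -
    have "u differentiable (at x)"
      using solve_differentiable[of w u x] Suc.prems that by auto
    then show ?thesis using frechet_derivative_works by blast
  qed
  have kD: "Ck_on k S u" using Suc.IH[of w u] Suc.prems Ck_on_SucD by blast
  have eq: "G x (?D x v) z = FD (\<lambda>x. w x z) x v -
      (\<Sum>i\<in>Basis. (u x \<bullet> i) * FD (\<lambda>x. G x i z) x v)" if x: "x \<in> S" for x v z
  proof -
    have dG: "\<And>i. (\<lambda>y. G y i z) differentiable (at x)" using sG smooth_on_differentiable x by blast
    have lG: "linear (\<lambda>i. G y i z)" if "y \<in> S" for y using bG[OF that] by (auto simp: bilinear_def)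
    have "((\<lambda>y. G y (u y) z) has_derivative
        (\<lambda>h. FD (\<lambda>y. G y (u x) z) x h + G x (?D x h) z)) (at x)"
      by (rule has_derivative_linear_field[of "\<lambda>s i. G s i z" "\<lambda>h i. FD (\<lambda>y. G y i z) x h",
            OF _ _ S x lG du[OF x]])
        (use dG frechet_derivative_works in blast, rule linear_frechet_field[OF S x lG dG])
    then have "((\<lambda>x. w x z) has_derivative
        (\<lambda>h. FD (\<lambda>y. G y (u x) z) x h + G x (?D x h) z)) (at x)"
      by (rule has_derivative_transform_within_open[OF _ S x]) (simp add: Suc.prems)
    then have "FD (\<lambda>x. w x z) x v =
        FD (\<lambda>y. G y (u x) z) x v + G x (?D x v) z"
      by (simp add: frechet_derivative_at[symmetric])
    moreover have "FD (\<lambda>y. G y (u x) z) x v =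
        (\<Sum>i\<in>Basis. (u x \<bullet> i) * FD (\<lambda>x. G x i z) x v)"
      using linear_expand[OF linear_frechet_field[OF S x lG dG], of "u x" v] by simp
    ultimately show ?thesis by simp
  qed
  have "Ck_on k S (\<lambda>x. ?D x v)" for v
  proof (rule Suc.IH[OF _ eq])
    fix z
    have "Ck_on k S (\<lambda>x. FD (\<lambda>x. w x z) x v)"
      using Suc.prems(1)[of z] by simp
    moreover have "Ck_on k S (\<lambda>x. \<Sum>i\<in>Basis. (u x \<bullet> i) * FD (\<lambda>x. G x i z) x v)"
      using smooth_on_frechet_derivative[OF sG] unfolding smooth_on_def
      by (intro Ck_on_sum Ck_on_mult Ck_on_inner Ck_on_const kD S) auto
    ultimately have "Ck_on k S (\<lambda>x. FD (\<lambda>x. w x z) x v +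
        (-1) *\<^sub>R (\<Sum>i\<in>Basis. (u x \<bullet> i) * FD (\<lambda>x. G x i z) x v))"
      by (intro Ck_on_add Ck_on_scaleR Ck_on_const S)
    then show "Ck_on k S (\<lambda>x. FD (\<lambda>x. w x z) x v -
        (\<Sum>i\<in>Basis. (u x \<bullet> i) * FD (\<lambda>x. G x i z) x v))"
      by simp
  qed
  then show ?case by (intro Ck_on_SucI[OF S du])
qed

lemma smooth_on_solve:
  assumes "\<And>z. smooth_on S (\<lambda>x. w x z)" "\<And>x z. x \<in> S \<Longrightarrow> G x (u x) z = w x z"
  shows "smooth_on S u"
  using assms Ck_on_solve unfolding smooth_on_def by blast

end

subsection \<open>Local existence for ordinary differential equations\<close>

text \<open>Continuity of the derivative is known direction by direction, so its operator norm is
  bounded by the sum of the bounds for basis directions; the mean value inequality on the convex set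
  \<open>D\<close> does the rest.\<close>

lemma Ck_on_1_lipschitz:
  fixes Y :: "'e::euclidean_space \<Rightarrow> 'b::euclidean_space"
  assumes Y: "Ck_on (Suc 0) W Y" and D: "D \<subseteq> W" "compact D" "convex D"
  obtains L where "L \<ge> 0" "\<And>x y. x \<in> D \<Longrightarrow> y \<in> D \<Longrightarrow> norm (Y x - Y y) \<le> L * norm (x - y)"
proof -
  have "\<exists>K. \<forall>x\<in>D. norm (FD Y x b) \<le> K" for b
  proof -
    have "continuous_on W (\<lambda>x. FD Y x b)" using Y by simp
    then have "compact ((\<lambda>x. FD Y x b) ` D)"
      using D compact_continuous_image continuous_on_subset by blast
    then have "bounded ((\<lambda>x. FD Y x b) ` D)" by (rule compact_imp_bounded)
    then show ?thesis unfolding bounded_iff by simp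
  qed
  then obtain K where K: "\<And>b x. x \<in> D \<Longrightarrow> norm (FD Y x b) \<le> K b" by metis
  have on: "onorm (FD Y x) \<le> (\<Sum>b\<in>Basis. \<bar>K b\<bar>)" if x: "x \<in> D" for x
  proof (rule onorm_le)
    fix v
    have l: "linear (FD Y x)"
      using Ck_on_SucE[OF Y] x D has_derivative_linear by blast
    have "norm (FD Y x v) \<le> (\<Sum>b\<in>Basis. norm v * \<bar>K b\<bar>)"
      unfolding linear_expand[OF l, of v]
    proof (rule sum_norm_le)
      fix b :: 'e assume "b \<in> Basis"
      then show "norm ((v \<bullet> b) *\<^sub>R FD Y x b) \<le> norm v * \<bar>K b\<bar>"
        using K[OF x, of b] by (auto intro!: mult_mono simp: Basis_le_norm)
    qed
    then show "norm (FD Y x v) \<le> (\<Sum>b\<in>Basis. \<bar>K b\<bar>) * norm v"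
      by (simp add: sum_distrib_left[symmetric] mult.commute)
  qed
  show ?thesis
  proof
    show "(\<Sum>b\<in>Basis. \<bar>K b\<bar>) \<ge> 0" by (simp add: sum_nonneg)
    show "norm (Y x - Y y) \<le> (\<Sum>b\<in>Basis. \<bar>K b\<bar>) * norm (x - y)" if "x \<in> D" "y \<in> D" for x y
      by (rule differentiable_bound[OF D(3) _ on]) 
        (use that D Ck_on_SucE[OF Y] in \<open>auto intro: has_derivative_at_withinI\<close>)
  qed
qed

text \<open>Picard's operator is a contraction with constant 1/2 by the choice of
  \<open>\<epsilon>\<close>, so Banach's fixed point theorem applies.\<close>

lemma ode_local_existence_lipschitz:
  fixes Z :: "'e::euclidean_space \<Rightarrow> 'e"
  assumes L: "L \<ge> 0" "\<And>x y. norm (Z x - Z y) \<le> L * norm (x - y)"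
    and \<epsilon>: "\<epsilon> > 0" "L * \<epsilon> \<le> 1/2"
  obtains u where "continuous_on UNIV u" "u 0 = y0"
    "\<And>t. t \<in> {-\<epsilon>..\<epsilon>} \<Longrightarrow> (u has_vector_derivative Z (u t)) (at t within {-\<epsilon>..\<epsilon>})"
proof -
  \<comment> \<open>Clamping time to the interval makes the iterates bounded continuous functions on
    the whole line, so the complete space \<open>real \<Rightarrow>\<^sub>C 'e\<close> can be
    used.\<close>
  define cl where "cl = (\<lambda>t::real. max (-\<epsilon>) (min \<epsilon> t))"
  have cl: "cl t \<in> {-\<epsilon>..\<epsilon>}" "cl t = t \<longleftrightarrow> t \<in> {-\<epsilon>..\<epsilon>}" for t using \<epsilon> by (auto simp: cl_def)
  have contcl: "continuous_on A cl" for A unfolding cl_def by (intro continuous_intros)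
  have contZ: "continuous_on A Z" for A
  proof -
    have "L-lipschitz_on UNIV Z" using L by (auto simp: lipschitz_on_def dist_norm)
    then show ?thesis using lipschitz_on_continuous_on continuous_on_subset by blast
  qed
  \<comment> \<open>Integrating from the left end and subtracting the value at 0 gives the integral
    from 0 to \<open>s\<close> for \<open>s\<close> of either sign.\<close>
  define J where "J = (\<lambda>(u::real\<Rightarrow>'e) s. integral {-\<epsilon>..s} (\<lambda>t. Z (u t)) - integral {-\<epsilon>..0} (\<lambda>t. Z (u t)))"
  have dJ: "(J u has_vector_derivative Z (u s)) (at s within {-\<epsilon>..\<epsilon>})"
    if "continuous_on UNIV u" "s \<in> {-\<epsilon>..\<epsilon>}" for u s
  proof -
    have "continuous_on {-\<epsilon>..\<epsilon>} (\<lambda>t. Z (u t))"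
      using continuous_on_compose2[OF contZ[of UNIV] that(1)] continuous_on_subset by blast
    then have "((\<lambda>s. integral {-\<epsilon>..s} (\<lambda>t. Z (u t))) has_vector_derivative Z (u s)) (at s within {-\<epsilon>..\<epsilon>})"
      using integral_has_vector_derivative that(2) by blast
    from has_vector_derivative_diff[OF this has_vector_derivative_const] show ?thesis
      unfolding J_def by simp
  qed
  have J0: "J u 0 = 0" for u by (simp add: J_def)
  have contJ: "continuous_on {-\<epsilon>..\<epsilon>} (J u)" if "continuous_on UNIV u" for u
    unfolding continuous_on_eq_continuous_within
    using dJ[OF that] has_vector_derivative_continuous by blast
  define T where "T = (\<lambda>u :: real \<Rightarrow>\<^sub>C 'e. Bcontfun (\<lambda>t. y0 + J (apply_bcontfun u) (cl t)))"
  have Tapp: "apply_bcontfun (T u) t = y0 + J (apply_bcontfun u) (cl t)" for u t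
  proof -
    have c: "continuous_on UNIV (\<lambda>t. J (apply_bcontfun u) (cl t))"
      by (rule continuous_on_compose2[OF contJ contcl]) (use cl in auto)
    have "bounded (J (apply_bcontfun u) ` {-\<epsilon>..\<epsilon>})"
      by (intro compact_imp_bounded compact_continuous_image contJ) auto
    then have "bounded ((+) y0 ` J (apply_bcontfun u) ` {-\<epsilon>..\<epsilon>})" by (rule bounded_translation)
    then have "bounded (range (\<lambda>t. y0 + J (apply_bcontfun u) (cl t)))"
      by (rule bounded_subset) (use cl in auto)
    then have "(\<lambda>t. y0 + J (apply_bcontfun u) (cl t)) \<in> bcontfun"
      unfolding bcontfun_def using c by (auto intro!: continuous_intros)
    then show ?thesis unfolding T_def by (simp add: Bcontfun_inverse)
  qed
  have "dist (T u) (T v) \<le> 1/2 * dist u v" for u v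
  proof (rule dist_bound)
    fix t
    have d: "((\<lambda>s. J (apply_bcontfun u) s - J (apply_bcontfun v) s) has_vector_derivative
        (Z (apply_bcontfun u s) - Z (apply_bcontfun v s))) (at s within {-\<epsilon>..\<epsilon>})" if "s \<in> {-\<epsilon>..\<epsilon>}" for s
      using that by (intro has_vector_derivative_diff dJ) auto
    have "norm ((J (apply_bcontfun u) (cl t) - J (apply_bcontfun v) (cl t)) -
        (J (apply_bcontfun u) 0 - J (apply_bcontfun v) 0)) \<le> (L * dist u v) * norm (cl t - 0)"
    proof (rule differentiable_bound[of "{-\<epsilon>..\<epsilon>}"])
      fix s assume s: "s \<in> {-\<epsilon>..\<epsilon>}"
      show "((\<lambda>s. J (apply_bcontfun u) s - J (apply_bcontfun v) s) has_derivative
          (\<lambda>h. h *\<^sub>R (Z (apply_bcontfun u s) - Z (apply_bcontfun v s)))) (at s within {-\<epsilon>..\<epsilon>})"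
        using d[OF s] by (simp add: has_vector_derivative_def)
      have "norm (Z (apply_bcontfun u s) - Z (apply_bcontfun v s)) \<le> L * dist u v"
        by (rule order_trans[OF L(2)]) (use dist_bounded[of u s v] L(1) in \<open>auto intro!: mult_left_mono simp: dist_norm\<close>)
      then show "onorm (\<lambda>h. h *\<^sub>R (Z (apply_bcontfun u s) - Z (apply_bcontfun v s))) \<le> L * dist u v"
        by (intro onorm_le) (simp add: mult_left_mono mult.commute[of "L * dist u v"])
    qed (use cl \<epsilon> in auto)
    also have "\<dots> \<le> (L * dist u v) * \<epsilon>"
      using cl(1)[of t] L(1) by (intro mult_left_mono) auto
    also have "\<dots> \<le> 1/2 * dist u v"
      using mult_right_mono[OF \<epsilon>(2), of "dist u v"] by (simp add: algebra_simps)
    finally show "dist (apply_bcontfun (T u) t) (apply_bcontfun (T v) t) \<le> 1/2 * dist u v"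
      by (simp add: Tapp J0 dist_norm)
  qed
  then have "\<exists>!u. T u = u"
    by (intro banach_fix_type[of "1/2"]) auto
  then obtain u where "T u = u" by blast
  then have u: "apply_bcontfun u t = y0 + J (apply_bcontfun u) (cl t)" for t using Tapp by metis
  show ?thesis
  proof
    show "apply_bcontfun u 0 = y0" using u[of 0] \<epsilon> by (simp add: cl_def J0)
    fix t assume t: "t \<in> {-\<epsilon>..\<epsilon>}"
    have "((\<lambda>t. y0 + J (apply_bcontfun u) t) has_vector_derivative 0 + Z (apply_bcontfun u t)) (at t within {-\<epsilon>..\<epsilon>})"
      by (intro has_vector_derivative_add has_vector_derivative_const dJ t) auto
    then have "((\<lambda>t. y0 + J (apply_bcontfun u) t) has_vector_derivative Z (apply_bcontfun u t)) (at t within {-\<epsilon>..\<epsilon>})"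
      by simp
    then show "(apply_bcontfun u has_vector_derivative Z (apply_bcontfun u t)) (at t within {-\<epsilon>..\<epsilon>})"
      by (rule has_vector_derivative_transform[OF t, rotated]) (metis u cl(2))
  qed simp
qed

text \<open>Composing \<open>Y\<close> with the closest point projection onto a ball, which is
  1-Lipschitz, gives a globally Lipschitz field \<open>Z\<close>. A solution for \<open>Z\<close>
  that has no time to leave the ball is a solution for \<open>Y\<close>.\<close>

lemma ode_local_existence:
  fixes Y :: "'e::euclidean_space \<Rightarrow> 'e"
  assumes W: "open W" "y0 \<in> W" and Y: "Ck_on (Suc 0) W Y"
  obtains \<epsilon> u where "\<epsilon> > 0" "u 0 = y0" "\<And>t. \<bar>t\<bar> < \<epsilon> \<Longrightarrow> u t \<in> W"
    "\<And>t. \<bar>t\<bar> < \<epsilon> \<Longrightarrow> (u has_vector_derivative Y (u t)) (at t)"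
proof -
  obtain r where r: "r > 0" "cball y0 r \<subseteq> W" using W open_contains_cball by blast
  let ?D = "cball y0 r"
  obtain L where L: "L \<ge> 0" "\<And>x y. x \<in> ?D \<Longrightarrow> y \<in> ?D \<Longrightarrow> norm (Y x - Y y) \<le> L * norm (x - y)"
    using Ck_on_1_lipschitz[OF Y r(2)] by auto
  have "continuous_on ?D Y" using Y r Ck_on_imp_continuous_on continuous_on_subset by blast
  then have "bounded (Y ` ?D)" by (intro compact_imp_bounded compact_continuous_image) auto
  then obtain M where M: "M > 0" "\<And>x. x \<in> ?D \<Longrightarrow> norm (Y x) \<le> M" unfolding bounded_pos by blast
  define Z where "Z = (\<lambda>x. Y (closest_point ?D x))"
  have cp: "closest_point ?D x \<in> ?D" for x using r by (intro closest_point_in_set) auto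
  have Z: "norm (Z x - Z y) \<le> L * norm (x - y)" for x y
  proof -
    have "dist (closest_point ?D x) (closest_point ?D y) \<le> dist x y"
      using r by (intro closest_point_lipschitz) auto
    then have "L * norm (closest_point ?D x - closest_point ?D y) \<le> L * norm (x - y)"
      using L(1) by (intro mult_left_mono) (simp_all add: dist_norm)
    then show ?thesis using L(2)[OF cp cp, of x y] by (simp add: Z_def)
  qed
  \<comment> \<open>Within time \<open>r / M\<close> a curve of speed at most \<open>M\<close>
    cannot leave the ball; the second bound gives \<open>L * \<epsilon> \<le> 1/2\<close>, with
    \<open>L + 1\<close> because \<open>L\<close> may be 0.\<close>
  define \<epsilon> where "\<epsilon> = min (r / M) (1 / (2 * (L + 1)))"
  have e: "\<epsilon> > 0" using r M L by (simp add: \<epsilon>_def)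
  have "L * \<epsilon> \<le> (L + 1) * (1 / (2 * (L + 1)))" using L e by (intro mult_mono) (auto simp: \<epsilon>_def)
  also have "\<dots> = 1/2" using L by (simp add: field_simps)
  finally have Le: "L * \<epsilon> \<le> 1/2" .
  have "M * \<epsilon> \<le> M * (r / M)" using M by (intro mult_left_mono) (auto simp: \<epsilon>_def)
  then have Me: "M * \<epsilon> \<le> r" using M by simp
  obtain u where u: "u 0 = y0"
    "\<And>t. t \<in> {-\<epsilon>..\<epsilon>} \<Longrightarrow> (u has_vector_derivative Z (u t)) (at t within {-\<epsilon>..\<epsilon>})"
    using ode_local_existence_lipschitz[OF L(1) Z e Le] by metis
  have uD: "u t \<in> ?D" if t: "\<bar>t\<bar> < \<epsilon>" for t
  proof -
    have "norm (u t - u 0) \<le> M * norm (t - 0)"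
    proof (rule differentiable_bound[of "{-\<epsilon>..\<epsilon>}"])
      fix s assume "s \<in> {-\<epsilon>..\<epsilon>}"
      then show "(u has_derivative (\<lambda>h. h *\<^sub>R Z (u s))) (at s within {-\<epsilon>..\<epsilon>})"
        using u(2) by (simp add: has_vector_derivative_def)
      show "onorm (\<lambda>h. h *\<^sub>R Z (u s)) \<le> M"
        using M(2)[OF cp] by (intro onorm_le) (simp add: Z_def mult_left_mono mult.commute[of M])
    qed (use t e in auto)
    also have "\<dots> \<le> M * \<epsilon>" using t M(1) by (intro mult_left_mono) auto
    finally show ?thesis using Me u(1) by (simp add: dist_norm norm_minus_commute)
  qed
  show ?thesis
  proof
    fix t assume t: "\<bar>t\<bar> < \<epsilon>"
    show "u t \<in> W" using uD[OF t] r by blast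
    have "(u has_vector_derivative Z (u t)) (at t within {-\<epsilon><..<\<epsilon>})"
      by (rule has_vector_derivative_within_subset[OF u(2)]) (use t in auto)
    moreover have "at t within {-\<epsilon><..<\<epsilon>} = at t" using t by (intro at_within_open) auto
    ultimately have "(u has_vector_derivative Z (u t)) (at t)" by simp
    moreover have "Z (u t) = Y (u t)" by (simp add: Z_def closest_point_self[OF uD[OF t]])
    ultimately show "(u has_vector_derivative Y (u t)) (at t)" by simp
  qed (use e u in auto)
qed

subsection \<open>Smooth bump functions\<close>

text \<open>The powers of 1/t are included to obtain a family closed under differentiation: each
  derivative is a combination of members of higher index.\<close>

definition flat_exp :: "nat \<Rightarrow> real \<Rightarrow> real" where
  "flat_exp n t = (if t > 0 then (1 / t) ^ n * exp (- (1 / t)) else 0)"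

lemma flat_exp_tendsto_0: "(flat_exp n \<longlongrightarrow> 0) (at 0)"
proof -
  have "((\<lambda>x::real. x ^ n / exp x) \<longlongrightarrow> 0) at_top" by (rule tendsto_power_div_exp_0)
  then have "((\<lambda>t::real. inverse t ^ n / exp (inverse t)) \<longlongrightarrow> 0) (at_right 0)"
    by (rule filterlim_compose[OF _ filterlim_inverse_at_top_right])
  moreover have "\<forall>\<^sub>F t in at_right 0. inverse t ^ n / exp (inverse t) = flat_exp n t"
    using eventually_at_right_less[of 0]
    by eventually_elim (simp add: flat_exp_def exp_minus field_simps)
  ultimately have "(flat_exp n \<longlongrightarrow> 0) (at_right 0)" using tendsto_cong by fast
  moreover have "(flat_exp n \<longlongrightarrow> 0) (at_left 0)"
  proof (rule tendsto_eventually)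
    show "\<forall>\<^sub>F t in at_left 0. flat_exp n t = 0"
      using eventually_at_left_real[of "-1" 0] by (rule eventually_mono[OF _ ]) (auto simp: flat_exp_def)
  qed
  ultimately show ?thesis by (simp add: filterlim_split_at)
qed

lemma flat_exp_has_derivative:
  "(flat_exp n has_real_derivative flat_exp (n + 2) t - n * flat_exp (n + 1) t) (at t)"
proof -
  consider "t > 0" | "t < 0" | "t = 0" by linarith
  then show ?thesis
  proof cases
    case 1
    have "((\<lambda>t::real. (1 / t) ^ n * exp (- (1 / t))) has_real_derivative
        (1 / t) ^ n * (exp (- (1 / t)) * (1 / t\<^sup>2)) + (real n * (1 / t) ^ (n - 1) * (- (1 / t\<^sup>2))) * exp (- (1 / t))) (at t)"
      using 1 by (auto intro!: derivative_eq_intros simp: power2_eq_square)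
    moreover have "(1 / t) ^ n * (exp (- (1 / t)) * (1 / t\<^sup>2)) + (real n * (1 / t) ^ (n - 1) * (- (1 / t\<^sup>2))) * exp (- (1 / t)) =
        flat_exp (n + 2) t - n * flat_exp (n + 1) t"
      using 1 by (cases n) (simp_all add: flat_exp_def power2_eq_square field_simps)
    ultimately have "((\<lambda>t::real. (1 / t) ^ n * exp (- (1 / t))) has_real_derivative
        flat_exp (n + 2) t - n * flat_exp (n + 1) t) (at t)" by simp
    then show ?thesis
      by (rule has_field_derivative_transform_within_open[where S = "{0<..}"])
        (use 1 in \<open>auto simp: flat_exp_def\<close>)
  next
    case 2
    have "((\<lambda>t::real. 0) has_real_derivative flat_exp (n + 2) t - n * flat_exp (n + 1) t) (at t)"
      using 2 by (simp add: flat_exp_def)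
    then show ?thesis
      by (rule has_field_derivative_transform_within_open[where S = "{..<0}"])
        (use 2 in \<open>auto simp: flat_exp_def\<close>)
  next
    case 3
    \<comment> \<open>At 0 the difference quotient is the member of index \<open>n + 1\<close>,
      whose limit is already known.\<close>
    have "(flat_exp n (0 + h) - flat_exp n 0) / h = flat_exp (n + 1) h" for h
      by (simp add: flat_exp_def)
    then have "(flat_exp n has_real_derivative 0) (at 0)"
      using flat_exp_tendsto_0[of "n + 1"] by (simp add: DERIV_def)
    with 3 show ?thesis by (simp add: flat_exp_def)
  qed
qed

lemma smooth_on_flat_exp: "smooth_on UNIV (flat_exp n)"
proof -
  have "Ck_on k UNIV (flat_exp n)" for k n
  proof (induction k arbitrary: n)
    case 0
    then show ?case
      using DERIV_isCont[OF flat_exp_has_derivative] by (simp add: continuous_at_imp_continuous_on)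
  next
    case (Suc k)
    show ?case
    proof (rule Ck_on_SucI)
      show "(flat_exp n has_derivative (\<lambda>v. (flat_exp (n + 2) x + (- real n) * flat_exp (n + 1) x) * v)) (at x)" for x
        using flat_exp_has_derivative[of n x] by (simp add: has_field_derivative_def)
      show "Ck_on k UNIV (\<lambda>x. (flat_exp (n + 2) x + (- real n) * flat_exp (n + 1) x) * v)" for v
        by (intro Ck_on_mult Ck_on_add Ck_on_const Suc open_UNIV)
    qed simp
  qed
  then show ?thesis by (simp add: smooth_on_def)
qed

text \<open>\<open>flat_exp 0\<close> is applied to r^2 - |x - x0|^2, which is positive exactly
  inside the ball, and normalised at the centre.\<close>

lemma smooth_bump:
  fixes x0 :: "'a::euclidean_space"
  assumes "r > 0"
  obtains \<psi> :: "'a \<Rightarrow> real" where "smooth_on UNIV \<psi>" "\<psi> x0 = 1" "\<And>x. x \<notin> ball x0 r \<Longrightarrow> \<psi> x = 0"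
proof
  let ?q = "\<lambda>x. r\<^sup>2 - (x - x0) \<bullet> (x - x0)"
  let ?c = "1 / flat_exp 0 (r\<^sup>2)"
  show "smooth_on UNIV (\<lambda>x. ?c * flat_exp 0 (?q x))"
  proof -
    have i: "smooth_on UNIV (\<lambda>x::'a. x)" by (rule smooth_on_linear) (auto intro: linearI)
    have "smooth_on UNIV (\<lambda>x. flat_exp 0 (?q x))"
      by (rule smooth_on_compose[OF _ _ _ smooth_on_flat_exp])
        (auto intro!: smooth_on_diff smooth_on_inner smooth_on_const i)
    then show ?thesis by (intro smooth_on_mult smooth_on_const) auto
  qed
  show "?c * flat_exp 0 (?q x0) = 1" using assms by (simp add: flat_exp_def)
  show "?c * flat_exp 0 (?q x) = 0" if "x \<notin> ball x0 r" for x
  proof -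
    have "r \<le> norm (x - x0)" using that by (simp add: dist_norm norm_minus_commute)
    then have "r\<^sup>2 \<le> (norm (x - x0))\<^sup>2" using assms by (intro power_mono) auto
    then show ?thesis by (simp add: flat_exp_def power2_norm_eq_inner)
  qed
qed

subsection \<open>Charts and tangent vectors\<close>

lemma frechet_derivative_local_comp:
  assumes f: "(f has_derivative f') (at x)" and g: "(g has_derivative g') (at (f x))"
    and S: "open S" "x \<in> S" "\<And>y. y \<in> S \<Longrightarrow> h y = g (f y)"
  shows "FD h x u = g' (f' u)"
proof -
  have "(h has_derivative (\<lambda>u. g' (f' u))) (at x)"
    by (rule has_derivative_transform_within_open[OF has_derivative_compose[OF f g] S(1,2)]) (simp add: S(3))
  then show ?thesis by (simp add: frechet_derivative_at[symmetric])
qed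

lemma charts_atD: "c \<in> charts_at A p \<Longrightarrow> c \<in> A" "c \<in> charts_at A p \<Longrightarrow> p \<in> cdom c"
  by (simp_all add: charts_at_def)

context
  fixes A :: "('m::{t2_space, second_countable_topology}, 'a::euclidean_space) chart set"
  assumes A: "smooth_manifold A"
begin

lemma chart_at_in: "chart_at A p \<in> charts_at A p"
proof -
  have "\<exists>c. c \<in> charts_at A p" using A unfolding smooth_manifold_def charts_at_def by fast
  then show ?thesis unfolding chart_at_def by (rule someI_ex)
qed

lemma is_chart: "c \<in> A \<Longrightarrow> is_chart c"
  using A by (simp add: smooth_manifold_def)

lemma open_cdom: "c \<in> A \<Longrightarrow> open (cdom c)"
  using is_chart is_chart_def by blast

lemma cinv_cmap: "c \<in> A \<Longrightarrow> p \<in> cdom c \<Longrightarrow> cinv c (cmap c p) = p"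
  using is_chart is_chart_def homeomorphism_apply1 by blast

lemma cmap_cinv: "c \<in> A \<Longrightarrow> x \<in> cmap c ` cdom c \<Longrightarrow> cmap c (cinv c x) = x"
  by (auto simp: cinv_cmap)

lemma cinv_in: "c \<in> A \<Longrightarrow> x \<in> cmap c ` cdom c \<Longrightarrow> cinv c x \<in> cdom c"
  by (auto simp: cinv_cmap)

lemma continuous_on_cmap: "c \<in> A \<Longrightarrow> continuous_on (cdom c) (cmap c)"
  using is_chart is_chart_def homeomorphism_cont1 by blast

lemma continuous_on_cinv: "c \<in> A \<Longrightarrow> continuous_on (cmap c ` cdom c) (cinv c)"
  using is_chart is_chart_def homeomorphism_cont2 by blast

lemma open_cmap_image:
  assumes "c \<in> A" "open U"
  shows "open (cmap c ` (cdom c \<inter> U))"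
proof -
  have "cmap c ` (cdom c \<inter> U) = cmap c ` cdom c \<inter> cinv c -` U"
    using assms(1) by (auto simp: cinv_cmap)
  moreover have "open (cmap c ` cdom c)" using assms is_chart is_chart_def by blast
  ultimately show ?thesis
    using continuous_on_open_vimage[of "cmap c ` cdom c" "cinv c"] continuous_on_cinv[OF assms(1)] assms(2)
    by (simp add: Int_commute)
qed

lemma open_cmap_cdom: "c \<in> A \<Longrightarrow> open (cmap c ` cdom c)"
  using is_chart is_chart_def by blast

lemma transition_smooth:
  "c \<in> A \<Longrightarrow> d \<in> A \<Longrightarrow> smooth_on (cmap c ` (cdom c \<inter> cdom d)) (cmap d \<circ> cinv c)"
  using A by (simp add: smooth_manifold_def)

lemma transition_has_derivative:
  assumes "c \<in> charts_at A p" "d \<in> charts_at A p"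
  shows "((cmap d \<circ> cinv c) has_derivative FD (cmap d \<circ> cinv c) (cmap c p)) (at (cmap c p))"
  using assms by (intro smooth_on_has_derivative[OF transition_smooth]) (auto simp: charts_at_def)

lemma linear_transition:
  assumes "c \<in> charts_at A p" "d \<in> charts_at A p"
  shows "linear (FD (cmap d \<circ> cinv c) (cmap c p))"
  using transition_has_derivative[OF assms] has_derivative_linear by blast

lemma transition_self:
  assumes c: "c \<in> charts_at A p"
  shows "FD (cmap c \<circ> cinv c) (cmap c p) u = u"
proof -
  have "((\<lambda>x. x) has_derivative (\<lambda>x. x)) (at (cmap c p))" by simp
  then have "((cmap c \<circ> cinv c) has_derivative (\<lambda>x. x)) (at (cmap c p))"
    by (rule has_derivative_transform_within_open[OF _ open_cmap_cdom[OF charts_atD(1)[OF c]]])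
      (use charts_atD[OF c] in \<open>auto simp: cinv_cmap\<close>)
  then show ?thesis by (simp add: frechet_derivative_at[symmetric])
qed

text \<open>The chain rule for transition maps; it is what makes the families given by
  \<open>tvec_of\<close> tangent vectors.\<close>

lemma transition_cocycle:
  assumes c: "c \<in> charts_at A p" and d: "d \<in> charts_at A p" and e: "e \<in> charts_at A p"
  shows "FD (cmap e \<circ> cinv d) (cmap d p)
    (FD (cmap d \<circ> cinv c) (cmap c p) u) =
    FD (cmap e \<circ> cinv c) (cmap c p) u"
proof (rule frechet_derivative_local_comp[symmetric, OF transition_has_derivative[OF c d]])
  show "(cmap e \<circ> cinv d has_derivative FD (cmap e \<circ> cinv d) (cmap d p))
      (at ((cmap d \<circ> cinv c) (cmap c p)))"
    using transition_has_derivative[OF d e] by (simp only: o_apply cinv_cmap[OF charts_atD[OF c]])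
  show "open (cmap c ` (cdom c \<inter> cdom d))"
    by (intro open_cmap_image open_cdom charts_atD(1)[OF c] charts_atD(1)[OF d])
  show "cmap c p \<in> cmap c ` (cdom c \<inter> cdom d)" using charts_atD(2)[OF c] charts_atD(2)[OF d] by blast
  fix y assume "y \<in> cmap c ` (cdom c \<inter> cdom d)"
  then show "(cmap e \<circ> cinv c) y = (cmap e \<circ> cinv d) ((cmap d \<circ> cinv c) y)"
    using charts_atD(1)[OF c] charts_atD(1)[OF d] by (auto simp: cinv_cmap)
qed

lemma tvec_of_self: "c \<in> charts_at A p \<Longrightarrow> tvec_of A c p u c = u"
  by (simp add: tvec_of_def transition_self)

lemma tvec_of_tangent:
  assumes "c \<in> charts_at A p"
  shows "tvec_of A c p u \<in> tangent_space A p"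
  using assms by (auto simp: tangent_space_def tvec_of_def transition_cocycle)

lemma tangent_transition:
  assumes "v \<in> tangent_space A p" "c \<in> charts_at A p" "d \<in> charts_at A p"
  shows "v d = FD (cmap d \<circ> cinv c) (cmap c p) (v c)"
  using assms unfolding tangent_space_def by blast

lemma tvec_of_coord:
  assumes "v \<in> tangent_space A p" "c \<in> charts_at A p"
  shows "tvec_of A c p (v c) = v"
proof
  fix d
  have "v d = 0" if "d \<notin> charts_at A p" using assms(1) that unfolding tangent_space_def by blast
  then show "tvec_of A c p (v c) d = v d"
    by (auto simp: tvec_of_def tangent_transition[OF assms, symmetric])
qed

lemma tangent_eqI:
  assumes "v \<in> tangent_space A p" "w \<in> tangent_space A p" "c \<in> charts_at A p" "v c = w c"
  shows "v = w"
  using tvec_of_coord assms by metis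

lemma tvec_of_add: "c \<in> charts_at A p \<Longrightarrow> tvec_of A c p (u + v) = tvec_of A c p u + tvec_of A c p v"
  by (rule ext) (simp add: tvec_of_def plus_fun_def linear_add[OF linear_transition])

lemma tvec_of_scaleR: "c \<in> charts_at A p \<Longrightarrow> tvec_of A c p (r *\<^sub>R u) = r *\<^sub>R tvec_of A c p u"
  by (intro ext) (simp add: tvec_of_def scaleR_fun_def linear_scale[OF linear_transition])

lemma tvec_of_0: "c \<in> charts_at A p \<Longrightarrow> tvec_of A c p 0 = 0"
  by (intro ext) (simp add: tvec_of_def zero_fun_def linear_0[OF linear_transition])

lemma tangent_add: "u \<in> tangent_space A p \<Longrightarrow> v \<in> tangent_space A p \<Longrightarrow> u + v \<in> tangent_space A p"
  by (metis chart_at_in tvec_of_add tvec_of_coord tvec_of_tangent)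

lemma tangent_scaleR: "u \<in> tangent_space A p \<Longrightarrow> r *\<^sub>R u \<in> tangent_space A p"
  by (metis chart_at_in tvec_of_scaleR tvec_of_coord tvec_of_tangent)

lemma tangent_0: "0 \<in> tangent_space A p"
  by (metis chart_at_in tvec_of_0 tvec_of_tangent)

lemma tangent_minus: "u \<in> tangent_space A p \<Longrightarrow> - u \<in> tangent_space A p"
  using tangent_scaleR[of u p "-1"] by simp

lemma tangent_diff: "u \<in> tangent_space A p \<Longrightarrow> v \<in> tangent_space A p \<Longrightarrow> u - v \<in> tangent_space A p"
  using tangent_add[OF _ tangent_minus, of u p v] by simp

end

subsection \<open>Differentials\<close>

context
  fixes A :: "('m::{t2_space, second_countable_topology}, 'a::euclidean_space) chart set"
    and B :: "('n::{t2_space, second_countable_topology}, 'b::euclidean_space) chart set"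
    and F :: "'m \<Rightarrow> 'n"
  assumes A: "smooth_manifold A" and B: "smooth_manifold B" and F: "smooth_map A B F"
begin

lemma open_vimage_chart: "d \<in> B \<Longrightarrow> open (F -` cdom d)"
  using F open_cdom[OF B] by (simp add: smooth_map_def open_vimage)

lemma smooth_map_coords:
  "c \<in> A \<Longrightarrow> d \<in> B \<Longrightarrow> smooth_on (cmap c ` (cdom c \<inter> F -` cdom d)) (cmap d \<circ> F \<circ> cinv c)"
  using F by (simp add: smooth_map_def)

lemma open_map_coords: "c \<in> A \<Longrightarrow> d \<in> B \<Longrightarrow> open (cmap c ` (cdom c \<inter> F -` cdom d))"
  by (intro open_cmap_image[OF A] open_vimage_chart)

lemma map_coords_has_derivative:
  assumes "c \<in> charts_at A p" "d \<in> charts_at B (F p)"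
  shows "((cmap d \<circ> F \<circ> cinv c) has_derivative
    FD (cmap d \<circ> F \<circ> cinv c) (cmap c p)) (at (cmap c p))"
  using assms by (intro smooth_on_has_derivative[OF smooth_map_coords]) (auto simp: charts_at_def)

lemma linear_map_coords:
  assumes "c \<in> charts_at A p" "d \<in> charts_at B (F p)"
  shows "linear (FD (cmap d \<circ> F \<circ> cinv c) (cmap c p))"
  using map_coords_has_derivative[OF assms] has_derivative_linear by blast

lemma map_coords_source:
  assumes c: "c \<in> charts_at A p" and c': "c' \<in> charts_at A p" and d: "d \<in> charts_at B (F p)"
  shows "FD (cmap d \<circ> F \<circ> cinv c) (cmap c p) u =
    FD (cmap d \<circ> F \<circ> cinv c') (cmap c' p)
      (FD (cmap c' \<circ> cinv c) (cmap c p) u)"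
proof (rule frechet_derivative_local_comp[OF transition_has_derivative[OF A c c'], where g = "cmap d \<circ> F \<circ> cinv c'"
      and g' = "FD (cmap d \<circ> F \<circ> cinv c') (cmap c' p)"])
  show "(cmap d \<circ> F \<circ> cinv c' has_derivative FD (cmap d \<circ> F \<circ> cinv c') (cmap c' p))
      (at ((cmap c' \<circ> cinv c) (cmap c p)))"
    using map_coords_has_derivative[OF c' d] by (simp only: o_apply cinv_cmap[OF A charts_atD[OF c]])
  show "open (cmap c ` (cdom c \<inter> cdom c'))"
    by (intro open_cmap_image[OF A] open_cdom[OF A] charts_atD(1)[OF c] charts_atD(1)[OF c'])
  show "cmap c p \<in> cmap c ` (cdom c \<inter> cdom c')" using charts_atD(2)[OF c] charts_atD(2)[OF c'] by blast
  fix y assume "y \<in> cmap c ` (cdom c \<inter> cdom c')"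
  then show "(cmap d \<circ> F \<circ> cinv c) y = (cmap d \<circ> F \<circ> cinv c') ((cmap c' \<circ> cinv c) y)"
    using charts_atD(1)[OF c] charts_atD(1)[OF c'] by (auto simp: cinv_cmap[OF A])
qed

lemma map_coords_target:
  assumes c: "c \<in> charts_at A p" and d: "d \<in> charts_at B (F p)" and d': "d' \<in> charts_at B (F p)"
  shows "FD (cmap d' \<circ> cinv d) (cmap d (F p))
    (FD (cmap d \<circ> F \<circ> cinv c) (cmap c p) u) =
    FD (cmap d' \<circ> F \<circ> cinv c) (cmap c p) u"
proof (rule frechet_derivative_local_comp[symmetric, OF map_coords_has_derivative[OF c d], where g = "cmap d' \<circ> cinv d"
      and g' = "FD (cmap d' \<circ> cinv d) (cmap d (F p))"])
  show "(cmap d' \<circ> cinv d has_derivative FD (cmap d' \<circ> cinv d) (cmap d (F p)))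
      (at ((cmap d \<circ> F \<circ> cinv c) (cmap c p)))"
    using transition_has_derivative[OF B d d'] by (simp only: o_apply cinv_cmap[OF A charts_atD[OF c]])
  show "open (cmap c ` (cdom c \<inter> F -` cdom d))"
    by (intro open_map_coords charts_atD(1)[OF c] charts_atD(1)[OF d])
  show "cmap c p \<in> cmap c ` (cdom c \<inter> F -` cdom d)" using charts_atD(2)[OF c] charts_atD(2)[OF d] by blast
  fix y assume "y \<in> cmap c ` (cdom c \<inter> F -` cdom d)"
  then show "(cmap d' \<circ> F \<circ> cinv c) y = (cmap d' \<circ> cinv d) ((cmap d \<circ> F \<circ> cinv c) y)"
    using charts_atD(1)[OF c] charts_atD(1)[OF d] by (auto simp: cinv_cmap[OF A] cinv_cmap[OF B])
qed

text \<open>\<open>pushforward\<close> is defined in the chart chosen by \<open>chart_at\<close>;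
  the chain rule in the source shows that every chart around \<open>p\<close> gives the same
  components.\<close>

lemma pushforward_coords:
  assumes "v \<in> tangent_space A p" "c \<in> charts_at A p" "d \<in> charts_at B (F p)"
  shows "pushforward A B F p v d = FD (cmap d \<circ> F \<circ> cinv c) (cmap c p) (v c)"
  using assms map_coords_source[OF chart_at_in[OF A] assms(2,3)] tangent_transition[OF A assms(1) chart_at_in[OF A] assms(2)]
  by (simp add: pushforward_def Let_def)

lemma pushforward_tangent:
  assumes v: "v \<in> tangent_space A p"
  shows "pushforward A B F p v \<in> tangent_space B (F p)"
  unfolding tangent_space_def mem_Collect_eq
proof (intro conjI ballI allI impI)
  fix d d' assume "d \<in> charts_at B (F p)" "d' \<in> charts_at B (F p)"
  then show "pushforward A B F p v d' =
      FD (cmap d' \<circ> cinv d) (cmap d (F p)) (pushforward A B F p v d)"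
    by (simp add: pushforward_coords[OF v chart_at_in[OF A]] map_coords_target[OF chart_at_in[OF A]])
qed (simp add: pushforward_def Let_def)

end

lemma linear_pushforward:
  assumes A: "smooth_manifold A" and B: "smooth_manifold B" and F: "smooth_map A B F"
  shows "pushforward A B F p (u + v) = pushforward A B F p u + pushforward A B F p v"
    and "pushforward A B F p (r *\<^sub>R u) = r *\<^sub>R pushforward A B F p u"
  by (rule ext, simp add: pushforward_def Let_def plus_fun_def scaleR_fun_def
      linear_add[OF linear_map_coords[OF A B F chart_at_in[OF A]]]
      linear_scale[OF linear_map_coords[OF A B F chart_at_in[OF A]]])+

lemma dfun_coords:
  assumes A: "smooth_manifold A" and f: "smooth_fun A f"
    and v: "v \<in> tangent_space A p" and c: "c \<in> charts_at A p"
  shows "dfun A f p v = FD (f \<circ> cinv c) (cmap c p) (v c)"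
proof -
  let ?e = "chart_at A p"
  note e = chart_at_in[OF A, of p]
  have "FD (f \<circ> cinv ?e) (cmap ?e p) (v ?e) = FD (f \<circ> cinv c) (cmap c p)
      (FD (cmap c \<circ> cinv ?e) (cmap ?e p) (v ?e))"
  proof (rule frechet_derivative_local_comp[OF transition_has_derivative[OF A e c], where g = "f \<circ> cinv c"
      and g' = "FD (f \<circ> cinv c) (cmap c p)"])
    have "((f \<circ> cinv c) has_derivative FD (f \<circ> cinv c) (cmap c p)) (at (cmap c p))"
      using f charts_atD[OF c] by (intro smooth_on_has_derivative[of "cmap c ` cdom c"]) (auto simp: smooth_fun_def)
    then show "((f \<circ> cinv c) has_derivative FD (f \<circ> cinv c) (cmap c p))
        (at ((cmap c \<circ> cinv ?e) (cmap ?e p)))"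
      by (simp only: o_apply cinv_cmap[OF A charts_atD[OF e]])
    show "open (cmap ?e ` (cdom ?e \<inter> cdom c))"
      by (intro open_cmap_image[OF A] open_cdom[OF A] charts_atD(1)[OF e] charts_atD(1)[OF c])
    show "cmap ?e p \<in> cmap ?e ` (cdom ?e \<inter> cdom c)" using charts_atD(2)[OF c] charts_atD(2)[OF e] by blast
    fix y assume "y \<in> cmap ?e ` (cdom ?e \<inter> cdom c)"
    then show "(f \<circ> cinv ?e) y = (f \<circ> cinv c) ((cmap c \<circ> cinv ?e) y)"
      using charts_atD(1)[OF c] charts_atD(1)[OF e] by (auto simp: cinv_cmap[OF A])
  qed
  then show ?thesis
    using tangent_transition[OF A v e c] by (simp add: dfun_def Let_def)
qed

subsection \<open>Existence and uniqueness of the Christoffel symbols\<close>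

text \<open>Three instances of the compatibility condition, added with signs: the symmetry of
  \<open>\<Gamma>\<close> and \<open>G\<close> cancels all but one pair of equal terms.\<close>

lemma koszul_formula:
  fixes G :: "'a::real_vector \<Rightarrow> 'a \<Rightarrow> real"
  assumes "bilinear G" "\<And>u v. G u v = G v u" "\<And>u v. \<Gamma> u v = \<Gamma> v u"
    and "\<And>w u v. D w u v = G (\<Gamma> w u) v + G u (\<Gamma> w v)"
  shows "G (\<Gamma> u v) z = (D u v z + D v u z - D z u v) / 2"
  unfolding assms(4) using assms(2)[of v] assms(2)[of u] assms(3)[of z] assms(3)[of v u] by simp

text \<open>The Koszul expression is linear in \<open>z\<close>, hence represented by a unique
  vector with respect to the metric at \<open>x\<close>, and that vector is the value of
  \<open>\<Gamma>\<close>. This gives the \<open>THE\<close> in \<open>christoffel\<close> its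
  meaning.\<close>

lemma christoffel_ex1:
  fixes G :: "'a::euclidean_space \<Rightarrow> 'a \<Rightarrow> 'a \<Rightarrow> real"
  assumes S: "open S" "x \<in> S" and bG: "\<And>y. y \<in> S \<Longrightarrow> bilinear (G y)"
    and sG: "\<And>y u v. y \<in> S \<Longrightarrow> G y u v = G y v u" and pG: "\<And>z. z \<noteq> 0 \<Longrightarrow> G x z z > 0"
    and dG: "\<And>u v. (\<lambda>y. G y u v) differentiable (at x)"
  shows "\<exists>!\<Gamma>. bilinear \<Gamma> \<and> (\<forall>u v. \<Gamma> u v = \<Gamma> v u) \<and>
    (\<forall>w u v. FD (\<lambda>y. G y u v) x w = G x (\<Gamma> w u) v + G x u (\<Gamma> w v))"
proof -
  define D where "D = (\<lambda>w u v. FD (\<lambda>y. G y u v) x w)"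
  have l: "linear (\<lambda>w. D w u v)" "linear (\<lambda>u. D w u v)" "linear (\<lambda>v. D w u v)" for u v w
  proof -
    show "linear (\<lambda>w. D w u v)"
      unfolding D_def by (rule linear_frechet_derivative[OF dG])
    show "linear (\<lambda>u. D w u v)" unfolding D_def
      by (rule linear_frechet_field[OF S, of "\<lambda>y u. G y u v"]) (use bG dG in \<open>auto simp: bilinear_def\<close>)
    show "linear (\<lambda>v. D w u v)" unfolding D_def
      by (rule linear_frechet_field[OF S, of "\<lambda>y v. G y u v"]) (use bG dG in \<open>auto simp: bilinear_def\<close>)
  qed
  note lin = l[THEN linear_add] l[THEN linear_scale]
  have Dsym: "D w u v = D w v u" for w u v
  proof -
    have "(\<lambda>y. G y v u) differentiable (at x)" by (rule dG)
    then have "FD (\<lambda>y. G y v u) x = FD (\<lambda>y. G y u v) x"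
      by (rule frechet_derivative_transform_within_open[OF _ S]) (rule sG)
    then show ?thesis by (simp add: D_def)
  qed
  define k where "k = (\<lambda>u v z. (D u v z + D v u z - D z u v) / 2)"
  have "\<exists>!a. \<forall>z. G x a z = k u v z" for u v
    by (rule bilinear_pos_def_solve[OF bG[OF S(2)] pG]) (auto intro!: linearI simp: k_def lin field_simps)
  then obtain \<Gamma> where G: "\<And>u v z. G x (\<Gamma> u v) z = k u v z" by metis
  have uniq: "a = b" if "\<And>z. G x a z = G x b z" for a b
  proof -
    have "G x (a - b) (a - b) = 0"
      unfolding bilinear_lsub[OF bG[OF S(2)]] using that[of "a - b"] by simp
    then show ?thesis using pG[of "a - b"] by fastforce
  qed
  note Glin = bilinear_ladd[OF bG[OF S(2)]] bilinear_radd[OF bG[OF S(2)]] bilinear_lmul[OF bG[OF S(2)]]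
    bilinear_rmul[OF bG[OF S(2)]]
  have Gs: "\<Gamma> u v = \<Gamma> v u" for u v
    by (rule uniq) (simp add: G k_def Dsym[of _ u v])
  have Ga: "\<Gamma> (u + u') v = \<Gamma> u v + \<Gamma> u' v" "\<Gamma> (r *\<^sub>R u) v = r *\<^sub>R \<Gamma> u v" for u u' v r
    by (rule uniq, simp add: G k_def lin Glin field_simps)+
  have Ga2: "\<Gamma> u (v + v') = \<Gamma> u v + \<Gamma> u v'" "\<Gamma> u (r *\<^sub>R v) = r *\<^sub>R \<Gamma> u v" for u v v' r
    by (metis Gs Ga)+
  have bil: "bilinear \<Gamma>"
    unfolding bilinear_def by (intro conjI allI linearI) (simp_all add: Ga Ga2)
  have comp: "D w u v = G x (\<Gamma> w u) v + G x u (\<Gamma> w v)" for w u v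
    by (simp add: G k_def sG[OF S(2), of u] Dsym[of _ u v] Dsym[of _ w v] Dsym[of _ w u] field_simps)
  have uni: "\<Gamma>' = \<Gamma>" if "\<forall>u v. \<Gamma>' u v = \<Gamma>' v u"
      "\<forall>w u v. D w u v = G x (\<Gamma>' w u) v + G x u (\<Gamma>' w v)" for \<Gamma>'
  proof (intro ext uniq)
    fix u v z
    have "G x (\<Gamma>' u v) z = (D u v z + D v u z - D z u v) / 2"
      by (rule koszul_formula[OF bG[OF S(2)] sG[OF S(2)], where \<Gamma> = \<Gamma>' and D = D]) (use that in blast)+
    then show "G x (\<Gamma>' u v) z = G x (\<Gamma> u v) z" by (simp add: G k_def)
  qed
  show ?thesis
  proof (intro ex1I[of _ \<Gamma>] conjI allI)
    show "bilinear \<Gamma>" by (rule bil)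
    show "\<Gamma> u v = \<Gamma> v u" for u v by (rule Gs)
    show "FD (\<lambda>y. G y u v) x w = G x (\<Gamma> w u) v + G x u (\<Gamma> w v)" for w u v
      using comp by (simp add: D_def)
  qed (use uni in \<open>simp add: D_def\<close>)
qed

subsection \<open>The metric in coordinates\<close>

context
  fixes A :: "('m::{t2_space, second_countable_topology}, 'a::euclidean_space) chart set"
    and g :: "('m, 'a) metric"
  assumes A: "smooth_manifold A" and g: "riemannian_metric A g"
begin

lemma metric_add_left: "u \<in> tangent_space A p \<Longrightarrow> v \<in> tangent_space A p \<Longrightarrow> w \<in> tangent_space A p \<Longrightarrow>
    g p (u + v) w = g p u w + g p v w"
  using g unfolding riemannian_metric_def by blast

lemma metric_scaleR_left: "u \<in> tangent_space A p \<Longrightarrow> w \<in> tangent_space A p \<Longrightarrow>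
    g p (r *\<^sub>R u) w = r * g p u w"
  using g unfolding riemannian_metric_def by blast

lemma metric_commute: "u \<in> tangent_space A p \<Longrightarrow> v \<in> tangent_space A p \<Longrightarrow> g p u v = g p v u"
  using g unfolding riemannian_metric_def by blast

lemma metric_pos: "u \<in> tangent_space A p \<Longrightarrow> u \<noteq> 0 \<Longrightarrow> g p u u > 0"
  using g unfolding riemannian_metric_def by blast

lemma metric_coords_smooth:
  "c \<in> A \<Longrightarrow> smooth_on (cmap c ` cdom c) (\<lambda>x. metric_coords A g c x u v)"
  using g unfolding riemannian_metric_def by blast

lemma charts_at_cinv: "c \<in> A \<Longrightarrow> x \<in> cmap c ` cdom c \<Longrightarrow> c \<in> charts_at A (cinv c x)"
  by (simp add: charts_at_def cinv_in[OF A])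

lemma charts_at_cmap: "c \<in> charts_at A p \<Longrightarrow> cmap c p \<in> cmap c ` cdom c"
  by (simp add: charts_at_def)

lemma metric_coords_eq:
  assumes "c \<in> charts_at A p" "u \<in> tangent_space A p" "v \<in> tangent_space A p"
  shows "g p u v = metric_coords A g c (cmap c p) (u c) (v c)"
  unfolding metric_coords_def
  by (simp only: cinv_cmap[OF A charts_atD[OF assms(1)]] tvec_of_coord[OF A assms(2,1)] tvec_of_coord[OF A assms(3,1)])

lemma metric_coords_sym:
  assumes "c \<in> A" "x \<in> cmap c ` cdom c"
  shows "metric_coords A g c x u v = metric_coords A g c x v u"
  unfolding metric_coords_def
  by (intro metric_commute tvec_of_tangent[OF A] charts_at_cinv assms)

lemma metric_coords_bilinear:
  assumes "c \<in> A" "x \<in> cmap c ` cdom c"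
  shows "bilinear (metric_coords A g c x)"
proof -
  note c = charts_at_cinv[OF assms]
  have l: "metric_coords A g c x (u + u') v = metric_coords A g c x u v + metric_coords A g c x u' v"
    "metric_coords A g c x (r *\<^sub>R u) v = r * metric_coords A g c x u v" for u u' v r
    unfolding metric_coords_def
    by (simp_all only: tvec_of_add[OF A c] tvec_of_scaleR[OF A c] metric_add_left metric_scaleR_left tvec_of_tangent[OF A c])
  then show ?thesis
    unfolding bilinear_def
    by (intro conjI allI linearI) (simp_all add: l metric_coords_sym[OF assms, of u for u])
qed

lemma metric_coords_pos:
  assumes "c \<in> A" "x \<in> cmap c ` cdom c" "u \<noteq> 0"
  shows "metric_coords A g c x u u > 0"
proof -
  note c = charts_at_cinv[OF assms(1,2)]
  have "tvec_of A c (cinv c x) u c = u" by (rule tvec_of_self[OF A c])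
  then have "tvec_of A c (cinv c x) u \<noteq> 0" using assms(3) by (auto simp: zero_fun_def)
  then show ?thesis unfolding metric_coords_def using metric_pos tvec_of_tangent[OF A c] by blast
qed

lemma metric_coords_differentiable:
  "c \<in> A \<Longrightarrow> x \<in> cmap c ` cdom c \<Longrightarrow> (\<lambda>y. metric_coords A g c y u v) differentiable (at x)"
  using metric_coords_smooth smooth_on_differentiable by blast

lemma christoffel_spec:
  assumes c: "c \<in> charts_at A p"
  shows "bilinear (christoffel A g c p)" "christoffel A g c p u v = christoffel A g c p v u"
    "FD (\<lambda>x. metric_coords A g c x u v) (cmap c p) w =
       metric_coords A g c (cmap c p) (christoffel A g c p w u) v +
       metric_coords A g c (cmap c p) u (christoffel A g c p w v)"
proof -
  note cA = charts_atD(1)[OF c]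
  have "\<exists>!\<Gamma>. bilinear \<Gamma> \<and> (\<forall>u v. \<Gamma> u v = \<Gamma> v u) \<and>
        (\<forall>w u v. FD (\<lambda>x. metric_coords A g c x u v) (cmap c p) w =
           metric_coords A g c (cmap c p) (\<Gamma> w u) v +
           metric_coords A g c (cmap c p) u (\<Gamma> w v))"
    by (rule christoffel_ex1[OF open_cmap_cdom[OF A cA] charts_at_cmap[OF c]])
      (intro metric_coords_bilinear metric_coords_sym metric_coords_pos metric_coords_differentiable cA
        charts_at_cmap[OF c]; assumption)+
  from theI'[OF this, folded christoffel_def]
  show "bilinear (christoffel A g c p)" "christoffel A g c p u v = christoffel A g c p v u"
    "FD (\<lambda>x. metric_coords A g c x u v) (cmap c p) w =
       metric_coords A g c (cmap c p) (christoffel A g c p w u) v +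
       metric_coords A g c (cmap c p) u (christoffel A g c p w v)"
    by blast+
qed

text \<open>By the Koszul formula the symbols solve a linear system with the metric as matrix and
  its first derivatives on the right, so \<open>smooth_on_solve\<close> applies.\<close>

lemma christoffel_smooth:
  assumes c: "c \<in> A"
  shows "smooth_on (cmap c ` cdom c) (\<lambda>x. christoffel A g c (cinv c x) u v)"
proof (rule smooth_on_solve[OF open_cmap_cdom[OF A c], of "metric_coords A g c"])
  let ?D = "\<lambda>x w u v. FD (\<lambda>x. metric_coords A g c x u v) x w"
  show "smooth_on (cmap c ` cdom c) (\<lambda>x. inverse 2 * ((?D x u v z + ?D x v u z) - ?D x z u v))" for z
    by (intro smooth_on_mult smooth_on_diff smooth_on_add smooth_on_const open_cmap_cdom[OF A c]
        smooth_on_frechet_derivative[OF metric_coords_smooth[OF c]])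
  fix x z assume x: "x \<in> cmap c ` cdom c"
  note c' = charts_at_cinv[OF c x]
  note ch = christoffel_spec[OF c', unfolded cmap_cinv[OF A c x]]
  have "metric_coords A g c x (christoffel A g c (cinv c x) u v) z = (?D x u v z + ?D x v u z - ?D x z u v) / 2"
    by (rule koszul_formula[where D = "?D x", OF metric_coords_bilinear[OF c x] metric_coords_sym[OF c x] ch(2) ch(3)])
  then show "metric_coords A g c x (christoffel A g c (cinv c x) u v) z =
      inverse 2 * ((?D x u v z + ?D x v u z) - ?D x z u v)" by (simp add: field_simps)
qed (simp_all add: metric_coords_bilinear[OF c] metric_coords_pos[OF c] metric_coords_smooth[OF c])

text \<open>The defect \<open>B\<close> of the transformation law is symmetric, and differentiating the isometry
  condition makes \<open>G' (B w u) (\<tau>' v)\<close> skew in \<open>u\<close>, \<open>v\<close>; a trilinear form that is symmetric in the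
  first two and skew in the last two arguments vanishes.\<close>

lemma christoffel_transition:
  assumes c: "c \<in> charts_at A p" and d: "d \<in> charts_at A p"
  defines "\<tau> \<equiv> cmap d \<circ> cinv c"
  defines "D\<tau> \<equiv> FD \<tau> (cmap c p)"
  shows "christoffel A g d p (D\<tau> u) (D\<tau> v) = D\<tau> (christoffel A g c p u v) -
    FD (\<lambda>x. FD \<tau> x u) (cmap c p) v"
proof -
  note cA = charts_atD(1)[OF c] and dA = charts_atD(1)[OF d]
  let ?S = "cmap c ` (cdom c \<inter> cdom d)" and ?x = "cmap c p"
  let ?G = "metric_coords A g c" and ?G' = "metric_coords A g d"
  let ?C = "christoffel A g c p" and ?C' = "christoffel A g d p"
  have S: "open ?S" by (intro open_cmap_image[OF A] open_cdom[OF A] cA dA)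
  have x: "?x \<in> ?S" using charts_atD(2)[OF c] charts_atD(2)[OF d] by blast
  have \<tau>x: "\<tau> ?x = cmap d p" by (simp add: \<tau>_def cinv_cmap[OF A charts_atD[OF c]])
  have st: "smooth_on ?S \<tau>" unfolding \<tau>_def by (rule transition_smooth[OF A cA dA])
  have lt: "linear D\<tau>" unfolding D\<tau>_def \<tau>_def by (rule linear_transition[OF A c d])
  define D2 where "D2 = (\<lambda>w u. FD (\<lambda>x. FD \<tau> x u) ?x w)"
  have D2: "((\<lambda>x. FD \<tau> x u) has_derivative (\<lambda>w. D2 w u)) (at ?x)" for u
    unfolding D2_def by (rule smooth_on_has_derivative[OF smooth_on_frechet_derivative[OF st] x])
  have D2s: "D2 w u = D2 u w" for u w unfolding D2_def by (rule second_derivative_symmetric[OF S x st])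
  have iso: "?G y u v = ?G' (\<tau> y) (FD \<tau> y u) (FD \<tau> y v)"
    if y: "y \<in> ?S" for y u v
  proof -
    have yc: "y \<in> cmap c ` cdom c" using y by blast
    have c': "c \<in> charts_at A (cinv c y)" by (rule charts_at_cinv[OF cA yc])
    have d': "d \<in> charts_at A (cinv c y)" using y dA by (auto simp: charts_at_def cinv_cmap[OF A cA])
    have "tvec_of A c (cinv c y) u d = FD \<tau> y u" for u
      using d' by (simp add: tvec_of_def \<tau>_def cmap_cinv[OF A cA yc])
    then show ?thesis
      unfolding metric_coords_def[of A g c]
      using metric_coords_eq[OF d' tvec_of_tangent[OF A c'] tvec_of_tangent[OF A c']]
      by (simp add: \<tau>_def)
  qed
  note xd = charts_at_cmap[OF d, folded \<tau>x]
  note b' = metric_coords_bilinear[OF dA xd]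
  note lin = bilinear_ladd[OF b'] bilinear_radd[OF b'] bilinear_lsub[OF b'] bilinear_rsub[OF b']
  define B where "B = (\<lambda>w u. D2 w u - D\<tau> (?C w u) + ?C' (D\<tau> w) (D\<tau> u))"
  have Bs: "B w u = B u w" for w u
    by (simp add: B_def D2s[of w] christoffel_spec(2)[OF c, of w] christoffel_spec(2)[OF d, of "D\<tau> w"])
  have skew: "?G' (\<tau> ?x) (B w u) (D\<tau> v) + ?G' (\<tau> ?x) (D\<tau> u) (B w v) = 0" for w u v
  proof -
    have "((\<lambda>y. ?G' (\<tau> y) (FD \<tau> y u) (FD \<tau> y v)) has_derivative
        (\<lambda>w. FD (\<lambda>y. ?G' y (D\<tau> u) (D\<tau> v)) (\<tau> ?x) (D\<tau> w) +
          ?G' (\<tau> ?x) (D2 w u) (D\<tau> v) + ?G' (\<tau> ?x) (D\<tau> u) (D2 w v))) (at ?x)"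
      unfolding D\<tau>_def
      by (rule has_derivative_bilinear_field[OF open_cmap_cdom[OF A dA] xd _ _
            smooth_on_has_derivative[OF st x] D2 D2])
        (simp_all only: metric_coords_bilinear[OF dA] metric_coords_differentiable[OF dA xd])
    then have "((\<lambda>y. ?G y u v) has_derivative
        (\<lambda>w. FD (\<lambda>y. ?G' y (D\<tau> u) (D\<tau> v)) (\<tau> ?x) (D\<tau> w) +
          ?G' (\<tau> ?x) (D2 w u) (D\<tau> v) + ?G' (\<tau> ?x) (D\<tau> u) (D2 w v))) (at ?x)"
      by (rule has_derivative_transform_within_open[OF _ S x]) (simp only: iso)
    then have "FD (\<lambda>y. ?G y u v) ?x w =
        FD (\<lambda>y. ?G' y (D\<tau> u) (D\<tau> v)) (\<tau> ?x) (D\<tau> w) +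
          ?G' (\<tau> ?x) (D2 w u) (D\<tau> v) + ?G' (\<tau> ?x) (D\<tau> u) (D2 w v)"
      by (simp add: frechet_derivative_at[symmetric])
    moreover have "FD (\<lambda>y. ?G y u v) ?x w =
        ?G' (\<tau> ?x) (D\<tau> (?C w u)) (D\<tau> v) + ?G' (\<tau> ?x) (D\<tau> u) (D\<tau> (?C w v))"
      unfolding christoffel_spec(3)[OF c] by (simp only: iso[OF x] D\<tau>_def)
    moreover note christoffel_spec(3)[OF d, of "D\<tau> u" "D\<tau> v" "D\<tau> w", folded \<tau>x]
    ultimately show ?thesis by (simp add: B_def lin)
  qed
  have G's: "?G' (\<tau> ?x) a b = ?G' (\<tau> ?x) b a" for a b by (rule metric_coords_sym[OF dA xd])
  have z: "?G' (\<tau> ?x) (B w u) (D\<tau> v) = 0" for w u v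
    using skew[of w u v] skew[of v w u] skew[of u v w] Bs[of w u] Bs[of v w] Bs[of u v]
      G's[of "D\<tau> u"] G's[of "D\<tau> v"] G's[of "D\<tau> w"] by simp
  have "B w u = 0" for w u
  proof (rule ccontr)
    assume n: "B w u \<noteq> 0"
    \<comment> \<open>\<open>D\<tau>\<close> is onto, so the defect itself may be taken for
      \<open>D\<tau> v\<close> in \<open>z\<close>; positive definiteness then forces it to
      vanish.\<close>
    have "D\<tau> (FD (cmap c \<circ> cinv d) (cmap d p) (B w u)) = B w u"
      using transition_cocycle[OF A d c d] transition_self[OF A d] by (simp add: D\<tau>_def \<tau>_def)
    then show False using z[of w u] metric_coords_pos[OF dA xd n] by (metis less_irrefl)
  qed
  from this[of u v] have "?C' (D\<tau> u) (D\<tau> v) = D\<tau> (?C u v) - D2 v u"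
    unfolding B_def D2s[of u v] by (simp add: algebra_simps)
  then show ?thesis by (simp only: D2_def)
qed

end

subsection \<open>Geodesics\<close>

lemma vector_derivative_eq_frechet:
  fixes f :: "real \<Rightarrow> 'b::euclidean_space"
  assumes "f differentiable (at t)"
  shows "(f has_vector_derivative FD f t 1) (at t)"
proof -
  have d: "(f has_derivative FD f t) (at t)"
    using assms frechet_derivative_works by blast
  have "FD f t = (\<lambda>h. h *\<^sub>R FD f t 1)"
  proof
    fix h show "FD f t h = h *\<^sub>R FD f t 1"
      using linear_scale[OF has_derivative_linear[OF d], of h 1] by simp
  qed
  with d show ?thesis unfolding has_vector_derivative_def by simp
qed

context
  fixes A :: "('m::{t2_space, second_countable_topology}, 'a::euclidean_space) chart set"
  assumes A: "smooth_manifold A"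
begin

context
  fixes I :: "real set" and \<alpha> :: "real \<Rightarrow> 'm"
  assumes I: "open I" and \<alpha>: "smooth_curve A I \<alpha>"
begin

lemma open_curve_vimage: "c \<in> A \<Longrightarrow> open (I \<inter> \<alpha> -` cdom c)"
  using \<alpha> I open_cdom[OF A] unfolding smooth_curve_def
  by (metis Int_commute continuous_on_open_vimage)

lemma curve_coords_smooth: "c \<in> A \<Longrightarrow> smooth_on (I \<inter> \<alpha> -` cdom c) (cmap c \<circ> \<alpha>)"
  using \<alpha> unfolding smooth_curve_def by blast

lemma velocity_coords:
  assumes c: "c \<in> charts_at A (\<alpha> t)" and t: "t \<in> I"
  shows "(cmap c \<circ> \<alpha> has_vector_derivative velocity A \<alpha> t c) (at t)"
    and "velocity A \<alpha> t c = FD (cmap c \<circ> \<alpha>) t 1"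
proof -
  have "t \<in> I \<inter> \<alpha> -` cdom c" using t charts_atD(2)[OF c] by blast
  then have d: "(cmap c \<circ> \<alpha> has_vector_derivative FD (cmap c \<circ> \<alpha>) t 1) (at t)"
    using curve_coords_smooth[OF charts_atD(1)[OF c]] smooth_on_differentiable
    by (intro vector_derivative_eq_frechet) blast
  then have "vector_derivative (cmap c \<circ> \<alpha>) (at t) = FD (cmap c \<circ> \<alpha>) t 1"
    by (rule vector_derivative_at)
  with d show "(cmap c \<circ> \<alpha> has_vector_derivative velocity A \<alpha> t c) (at t)"
    and "velocity A \<alpha> t c = FD (cmap c \<circ> \<alpha>) t 1"
    using c by (simp_all add: velocity_def)
qed

lemma velocity_tangent:
  assumes t: "t \<in> I"
  shows "velocity A \<alpha> t \<in> tangent_space A (\<alpha> t)"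
  unfolding tangent_space_def mem_Collect_eq
proof (intro conjI ballI allI impI)
  fix c d assume c: "c \<in> charts_at A (\<alpha> t)" and d: "d \<in> charts_at A (\<alpha> t)"
  note cA = charts_atD(1)[OF c]
  have "(cmap d \<circ> cinv c has_derivative FD (cmap d \<circ> cinv c) (cmap c (\<alpha> t)))
      (at ((cmap c \<circ> \<alpha>) t))"
    using transition_has_derivative[OF A c d] by simp
  from has_derivative_compose[OF velocity_coords(1)[OF c t, unfolded has_vector_derivative_def] this]
  have "((\<lambda>s. (cmap d \<circ> cinv c) ((cmap c \<circ> \<alpha>) s)) has_vector_derivative
      FD (cmap d \<circ> cinv c) (cmap c (\<alpha> t)) (velocity A \<alpha> t c)) (at t)"
    by (simp add: has_vector_derivative_def linear_scale[OF linear_transition[OF A c d]])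
  then have "(cmap d \<circ> \<alpha> has_vector_derivative
      FD (cmap d \<circ> cinv c) (cmap c (\<alpha> t)) (velocity A \<alpha> t c)) (at t)"
    by (rule has_vector_derivative_transform_within_open[OF _ open_curve_vimage[OF cA]])
      (use t charts_atD(2)[OF c] in \<open>auto simp: cinv_cmap[OF A cA]\<close>)
  with velocity_coords(1)[OF d t]
  show "velocity A \<alpha> t d = FD (cmap d \<circ> cinv c) (cmap c (\<alpha> t)) (velocity A \<alpha> t c)"
    by (rule vector_derivative_unique_at)
qed (simp add: velocity_def)

lemma velocity_coords_differentiable:
  assumes c: "c \<in> charts_at A (\<alpha> t)" and t: "t \<in> I"
  shows "(\<lambda>s. velocity A \<alpha> s c) differentiable (at t)"
proof -
  note cA = charts_atD(1)[OF c]
  have t': "t \<in> I \<inter> \<alpha> -` cdom c" using t charts_atD(2)[OF c] by blast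
  have "((\<lambda>s. FD (cmap c \<circ> \<alpha>) s 1) has_derivative
      FD (\<lambda>s. FD (cmap c \<circ> \<alpha>) s 1) t) (at t)"
    by (rule smooth_on_has_derivative[OF smooth_on_frechet_derivative[OF curve_coords_smooth[OF cA]] t'])
  then have "((\<lambda>s. velocity A \<alpha> s c) has_derivative
      FD (\<lambda>s. FD (cmap c \<circ> \<alpha>) s 1) t) (at t)"
    by (rule has_derivative_transform_within_open[OF _ open_curve_vimage[OF cA] t'])
      (use cA in \<open>auto intro!: velocity_coords(2)[symmetric] simp: charts_at_def\<close>)
  then show ?thesis by (auto simp: differentiable_def)
qed

end

text \<open>\<open>geodesic\<close> imposes its equation at time \<open>t\<close> in the chart
  \<open>chart_at A (\<alpha> t)\<close>. The equation is read off in that chart, which is kept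
  fixed while \<open>s\<close> varies near \<open>t\<close>.\<close>

lemma geodesic_acceleration:
  assumes \<alpha>: "geodesic A g I \<alpha>" and t: "t \<in> I"
  defines "c \<equiv> chart_at A (\<alpha> t)"
  shows "((\<lambda>s. velocity A \<alpha> s c) has_vector_derivative
    - christoffel A g c (\<alpha> t) (velocity A \<alpha> t c) (velocity A \<alpha> t c)) (at t)"
proof -
  have I: "open I" and sc: "smooth_curve A I \<alpha>" using \<alpha> by (auto simp: geodesic_def)
  have c: "c \<in> charts_at A (\<alpha> t)" unfolding c_def by (rule chart_at_in[OF A])
  let ?a = "vector_derivative (\<lambda>s. velocity A \<alpha> s c) (at t) +
         christoffel A g c (\<alpha> t) (velocity A \<alpha> t c) (velocity A \<alpha> t c)"
  have "tvec_of A c (\<alpha> t) ?a = 0"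
    using \<alpha> t unfolding geodesic_def cov_deriv_along_def Let_def c_def by blast
  then have "?a = 0" using tvec_of_self[OF A c, of ?a] by (simp add: zero_fun_def)
  moreover have "((\<lambda>s. velocity A \<alpha> s c) has_vector_derivative
      vector_derivative (\<lambda>s. velocity A \<alpha> s c) (at t)) (at t)"
    using vector_derivative_eq_frechet[OF velocity_coords_differentiable[OF I sc c t]]
      vector_derivative_at by metis
  ultimately show ?thesis by (metis eq_neg_iff_add_eq_0)
qed

end

text \<open>Bootstrapping: if \<open>z\<close> is C^k, then so is its derivative
  \<open>Y (z t)\<close>.\<close>

lemma smooth_on_ode_solution:
  assumes J: "open J" and W: "open W" and Y: "smooth_on W Y"
    and z: "\<And>t. t \<in> J \<Longrightarrow> z t \<in> W" "\<And>t. t \<in> J \<Longrightarrow> (z has_vector_derivative Y (z t)) (at t)"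
  shows "smooth_on J z"
proof -
  have "Ck_on k J z" for k
  proof (induction k)
    case 0
    have "isCont z t" if "t \<in> J" for t
      using z(2)[OF that] has_derivative_continuous unfolding has_vector_derivative_def by blast
    then show ?case by (simp add: continuous_at_imp_continuous_on)
  next
    case (Suc k)
    show ?case
    proof (rule Ck_on_SucI[OF J])
      show "(z has_derivative (\<lambda>h. h *\<^sub>R Y (z t))) (at t)" if "t \<in> J" for t
        using z(2)[OF that] by (simp add: has_vector_derivative_def)
      have "Ck_on k J (\<lambda>t. Y (z t))"
        by (rule Ck_on_compose[OF J W _ _ Suc]) (use z Y in \<open>auto simp: smooth_on_def\<close>)
      then show "Ck_on k J (\<lambda>t. h *\<^sub>R Y (z t))" for h by (intro Ck_on_scaleR Ck_on_const J)
    qed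
  qed
  then show ?thesis by (simp add: smooth_on_def)
qed

section \<open>Existence of geodesics with prescribed initial velocity\<close>

context
  fixes A :: "('m::{t2_space, second_countable_topology}, 'a::euclidean_space) chart set"
    and g :: "('m, 'a) metric"
  assumes A: "smooth_manifold A" and g: "riemannian_metric A g"
begin

text \<open>This field is the geodesic equation as a first order system in position and velocity.
  \<open>christoffel_smooth\<close> covers fixed arguments, so the quadratic dependence on the
  velocity is expanded in \<open>Basis\<close>.\<close>

lemma geodesic_spray_smooth:
  assumes c: "c \<in> A"
  shows "smooth_on ((cmap c ` cdom c) \<times> UNIV)
    (\<lambda>z. (snd z, - christoffel A g c (cinv c (fst z)) (snd z) (snd z)))" (is "smooth_on ?W _")
proof -
  have W: "open ?W" by (intro open_Times open_cmap_cdom[OF A c] open_UNIV)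
  have fst: "smooth_on ?W fst" and snd: "smooth_on ?W snd"
    by (rule smooth_on_linear[OF W linear_fst], rule smooth_on_linear[OF W linear_snd])
  have C: "smooth_on ?W (\<lambda>z. christoffel A g c (cinv c (fst z)) i j)" for i j
    by (rule smooth_on_compose[OF W open_cmap_cdom[OF A c] _ christoffel_smooth[OF A g c] fst]) auto
  let ?s = "\<lambda>z. \<Sum>i\<in>Basis. (snd z \<bullet> i) *\<^sub>R (\<Sum>j\<in>Basis. (snd z \<bullet> j) *\<^sub>R christoffel A g c (cinv c (fst z)) i j)"
  have s: "smooth_on ?W ?s"
    by (intro smooth_on_sum smooth_on_scaleR smooth_on_inner smooth_on_const C snd W finite_Basis)
  have "christoffel A g c (cinv c (fst z)) (snd z) (snd z) = ?s z" if "z \<in> ?W" for z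
  proof -
    have "c \<in> charts_at A (cinv c (fst z))" using that by (intro charts_at_cinv[OF A g c]) auto
    from christoffel_spec(1)[OF A g this]
    have l: "linear (\<lambda>i. christoffel A g c (cinv c (fst z)) i v)" "linear (christoffel A g c (cinv c (fst z)) u)" for u v
      by (simp_all add: bilinear_def)
    show ?thesis
      by (subst linear_expand[OF l(1)], intro sum.cong refl arg_cong[of _ _ "scaleR _"]) (rule linear_expand[OF l(2)])
  qed
  then have C2: "smooth_on ?W (\<lambda>z. christoffel A g c (cinv c (fst z)) (snd z) (snd z))"
    by (rule iffD2[OF smooth_on_cong[OF W] s])
  have lin: "linear (\<lambda>u::'a. (0 :: 'a, - u))" "linear (\<lambda>u::'a. (u, 0 :: 'a))" by (auto intro!: linearI)
  from smooth_on_compose[OF W open_UNIV _ smooth_on_linear[OF open_UNIV lin(1)] C2]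
  have "smooth_on ?W (\<lambda>z. (0 :: 'a, - christoffel A g c (cinv c (fst z)) (snd z) (snd z)))"
    by simp
  moreover from smooth_on_compose[OF W open_UNIV _ smooth_on_linear[OF open_UNIV lin(2)] snd]
  have "smooth_on ?W (\<lambda>z. (snd z, 0 :: 'a))"
    by simp
  ultimately have "smooth_on ?W (\<lambda>z. (snd z, 0) + (0, - christoffel A g c (cinv c (fst z)) (snd z) (snd z)))"
    by (intro smooth_on_add W)
  then show ?thesis by simp
qed

text \<open>The equation is given in the one chart \<open>c\<close>, but \<open>geodesic\<close>
  tests it at each \<open>t\<close> in the chart that \<open>chart_at\<close> picks for that point.
  The transformation law of the Christoffel symbols carries it over.\<close>

lemma geodesic_of_coords:
  assumes c: "c \<in> A" and J: "open J" "is_interval J" and x: "\<And>t. t \<in> J \<Longrightarrow> x t \<in> cmap c ` cdom c"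
    and sx: "smooth_on J x" and dx: "\<And>t. t \<in> J \<Longrightarrow> (x has_vector_derivative u t) (at t)"
    and du: "\<And>t. t \<in> J \<Longrightarrow> (u has_vector_derivative - christoffel A g c (cinv c (x t)) (u t) (u t)) (at t)"
  shows "geodesic A g J (\<lambda>t. cinv c (x t))"
    and "\<And>t. t \<in> J \<Longrightarrow> velocity A (\<lambda>t. cinv c (x t)) t c = u t"
proof -
  define \<alpha> where "\<alpha> = (\<lambda>t. cinv c (x t))"
  have cx: "cmap c (\<alpha> t) = x t" "\<alpha> t \<in> cdom c" if "t \<in> J" for t
    using x[OF that] by (simp_all add: \<alpha>_def cmap_cinv[OF A c] cinv_in[OF A c])
  have ca: "continuous_on J \<alpha>"
    unfolding \<alpha>_def
    by (rule continuous_on_compose2[OF continuous_on_cinv[OF A c] smooth_on_imp_continuous_on[OF sx]]) (use x in auto)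
  have op: "open (J \<inter> \<alpha> -` cdom e)" if "e \<in> A" for e
    using ca J open_cdom[OF A that] by (metis Int_commute continuous_on_open_vimage)
  have sc: "smooth_curve A J \<alpha>"
    unfolding smooth_curve_def
  proof (intro conjI ca ballI)
    fix e assume e: "e \<in> A"
    have "smooth_on (J \<inter> \<alpha> -` cdom e) (\<lambda>t. (cmap e \<circ> cinv c) (x t))"
    proof (rule smooth_on_compose[OF op[OF e] _ _ transition_smooth[OF A c e]])
      show "open (cmap c ` (cdom c \<inter> cdom e))" by (intro open_cmap_image[OF A c] open_cdom[OF A e])
      show "x ` (J \<inter> \<alpha> -` cdom e) \<subseteq> cmap c ` (cdom c \<inter> cdom e)"
        using cx by (metis (no_types, lifting) Int_iff imageI image_subsetI vimageE)
    qed (use sx smooth_on_subset in blast)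
    then show "smooth_on (J \<inter> \<alpha> -` cdom e) (cmap e \<circ> \<alpha>)" by (simp add: \<alpha>_def comp_def)
  qed
  have vc: "velocity A \<alpha> t c = u t" if t: "t \<in> J" for t
  proof -
    have "c \<in> charts_at A (\<alpha> t)" using c cx(2)[OF t] by (simp add: charts_at_def)
    moreover have "(cmap c \<circ> \<alpha> has_vector_derivative u t) (at t)"
      by (rule has_vector_derivative_transform_within_open[OF dx[OF t] J(1) t]) (simp add: cx)
    ultimately show ?thesis
      using velocity_coords(1)[OF A J(1) sc _ t] vector_derivative_unique_at by blast
  qed
  have "cov_deriv_along A g \<alpha> (velocity A \<alpha>) t = 0" if t: "t \<in> J" for t
  proof -
    define e where "e = chart_at A (\<alpha> t)"
    define \<tau> where "\<tau> = cmap e \<circ> cinv c"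
    have et: "e \<in> charts_at A (\<alpha> t)" unfolding e_def by (rule chart_at_in[OF A])
    note e = charts_atD(1)[OF et]
    have ct: "c \<in> charts_at A (\<alpha> t)" using c cx(2)[OF t] by (simp add: charts_at_def)
    let ?K = "J \<inter> \<alpha> -` cdom e"
    have tK: "t \<in> ?K" using t charts_atD(2)[OF et] by blast
    have ve: "velocity A \<alpha> s e = FD \<tau> (x s) (u s)" if s: "s \<in> ?K" for s
    proof -
      have sJ: "s \<in> J" using s by blast
      have "c \<in> charts_at A (\<alpha> s)" "e \<in> charts_at A (\<alpha> s)" using c e cx(2)[OF sJ] s by (auto simp: charts_at_def)
      from tangent_transition[OF A velocity_tangent[OF A J(1) sc sJ] this]
      show ?thesis by (simp add: vc[OF sJ] cx(1)[OF sJ] \<tau>_def)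
    qed
    have S: "open (cmap c ` (cdom c \<inter> cdom e))" "x t \<in> cmap c ` (cdom c \<inter> cdom e)"
      using open_cmap_image[OF A c open_cdom[OF A e]] imageI[of "\<alpha> t" "cdom c \<inter> cdom e" "cmap c"]
        cx[OF t] charts_atD(2)[OF et] by auto
    have st: "smooth_on (cmap c ` (cdom c \<inter> cdom e)) \<tau>" unfolding \<tau>_def by (rule transition_smooth[OF A c e])
    let ?D2 = "\<lambda>i. FD (\<lambda>y. FD \<tau> y i) (x t)"
    have "((\<lambda>s. FD \<tau> (x s) (u s)) has_derivative
      (\<lambda>h. ?D2 (u t) (h *\<^sub>R u t) + FD \<tau> (x t) (h *\<^sub>R (- christoffel A g c (\<alpha> t) (u t) (u t))))) (at t)"
    proof (rule has_derivative_linear_field[of "\<lambda>s i. FD \<tau> (x s) i" "\<lambda>h i. ?D2 i (h *\<^sub>R u t)", OF _ _ op[OF e] tK])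
      show "((\<lambda>s. FD \<tau> (x s) i) has_derivative (\<lambda>h. ?D2 i (h *\<^sub>R u t))) (at t)" for i
        by (rule has_derivative_compose[OF dx[OF t, unfolded has_vector_derivative_def]
              smooth_on_has_derivative[OF smooth_on_frechet_derivative[OF st] S(2)]])
      show "linear (\<lambda>i. ?D2 i (h *\<^sub>R u t))" for h
        by (rule linear_frechet_field[OF S])
          (auto intro: smooth_on_linear_frechet[OF st] smooth_on_differentiable[OF smooth_on_frechet_derivative[OF st] S(2)])
      show "linear (\<lambda>i. FD \<tau> (x s) i)" if s: "s \<in> ?K" for s
      proof -
        have "x s \<in> cmap c ` (cdom c \<inter> cdom e)" using s cx[of s] by (metis Int_iff imageI vimageE)
        then show ?thesis by (rule smooth_on_linear_frechet[OF st])
      qed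
    qed (use du[OF t] in \<open>simp add: has_vector_derivative_def \<alpha>_def\<close>)
    then have "((\<lambda>s. FD \<tau> (x s) (u s)) has_vector_derivative
      ?D2 (u t) (u t) - FD \<tau> (x t) (christoffel A g c (\<alpha> t) (u t) (u t))) (at t)"
      using smooth_on_linear_frechet[OF smooth_on_frechet_derivative[OF st] S(2)] smooth_on_linear_frechet[OF st S(2)]
      by (simp add: has_vector_derivative_def linear_scale linear_neg scaleR_diff_right)
    then have "((\<lambda>s. velocity A \<alpha> s e) has_vector_derivative
      ?D2 (u t) (u t) - FD \<tau> (x t) (christoffel A g c (\<alpha> t) (u t) (u t))) (at t)"
      by (rule has_vector_derivative_transform_within_open[OF _ op[OF e] tK]) (simp add: ve)
    then have "vector_derivative (\<lambda>s. velocity A \<alpha> s e) (at t) =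
      ?D2 (u t) (u t) - FD \<tau> (x t) (christoffel A g c (\<alpha> t) (u t) (u t))"
      by (rule vector_derivative_at)
    \<comment> \<open>Differentiating the transition map along the curve produced
      \<open>?D2 (u t) (u t)\<close>; the inhomogeneous term of
      \<open>christoffel_transition\<close> cancels it.\<close>
    moreover have "christoffel A g e (\<alpha> t) (velocity A \<alpha> t e) (velocity A \<alpha> t e) =
        FD \<tau> (x t) (christoffel A g c (\<alpha> t) (u t) (u t)) - ?D2 (u t) (u t)"
      using christoffel_transition[OF A g ct et, of "u t" "u t"] by (simp add: ve[OF tK] \<tau>_def cx(1)[OF t])
    ultimately show ?thesis
      by (simp add: cov_deriv_along_def Let_def e_def[symmetric] tvec_of_0[OF A et])
  qed
  then show "geodesic A g J (\<lambda>t. cinv c (x t))"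
    using J sc unfolding geodesic_def \<alpha>_def by blast
  show "\<And>t. t \<in> J \<Longrightarrow> velocity A (\<lambda>t. cinv c (x t)) t c = u t"
    using vc unfolding \<alpha>_def .
qed

text \<open>Needed to turn a statement about all geodesics into one about all tangent
  vectors.\<close>

lemma geodesic_exists:
  assumes v: "v \<in> tangent_space A p"
  obtains I \<alpha> where "geodesic A g I \<alpha>" "0 \<in> I" "\<alpha> 0 = p" "velocity A \<alpha> 0 = v"
proof -
  define c where "c = chart_at A p"
  have cp: "c \<in> charts_at A p" unfolding c_def by (rule chart_at_in[OF A])
  note c = charts_atD(1)[OF cp]
  let ?W = "(cmap c ` cdom c) \<times> (UNIV :: 'a set)"
  let ?Y = "\<lambda>z. (snd z, - christoffel A g c (cinv c (fst z)) (snd z) (snd z))"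
  have W: "open ?W" by (intro open_Times open_cmap_cdom[OF A c] open_UNIV)
  have Y: "smooth_on ?W ?Y" by (rule geodesic_spray_smooth[OF c])
  have "(cmap c p, v c) \<in> ?W" using charts_atD(2)[OF cp] by simp
  then obtain \<epsilon> z where \<epsilon>: "\<epsilon> > 0" and z0: "z 0 = (cmap c p, v c)" and z: "\<And>t. \<bar>t\<bar> < \<epsilon> \<Longrightarrow> z t \<in> ?W"
    "\<And>t. \<bar>t\<bar> < \<epsilon> \<Longrightarrow> (z has_vector_derivative ?Y (z t)) (at t)"
    using ode_local_existence[OF W _ Y[unfolded smooth_on_def, THEN spec]] by blast
  let ?J = "{-\<epsilon><..<\<epsilon>}"
  have J: "t \<in> ?J \<longleftrightarrow> \<bar>t\<bar> < \<epsilon>" for t by auto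
  have sz: "smooth_on ?J z"
    by (rule smooth_on_ode_solution[OF _ W Y]) (use z in \<open>auto simp: abs_less_iff\<close>)
  have s1: "smooth_on ?J (\<lambda>t. fst (z t))"
    by (rule smooth_on_compose[OF _ open_UNIV _ smooth_on_linear[OF open_UNIV linear_fst] sz]) auto
  have d1: "((\<lambda>t. fst (z t)) has_vector_derivative snd (z t)) (at t)"
    and d2: "((\<lambda>t. snd (z t)) has_vector_derivative - christoffel A g c (cinv c (fst (z t))) (snd (z t)) (snd (z t))) (at t)"
    if "t \<in> ?J" for t
    using bounded_linear.has_vector_derivative[OF bounded_linear_fst z(2), of t]
      bounded_linear.has_vector_derivative[OF bounded_linear_snd z(2), of t] that by (simp_all add: abs_less_iff)
  have in1: "fst (z t) \<in> cmap c ` cdom c" if "t \<in> ?J" for t using z(1)[of t] that J by (metis mem_Times_iff)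
  note G = geodesic_of_coords[OF c _ _ in1 s1 d1 d2]
  have 0: "0 \<in> ?J" using \<epsilon> by simp
  show ?thesis
  proof
    show geo: "geodesic A g ?J (\<lambda>t. cinv c (fst (z t)))" by (rule G(1)) auto
    show "0 \<in> ?J" by (rule 0)
    show p: "cinv c (fst (z 0)) = p" by (simp add: z0 cinv_cmap[OF A charts_atD[OF cp]])
    have "velocity A (\<lambda>t. cinv c (fst (z t))) 0 c = v c"
      using G(2)[OF _ _ _ _ _ 0] by (simp add: z0)
    moreover have "velocity A (\<lambda>t. cinv c (fst (z t))) 0 \<in> tangent_space A p"
      using velocity_tangent[OF A _ _ 0] geo p unfolding geodesic_def by metis
    ultimately show "velocity A (\<lambda>t. cinv c (fst (z t))) 0 = v"
      using tangent_eqI[OF A _ v cp] by blast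
  qed
qed

end

subsection \<open>Conformal submersions in coordinates\<close>

text \<open>The \<open>G\<close>-orthogonal projection of \<open>a\<close> to the kernel of
  \<open>L\<close>. To avoid linear algebra on a subspace, \<open>G\<close> on the kernel is
  completed by an inner product on the range of a right inverse \<open>R\<close> to a positive
  definite form on the whole space.\<close>

lemma orthogonal_decomposition:
  fixes G :: "'a::euclidean_space \<Rightarrow> 'a \<Rightarrow> real" and L :: "'a \<Rightarrow> 'b::euclidean_space"
  assumes G: "bilinear G" "\<And>z. z \<noteq> 0 \<Longrightarrow> G z z > 0" and L: "linear L" "surj L"
  shows "\<exists>v. L v = 0 \<and> (\<forall>z. L z = 0 \<longrightarrow> G v z = G a z)"
proof -
  obtain R where R: "linear R" "L \<circ> R = id" using linear_surjective_right_inverse[OF L] by blast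
  have LR: "L (R y) = y" for y using R(2) by (metis comp_apply id_apply)
  define P where "P = (\<lambda>z. z - R (L z))"
  note ll = linear_add[OF L(1)] linear_scale[OF L(1)] linear_add[OF R(1)] linear_scale[OF R(1)] linear_0[OF R(1)] linear_0[OF L(1)]
  note gl = bilinear_ladd[OF G(1)] bilinear_radd[OF G(1)] bilinear_lmul[OF G(1)] bilinear_rmul[OF G(1)]
    bilinear_lzero[OF G(1)] bilinear_rzero[OF G(1)]
  have P: "P (x + y) = P x + P y" "P (r *\<^sub>R x) = r *\<^sub>R P x" for x y r
    by (simp_all add: P_def ll algebra_simps)
  define G1 where "G1 = (\<lambda>u z. G (P u) (P z) + R (L u) \<bullet> R (L z))"
  have b: "bilinear G1"
    unfolding bilinear_def G1_def
    by (intro conjI allI linearI) (simp_all add: P ll gl inner_add_left inner_add_right algebra_simps)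
  have p: "G1 z z > 0" if "z \<noteq> 0" for z
  proof (cases "P z = 0")
    case True
    then have "R (L z) \<noteq> 0" using that by (simp add: P_def)
    then show ?thesis by (simp add: G1_def True gl)
  next
    case False
    then show ?thesis using G(2)[of "P z"] by (simp add: G1_def add_pos_nonneg)
  qed
  have "linear (\<lambda>z. G a (P z))" by (rule linearI) (simp_all add: P gl)
  from bilinear_pos_def_solve[OF b p this] obtain u where u: "\<And>z. G1 u z = G a (P z)" by blast
  \<comment> \<open>Testing the equation with \<open>R (L u)\<close>, on which \<open>P\<close>
    vanishes, leaves only the squared norm of this vector; hence the solution lies in the kernel of
    \<open>L\<close>.\<close>
  have "P (R (L u)) = 0" by (simp add: P_def LR)
  then have "R (L u) \<bullet> R (L u) = 0" using u[of "R (L u)"] by (simp add: G1_def gl LR)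
  then have Lu: "L u = 0" using LR[of "L u"] by (simp add: ll)
  moreover have "G u z = G a z" if "L z = 0" for z
    using u[of z] that Lu by (simp add: G1_def P_def ll)
  ultimately show ?thesis by blast
qed

text \<open>\<open>\<phi>\<close> is F in a pair of charts, \<open>G\<close> and \<open>G'\<close>
  are the coordinate expressions of the two metrics and \<open>l\<close> that of the dilation. All
  computations with derivatives of K take place in this Euclidean setting.\<close>

locale conformal_coords =
  fixes S :: "'a::euclidean_space set" and T :: "'b::euclidean_space set"
    and G :: "'a \<Rightarrow> 'a \<Rightarrow> 'a \<Rightarrow> real" and G' :: "'b \<Rightarrow> 'b \<Rightarrow> 'b \<Rightarrow> real"
    and \<phi> :: "'a \<Rightarrow> 'b" and l :: "'a \<Rightarrow> real"
  assumes S: "open S" and T: "open T" and \<phi>T: "\<phi> ` S \<subseteq> T"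
    and s\<phi>: "smooth_on S \<phi>" and sl: "smooth_on S l" and l: "\<And>y. y \<in> S \<Longrightarrow> l y > 0"
    and bG: "\<And>y. y \<in> S \<Longrightarrow> bilinear (G y)" and symG: "\<And>y u v. y \<in> S \<Longrightarrow> G y u v = G y v u"
    and pG: "\<And>y u. y \<in> S \<Longrightarrow> u \<noteq> 0 \<Longrightarrow> G y u u > 0" and sG: "\<And>u v. smooth_on S (\<lambda>y. G y u v)"
    and bG': "\<And>y. y \<in> T \<Longrightarrow> bilinear (G' y)" and symG': "\<And>y u v. y \<in> T \<Longrightarrow> G' y u v = G' y v u"
    and sG': "\<And>u v. smooth_on T (\<lambda>y. G' y u v)"
    and surj: "\<And>y. y \<in> S \<Longrightarrow> surj (FD \<phi> y)"
    and conformal: "\<And>y a b. y \<in> S \<Longrightarrow> (\<And>u. FD \<phi> y u = 0 \<Longrightarrow> G y a u = 0) \<Longrightarrow>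
      (\<And>u. FD \<phi> y u = 0 \<Longrightarrow> G y b u = 0) \<Longrightarrow>
      G' (\<phi> y) (FD \<phi> y a) (FD \<phi> y b) = (l y)\<^sup>2 * G y a b"
begin

abbreviation D\<phi> where "D\<phi> y \<equiv> FD \<phi> y"

definition K where "K y a b = inverse (l y * l y) * G' (\<phi> y) (D\<phi> y a) (D\<phi> y b)"

definition hor where "hor y a \<longleftrightarrow> (\<forall>u. D\<phi> y u = 0 \<longrightarrow> G y a u = 0)"

definition hp where "hp y a = (SOME b. hor y b \<and> D\<phi> y (a - b) = 0)"

lemma lin\<phi>: "y \<in> S \<Longrightarrow> linear (D\<phi> y)"
  using smooth_on_linear_frechet[OF s\<phi>] .

lemma G'_bil: "y \<in> S \<Longrightarrow> bilinear (G' (\<phi> y))"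
  using bG' \<phi>T by blast

lemmas lin_simps = linear_add linear_scale linear_0 linear_neg linear_diff
lemmas bil_simps = bilinear_ladd bilinear_radd bilinear_lmul bilinear_rmul bilinear_lzero bilinear_rzero
  bilinear_lneg bilinear_rneg bilinear_lsub bilinear_rsub

lemma K_bilinear:
  assumes "y \<in> S"
  shows "bilinear (K y)"
  unfolding bilinear_def K_def
  by (intro conjI allI linearI)
    (simp_all add: lin_simps[OF lin\<phi>[OF assms]] bil_simps[OF G'_bil[OF assms]] algebra_simps)

lemma K_sym: "y \<in> S \<Longrightarrow> K y a b = K y b a"
  unfolding K_def using symG' \<phi>T by (metis image_subset_iff)

lemma K_vertical: "y \<in> S \<Longrightarrow> D\<phi> y a = 0 \<Longrightarrow> K y a b = 0" "y \<in> S \<Longrightarrow> D\<phi> y b = 0 \<Longrightarrow> K y a b = 0"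
  by (simp_all add: K_def bil_simps[OF G'_bil])

lemma hp_ex: "y \<in> S \<Longrightarrow> \<exists>b. hor y b \<and> D\<phi> y (a - b) = 0"
proof -
  assume y: "y \<in> S"
  obtain v where v: "D\<phi> y v = 0" "\<And>z. D\<phi> y z = 0 \<Longrightarrow> G y v z = G y a z"
    using orthogonal_decomposition[OF bG[OF y] pG[OF y] lin\<phi>[OF y] surj[OF y]] by blast
  then show ?thesis
    by (intro exI[of _ "a - v"]) (simp add: hor_def bil_simps[OF bG[OF y]])
qed

lemma hp: "y \<in> S \<Longrightarrow> hor y (hp y a)" "y \<in> S \<Longrightarrow> D\<phi> y (a - hp y a) = 0"
  unfolding hp_def using someI_ex[OF hp_ex, of y a] by blast+

lemma D\<phi>_hp: "y \<in> S \<Longrightarrow> D\<phi> y (hp y a) = D\<phi> y a"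
  using hp(2)[of y a] by (simp add: lin_simps[OF lin\<phi>])

lemma K_hp: "y \<in> S \<Longrightarrow> K y (hp y a) b = K y a b" "y \<in> S \<Longrightarrow> K y a (hp y b) = K y a b"
  by (simp_all add: K_def D\<phi>_hp)

text \<open>Replacing \<open>a\<close> by its horizontal part changes neither side, and between
  horizontal vectors conformality applies.\<close>

lemma K_hor:
  assumes "y \<in> S" "hor y b"
  shows "K y a b = G y a b"
proof -
  have "G' (\<phi> y) (D\<phi> y (hp y a)) (D\<phi> y b) = (l y)\<^sup>2 * G y (hp y a) b"
    using conformal[of y "hp y a" b] assms hp(1)[OF assms(1), of a] unfolding hor_def by blast
  then have "K y (hp y a) b = G y (hp y a) b"
    using l[OF assms(1)] by (simp add: K_def power2_eq_square field_simps)
  moreover have "G y b (a - hp y a) = 0"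
    using assms(2) hp(2)[OF assms(1)] unfolding hor_def by blast
  then have "G y a b = G y (hp y a) b"
    using symG[OF assms(1), of b a] symG[OF assms(1), of b "hp y a"] by (simp add: bil_simps[OF bG[OF assms(1)]])
  ultimately show ?thesis by (simp add: K_hp(1)[OF assms(1)])
qed

lemma G_hp: "y \<in> S \<Longrightarrow> G y (hp y a) b = K y a b"
  using K_hor[of y "hp y a" b] hp(1)[of y a] symG[of y b] K_sym[of y b] K_hp(1) by simp

lemma hp_hor:
  assumes y: "y \<in> S" "hor y a"
  shows "hp y a = a"
proof -
  have "hor y (a - hp y a)"
    using y(2) hp(1)[OF y(1), of a] unfolding hor_def by (simp add: bil_simps[OF bG[OF y(1)]])
  then have "G y (a - hp y a) (a - hp y a) = 0" using hp(2)[OF y(1)] unfolding hor_def by blast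
  then show ?thesis using pG[OF y(1), of "a - hp y a"] by fastforce
qed

lemma G'\<phi>_smooth: "smooth_on S (\<lambda>y. G' (\<phi> y) i j)"
  by (rule smooth_on_compose[OF S T \<phi>T sG' s\<phi>])

lemma K_smooth: "smooth_on S (\<lambda>y. K y a b)"
proof -
  have expand: "G' (\<phi> y) u v = (\<Sum>i\<in>Basis. (u \<bullet> i) * (\<Sum>j\<in>Basis. (v \<bullet> j) * G' (\<phi> y) i j))" if "y \<in> S" for y u v
  proof -
    have l: "linear (\<lambda>i. G' (\<phi> y) i v)" "linear (G' (\<phi> y) u)" for u v
      using G'_bil[OF that] by (simp_all add: bilinear_def)
    show ?thesis
      by (subst linear_expand[OF l(1)], unfold real_scaleR_def, intro sum.cong refl arg_cong[of _ _ "(*) _"])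
        (subst linear_expand[OF l(2)], simp)
  qed
  have "K y a b = inverse (l y * l y) *
      (\<Sum>i\<in>Basis. (D\<phi> y a \<bullet> i) * (\<Sum>j\<in>Basis. (D\<phi> y b \<bullet> j) * G' (\<phi> y) i j))" if "y \<in> S" for y
    unfolding K_def by (rule arg_cong[of _ _ "(*) _"]) (rule expand[OF that])
  moreover have "smooth_on S (\<lambda>y. inverse (l y * l y) *
      (\<Sum>i\<in>Basis. (D\<phi> y a \<bullet> i) * (\<Sum>j\<in>Basis. (D\<phi> y b \<bullet> j) * G' (\<phi> y) i j)))"
  proof (intro smooth_on_mult smooth_on_sum smooth_on_inner smooth_on_const S G'\<phi>_smooth
      smooth_on_frechet_derivative[OF s\<phi>] finite_Basis)
    show "smooth_on S (\<lambda>y. inverse (l y * l y))"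
    proof (rule smooth_on_compose[OF S _ _ smooth_on_inverse])
      show "smooth_on S (\<lambda>y. l y * l y)" by (intro smooth_on_mult S sl)
      show "(\<lambda>y. l y * l y) ` S \<subseteq> - {0}" using l by fastforce
    qed (simp add: open_Compl)
  qed
  ultimately show ?thesis by (rule iffD2[OF smooth_on_cong[OF S]])
qed

text \<open>\<open>hp\<close> is defined by a choice, but \<open>G_hp\<close> exhibits it as the
  solution of a linear system with smooth matrix \<open>G\<close> and smooth right side
  \<open>K\<close>.\<close>

lemma hp_smooth: "smooth_on S (\<lambda>y. hp y a)"
  by (rule smooth_on_solve[OF S bG pG sG, of "\<lambda>y. K y a"]) (simp_all add: K_smooth G_hp)

section \<open>The covariant derivative of K at a point, by the type of its arguments\<close>

context
  fixes x \<Gamma>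
  assumes x: "x \<in> S" and b\<Gamma>: "bilinear \<Gamma>" and sym\<Gamma>: "\<And>u v. \<Gamma> u v = \<Gamma> v u"
    and compat: "\<And>w u v. FD (\<lambda>y. G y u v) x w = G x (\<Gamma> w u) v + G x u (\<Gamma> w v)"
begin

definition D2 where "D2 w u = FD (\<lambda>y. D\<phi> y u) x w"

definition DK where "DK w a b = FD (\<lambda>y. K y a b) x w"

text \<open>The covariant derivative of \<open>K\<close>.\<close>

definition NK where "NK w a b = DK w a b - K x (\<Gamma> w a) b - K x a (\<Gamma> w b)"

lemma D\<phi>_has_derivative: "((\<lambda>y. D\<phi> y u) has_derivative (\<lambda>w. D2 w u)) (at x)"
  unfolding D2_def by (rule smooth_on_has_derivative[OF smooth_on_frechet_derivative[OF s\<phi>] x])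

lemma D2_sym: "D2 w u = D2 u w"
  unfolding D2_def by (rule second_derivative_symmetric[OF S x s\<phi>])

lemma DK_linear: "linear (\<lambda>w. DK w a b)" "linear (\<lambda>a. DK w a b)" "linear (\<lambda>b. DK w a b)"
proof -
  have d: "(\<lambda>y. K y a b) differentiable (at x)" for a b by (rule smooth_on_differentiable[OF K_smooth x])
  show "linear (\<lambda>w. DK w a b)"
    unfolding DK_def by (rule linear_frechet_derivative[OF d])
  show "linear (\<lambda>a. DK w a b)" unfolding DK_def
    by (rule linear_frechet_field[OF S x, of "\<lambda>y a. K y a b"]) (use K_bilinear d in \<open>auto simp: bilinear_def\<close>)
  show "linear (\<lambda>b. DK w a b)" unfolding DK_def
    by (rule linear_frechet_field[OF S x, of "\<lambda>y b. K y a b"]) (use K_bilinear d in \<open>auto simp: bilinear_def\<close>)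
qed

lemma DK_sym: "DK w a b = DK w b a"
proof -
  have "(\<lambda>y. K y a b) differentiable (at x)" by (rule smooth_on_differentiable[OF K_smooth x])
  then have "FD (\<lambda>y. K y a b) x = FD (\<lambda>y. K y b a) x"
    by (rule frechet_derivative_transform_within_open[OF _ S x]) (rule K_sym)
  then show ?thesis by (simp add: DK_def)
qed

lemma DK_eq:
  "DK w a b = inverse (l x * l x) * (FD (\<lambda>y. G' y (D\<phi> x a) (D\<phi> x b)) (\<phi> x) (D\<phi> x w)
      + G' (\<phi> x) (D2 w a) (D\<phi> x b) + G' (\<phi> x) (D\<phi> x a) (D2 w b))
    - 2 * (FD l x w / l x) * K x a b"
proof -
  let ?q = "\<lambda>w. FD (\<lambda>y. G' y (D\<phi> x a) (D\<phi> x b)) (\<phi> x) (D\<phi> x w)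
      + G' (\<phi> x) (D2 w a) (D\<phi> x b) + G' (\<phi> x) (D\<phi> x a) (D2 w b)"
  have xT: "\<phi> x \<in> T" using \<phi>T x by blast
  have q: "((\<lambda>y. G' (\<phi> y) (D\<phi> y a) (D\<phi> y b)) has_derivative ?q) (at x)"
    by (rule has_derivative_bilinear_field[OF T xT bG' smooth_on_differentiable[OF sG' xT]
          smooth_on_has_derivative[OF s\<phi> x] D\<phi>_has_derivative D\<phi>_has_derivative])
  have dl: "(l has_derivative FD l x) (at x)" by (rule smooth_on_has_derivative[OF sl x])
  have n: "l x * l x \<noteq> 0" using l[OF x] by simp
  have "((\<lambda>y. K y a b) has_derivative (\<lambda>w. inverse (l x * l x) * ?q w +
     (- (inverse (l x * l x) * (l x * FD l x w + FD l x w * l x) * inverse (l x * l x))) *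
     G' (\<phi> x) (D\<phi> x a) (D\<phi> x b))) (at x)"
    unfolding K_def
    by (intro has_derivative_mult q Deriv.has_derivative_inverse dl n)
  then have f: "DK w a b = inverse (l x * l x) * ?q w +
     (- (inverse (l x * l x) * (l x * FD l x w + FD l x w * l x) * inverse (l x * l x))) *
     G' (\<phi> x) (D\<phi> x a) (D\<phi> x b)"
    by (simp add: DK_def frechet_derivative_at[symmetric])
  have e: "inverse (l x * l x) * (l x * d + d * l x) * inverse (l x * l x) = 2 * (d / l x) * inverse (l x * l x)" for d
    using l[OF x] by (simp add: field_simps)
  show ?thesis unfolding f e K_def by (simp only: diff_conv_add_uminus mult_minus_left mult.assoc)
qed

text \<open>As \<open>D\<phi> x u = 0\<close>, only those terms of the product rule survive in which
  the factor \<open>D\<phi> y u\<close> itself is differentiated.\<close>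

lemma DK_vertical:
  assumes u: "D\<phi> x u = 0"
  shows "DK w u b = inverse (l x * l x) * G' (\<phi> x) (D2 w u) (D\<phi> x b)"
proof -
  have "FD (\<lambda>y. G' y 0 (D\<phi> x b)) (\<phi> x) = (\<lambda>w. 0)"
  proof -
    have "((\<lambda>y. G' y 0 (D\<phi> x b)) has_derivative (\<lambda>w. 0)) (at (\<phi> x))"
      by (rule has_derivative_transform_within_open[OF has_derivative_const T])
        (use \<phi>T x in \<open>auto simp: bil_simps[OF bG']\<close>)
    then show ?thesis by (simp add: frechet_derivative_at[symmetric])
  qed
  then show ?thesis
    using u by (simp add: DK_eq K_vertical[OF x] bil_simps[OF G'_bil[OF x]])
qed

text \<open>A vertical direction has image 0, so the derivative of \<open>G'\<close> drops out and
  only the second derivative of \<open>\<phi>\<close> and the derivative of the dilation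
  remain.\<close>

lemma DK_along_vertical:
  assumes u: "D\<phi> x u = 0"
  shows "DK u a a = 2 * inverse (l x * l x) * G' (\<phi> x) (D2 u a) (D\<phi> x a) -
    2 * (FD l x u / l x) * K x a a"
proof -
  have xT: "\<phi> x \<in> T" using \<phi>T x by blast
  have "linear (FD (\<lambda>y. G' y (D\<phi> x a) (D\<phi> x a)) (\<phi> x))"
    by (rule smooth_on_linear_frechet[OF sG' xT])
  then show ?thesis
    unfolding DK_eq using u symG'[OF xT, of "D\<phi> x a"] by (simp add: linear_0 algebra_simps)
qed

lemma NK_sym: "NK w a b = NK w b a"
  by (simp add: NK_def DK_sym[of w a] K_sym[OF x, of a] K_sym[OF x, of b])

lemma NK_linear: "NK (w + w') a b = NK w a b + NK w' a b" "NK w (a + a') b = NK w a b + NK w a' b"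
  "NK w a (b + b') = NK w a b + NK w a b'"
  by (simp_all add: NK_def DK_linear[THEN linear_add] bil_simps[OF b\<Gamma>] bil_simps[OF K_bilinear[OF x]])

lemma NK_minus: "NK (- w) (- a) b = NK w a b"
  by (simp add: NK_def DK_linear[THEN linear_neg] bil_simps[OF b\<Gamma>] bil_simps[OF K_bilinear[OF x]])

lemma NK_vertical: "D\<phi> x u = 0 \<Longrightarrow> D\<phi> x v = 0 \<Longrightarrow> NK w u v = 0"
  by (simp add: NK_def DK_vertical K_vertical[OF x] bil_simps[OF G'_bil[OF x]])

text \<open>Differentiate \<open>K(X, b) = G(X, b)\<close> for the horizontal field \<open>X\<close> that extends \<open>a\<close>.\<close>

lemma NK_horizontal:
  assumes a: "hor x a" and b: "hor x b"
  shows "NK w a b = 0"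
proof -
  let ?h = "FD (\<lambda>y. hp y a) x"
  have dh: "((\<lambda>y. hp y a) has_derivative ?h) (at x)"
    by (rule smooth_on_has_derivative[OF hp_smooth x])
  have id: "((\<lambda>y. y) has_derivative (\<lambda>w. w)) (at x)" and c: "((\<lambda>y. b) has_derivative (\<lambda>w. 0)) (at x)" by simp_all
  note G1 = has_derivative_bilinear_field[OF S x bG smooth_on_differentiable[OF sG x] id dh c]
  note K1 = has_derivative_bilinear_field[OF S x K_bilinear smooth_on_differentiable[OF K_smooth x] id dh c]
  have "((\<lambda>y. K y (hp y a) b) has_derivative (\<lambda>h. FD (\<lambda>y. G y (hp x a) b) x h + G x (?h h) b + G x (hp x a) 0)) (at x)"
  proof (rule has_derivative_transform_within_open[OF G1 S x])
    show "G y (hp y a) b = K y (hp y a) b" if "y \<in> S" for y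
      by (simp only: G_hp[OF that] K_hp(1)[OF that])
  qed
  from has_derivative_unique[OF K1 this]
  have "DK w a b + K x (?h w) b + K x a 0 = FD (\<lambda>y. G y a b) x w + G x (?h w) b + G x a 0"
    unfolding DK_def hp_hor[OF x a] by meson
  then have "DK w a b = G x (\<Gamma> w a) b + G x a (\<Gamma> w b)"
    by (simp add: K_hor[OF x b] compat bil_simps[OF K_bilinear[OF x]] bil_simps[OF bG[OF x]])
  then show ?thesis
    by (simp add: NK_def K_hor[OF x b] K_sym[OF x, of a] K_hor[OF x a] symG[OF x, of a])
qed

text \<open>The symmetry of the second derivative of \<open>\<phi>\<close> relates the derivative of
  K(u, a) along \<open>a\<close> to that of K(a, a) along \<open>u\<close>, and only the latter
  involves the dilation. The Christoffel terms cancel because \<open>NK u a a\<close>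
  vanishes.\<close>

lemma NK_mixed:
  assumes a: "hor x a" and u: "D\<phi> x u = 0"
  shows "NK a a u = FD l x u / l x * G x a a"
proof -
  have "2 * DK a u a = DK u a a + 2 * (FD l x u / l x) * G x a a"
    by (simp add: DK_vertical[OF u] DK_along_vertical[OF u] D2_sym[of a u] K_hor[OF x a])
  moreover have "NK a u a = DK a u a - K x (\<Gamma> u a) a"
    unfolding NK_def sym\<Gamma>[of a u] by (simp add: K_vertical(1)[OF x u])
  moreover have "NK a a u = NK a u a" by (rule NK_sym)
  moreover have "DK u a a = 2 * K x (\<Gamma> u a) a"
    using NK_horizontal[OF a a, of u] by (simp add: NK_def K_sym[OF x, of a])
  ultimately show ?thesis by simp
qed

lemma NK_second_fundamental:
  assumes "D\<phi> x u = 0" "D\<phi> x v = 0"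
  shows "NK u v a = inverse (l x * l x) * G' (\<phi> x) (D2 u v) (D\<phi> x a) - K x (\<Gamma> u v) a"
  using assms by (simp add: NK_def DK_vertical K_vertical[OF x])

text \<open>Differentiating \<open>D\<phi> y (V y) = 0\<close> along \<open>u\<close> trades the
  second derivative of \<open>\<phi>\<close> for \<open>V' u\<close>. Together with the Christoffel
  term this is the covariant derivative of \<open>V\<close>, so \<open>NK\<close> here is minus the
  second fundamental form of the fiber.\<close>

lemma NK_vertical_field:
  assumes V: "(V has_derivative V') (at x)" "open N" "x \<in> N" "\<And>y. y \<in> N \<Longrightarrow> D\<phi> y (V y) = 0"
    and u: "D\<phi> x u = 0" and a: "hor x a"
  shows "NK u (V x) a = - G x (V' u + \<Gamma> u (V x)) a"
proof -
  have lD2: "linear (D2 w)" for w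
    unfolding D2_def
    by (rule linear_frechet_field[OF S x]) (auto intro: lin\<phi> smooth_on_differentiable[OF smooth_on_frechet_derivative[OF s\<phi>] x])
  have 1: "((\<lambda>y. D\<phi> y (V y)) has_derivative (\<lambda>w. D2 w (V x) + D\<phi> x (V' w))) (at x)"
    by (rule has_derivative_linear_field[OF D\<phi>_has_derivative _ S x lin\<phi> V(1)]) (simp add: lD2)
  have 2: "((\<lambda>y. D\<phi> y (V y)) has_derivative (\<lambda>w. 0)) (at x)"
    by (rule has_derivative_transform_within_open[OF has_derivative_const V(2,3)]) (simp add: V(4))
  have "D2 u (V x) + D\<phi> x (V' u) = 0" by (rule fun_cong[OF has_derivative_unique[OF 1 2]])
  then have "D2 u (V x) = - D\<phi> x (V' u)" by (simp add: add_eq_0_iff2)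
  then show ?thesis
    using V(4)[OF V(3)] u
    by (simp add: NK_second_fundamental K_hor[OF x a, symmetric] bil_simps[OF K_bilinear[OF x]])
      (simp add: K_def bil_simps[OF G'_bil[OF x]])
qed

text \<open>\<open>Df\<close> is any linear form, in the role of df; what remains is linear algebra
  at the one point \<open>x\<close>.\<close>

lemma clairaut_pointwise:
  assumes Df: "linear Df"
  shows "(\<forall>v. 2 * Df v * (G x v v - K x v v) = NK v v v) \<longleftrightarrow>
    (\<forall>u. D\<phi> x u = 0 \<longrightarrow> Df u = 0 \<and> FD l x u = 0) \<and>
    (\<forall>u a. D\<phi> x u = 0 \<longrightarrow> hor x a \<longrightarrow> NK u u a = Df a * G x u u)"
    (is "?C \<longleftrightarrow> ?R1 \<and> ?R2")
proof -
  note bG = bG[OF x] and bK = K_bilinear[OF x]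
  let ?dl = "FD l x"
  have ldl: "linear ?dl" by (rule smooth_on_linear_frechet[OF sl x])
  have P: "2 * Df (u + a) * (G x (u + a) (u + a) - K x (u + a) (u + a)) = 2 * (Df u + Df a) * G x u u"
    "NK (u + a) (u + a) (u + a) = 2 * NK u u a + 2 * (?dl u / l x * G x a a)"
    if u: "D\<phi> x u = 0" and a: "hor x a" for u a
  proof -
    have "G x a u = 0" using u a unfolding hor_def by blast
    then have "G x (u + a) (u + a) - K x (u + a) (u + a) = G x u u"
      using symG[OF x, of u a] by (simp add: bil_simps[OF bG] bil_simps[OF bK] K_vertical[OF x u] K_hor[OF x a])
    then show "2 * Df (u + a) * (G x (u + a) (u + a) - K x (u + a) (u + a)) = 2 * (Df u + Df a) * G x u u"
      by (simp add: linear_add[OF Df])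
    show "NK (u + a) (u + a) (u + a) = 2 * NK u u a + 2 * (?dl u / l x * G x a a)"
      \<comment> \<open>Of the eight terms, those with two vertical or two horizontal vectors in the
        last two slots vanish; the other four pair up by the symmetry of \<open>NK\<close> in these
        slots.\<close>
      using NK_mixed[OF a u] NK_vertical[OF u u] NK_horizontal[OF a a] NK_sym[of u a u] NK_sym[of a u a]
      by (simp add: NK_linear)
  qed
  show ?thesis
  proof
    assume C: ?C
    have E: "2 * (Df u + Df a) * G x u u = 2 * NK u u a + 2 * (?dl u / l x * G x a a)"
      if "D\<phi> x u = 0" "hor x a" for u a
      using C P[OF that] by metis
    have hor0: "hor x 0" by (simp add: hor_def bil_simps[OF bG])
    \<comment> \<open>The choice a = 0 in \<open>E\<close> leaves
      \<open>2 * Df u * G x u u = 0\<close>.\<close>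
    have f0: "Df u = 0" if u: "D\<phi> x u = 0" for u
    proof (cases "u = 0")
      case False
      have "NK u u 0 = 0" using NK_linear(3)[of u u 0 0] by simp
      then show ?thesis
        using E[OF u hor0] pG[OF x False] by (simp add: linear_0[OF Df] bil_simps[OF bG])
    qed (simp add: linear_0[OF Df])
    have F: "Df a * G x u u = NK u u a + ?dl u / l x * G x a a" if "D\<phi> x u = 0" "hor x a" for u a
      using E[OF that] f0[OF that(1)] by simp
    have z: "?dl u / l x * G x a a = 0" if u: "D\<phi> x u = 0" and a: "hor x a" for u a
    proof -
      \<comment> \<open>In \<open>F\<close> the passage from u to -u changes the sign of the
        dilation term only.\<close>
      have "D\<phi> x (- u) = 0" using u by (simp add: lin_simps[OF lin\<phi>[OF x]])
      from F[OF this a] F[OF u a] show ?thesis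
        by (simp add: NK_minus bil_simps[OF bG] linear_neg[OF ldl])
    qed
    \<comment> \<open>To conclude from \<open>z\<close>, some horizontal vector must be nonzero:
      take the horizontal part of a preimage of a basis vector, which exists because the target has
      positive dimension.\<close>
    obtain e where e: "D\<phi> x e = (SOME i. i \<in> Basis)" using surj[OF x] by (metis surjD)
    have "D\<phi> x (hp x e) \<noteq> 0" using e D\<phi>_hp[OF x, of e] by (simp add: nonzero_Basis some_in_eq)
    then have "hp x e \<noteq> 0" using linear_0[OF lin\<phi>[OF x]] by metis
    then have "?dl u = 0" if "D\<phi> x u = 0" for u
      using z[OF that hp(1)[OF x, of e]] pG[OF x, of "hp x e"] l[OF x] by simp
    with f0 z F show "?R1 \<and> ?R2" by simp
  next
    assume R: "?R1 \<and> ?R2"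
    show ?C
    proof
      fix v
      have u: "D\<phi> x (v - hp x v) = 0" and a: "hor x (hp x v)" by (simp_all add: hp[OF x])
      have "2 * Df ((v - hp x v) + hp x v) * (G x ((v - hp x v) + hp x v) ((v - hp x v) + hp x v) -
          K x ((v - hp x v) + hp x v) ((v - hp x v) + hp x v)) =
          NK ((v - hp x v) + hp x v) ((v - hp x v) + hp x v) ((v - hp x v) + hp x v)"
        unfolding P[OF u a] using R u a by simp
      then show "2 * Df v * (G x v v - K x v v) = NK v v v" by simp
    qed
  qed
qed

text \<open>On vertical vectors \<open>NK u v a\<close> is symmetric in \<open>u\<close> and
  \<open>v\<close>, since the second derivative of \<open>\<phi>\<close> and \<open>\<Gamma>\<close>
  are; so its diagonal determines it.\<close>

lemma second_fundamental_polarization: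
  assumes R: "\<And>u. D\<phi> x u = 0 \<Longrightarrow> NK u u a = c * G x u u" and u: "D\<phi> x u = 0" and v: "D\<phi> x v = 0"
  shows "NK u v a = c * G x u v"
proof -
  have s: "NK v u a = NK u v a"
    by (simp add: NK_second_fundamental u v D2_sym[of v u] sym\<Gamma>[of v u])
  have "D\<phi> x (u + v) = 0" using u v by (simp add: lin_simps[OF lin\<phi>[OF x]])
  from R[OF this] R[OF u] R[OF v] s show ?thesis
    using symG[OF x, of v u] by (simp add: NK_linear bil_simps[OF bG[OF x]] algebra_simps)
qed

end

end

subsection \<open>Functions that are constant along fibers\<close>

text \<open>With a right inverse \<open>R\<close> of \<open>\<phi>'(x\<^sub>0)\<close>, the map \<open>\<Psi> = id - R \<circ> \<phi>'(x\<^sub>0) + R \<circ> \<phi>\<close> is a local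
  diffeomorphism at \<open>x\<^sub>0\<close> with \<open>\<phi> = \<phi>'(x\<^sub>0) \<circ> \<Psi>\<close>: it straightens the fibers of \<open>\<phi>\<close>.\<close>

lemma submersion_locally_constant_on_fiber:
  fixes \<phi> :: "'a::euclidean_space \<Rightarrow> 'b::euclidean_space" and l :: "'a \<Rightarrow> real"
  assumes S: "open S" "x0 \<in> S" and \<phi>: "smooth_on S \<phi>" and sur: "surj (FD \<phi> x0)"
    and l: "smooth_on S l"
    and dl: "\<And>x u. x \<in> S \<Longrightarrow> FD \<phi> x u = 0 \<Longrightarrow> FD l x u = 0"
  obtains N where "open N" "x0 \<in> N" "N \<subseteq> S" "\<And>x. x \<in> N \<Longrightarrow> \<phi> x = \<phi> x0 \<Longrightarrow> l x = l x0"
proof -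
  let ?D = "\<lambda>x. FD \<phi> x" and ?L = "FD \<phi> x0"
  have lin: "linear (?D x)" if "x \<in> S" for x by (rule smooth_on_linear_frechet[OF \<phi> that])
  obtain R where R: "linear R" "?L \<circ> R = id" using linear_surjective_right_inverse[OF lin[OF S(2)] sur] by blast
  have LR: "?L (R y) = y" for y using R(2) by (metis comp_apply id_apply)
  define \<Psi> where "\<Psi> = (\<lambda>x. x - R (?L x) + R (\<phi> x))"
  have L\<Psi>: "?L (\<Psi> x) = \<phi> x" for x
    by (simp add: \<Psi>_def linear_add[OF lin[OF S(2)]] linear_diff[OF lin[OF S(2)]] LR)
  define \<Psi>' where "\<Psi>' = (\<lambda>x. Blinfun (\<lambda>h. h - R (?L h) + R (?D x h)))"
  have bR: "bounded_linear R" and bL: "bounded_linear ?L" using R(1) lin[OF S(2)] linear_conv_bounded_linear by blast+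
  have ap: "blinfun_apply (\<Psi>' x) = (\<lambda>h. h - R (?L h) + R (?D x h))" if x: "x \<in> S" for x
  proof -
    have "bounded_linear (?D x)" using lin[OF x] linear_conv_bounded_linear by blast
    then have "bounded_linear (\<lambda>h. h - R (?L h) + R (?D x h))"
      by (intro bounded_linear_add bounded_linear_sub bounded_linear_ident bounded_linear_compose[OF bR] bL)
    then show ?thesis unfolding \<Psi>'_def by (rule bounded_linear_Blinfun_apply)
  qed
  have d\<Psi>: "(\<Psi> has_derivative blinfun_apply (\<Psi>' x)) (at x)" if x: "x \<in> S" for x
    unfolding ap[OF x] \<Psi>_def
    by (intro has_derivative_add has_derivative_diff has_derivative_ident
        bounded_linear.has_derivative[OF bR] smooth_on_has_derivative[OF \<phi> x]
        bounded_linear_imp_has_derivative bL)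
  have c\<Psi>': "continuous_on S \<Psi>'"
  proof (rule continuous_on_blinfun_componentwise)
    fix i :: 'a
    have "continuous_on S (\<lambda>x. i - R (?L i) + R (?D x i))"
      by (intro continuous_intros linear_continuous_on_compose[OF _ R(1)]
          smooth_on_imp_continuous_on[OF smooth_on_frechet_derivative[OF \<phi>]])
    then show "continuous_on S (\<lambda>x. blinfun_apply (\<Psi>' x) i)"
      by (rule continuous_on_eq) (simp add: ap)
  qed
  \<comment> \<open>At \<open>x0\<close> the derivative of \<open>\<phi>\<close> is
    \<open>?L\<close>, so the two correction terms cancel and the inverse function theorem applies
    with the identity as inverse.\<close>
  have id0: "blinfun_apply (\<Psi>' x0) h = h" for h by (simp add: ap[OF S(2)])
  have "id_blinfun o\<^sub>L \<Psi>' x0 = id_blinfun" by (rule blinfun_eqI) (simp add: id0)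
  from inverse_function_theorem[OF S(1) d\<Psi> c\<Psi>' S(2) this]
  obtain U V \<theta> \<theta>' where U: "open U" "U \<subseteq> S" "x0 \<in> U" and V: "open V" "\<Psi> x0 \<in> V"
    and h: "homeomorphism U V \<Psi> \<theta>" and d\<theta>: "\<And>y. y \<in> V \<Longrightarrow> (\<theta> has_derivative \<theta>' y) (at y)" by metis
  have \<theta>: "\<theta> y \<in> S" "\<Psi> (\<theta> y) = y" if "y \<in> V" for y
    using h U that unfolding homeomorphism_def by auto
  obtain e where e: "e > 0" "ball (\<Psi> x0) e \<subseteq> V" using V open_contains_ball by blast
  have cPsi: "continuous_on U \<Psi>" using h unfolding homeomorphism_def by blast
  define N where "N = U \<inter> \<Psi> -` ball (\<Psi> x0) e"
  have "open N" unfolding N_def using cPsi U(1) continuous_on_open_vimage[of U \<Psi>]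
    by (simp add: Int_commute)
  moreover have "x0 \<in> N" "N \<subseteq> S" using e U by (auto simp: N_def)
  moreover have "l x = l x0" if x: "x \<in> N" "\<phi> x = \<phi> x0" for x
  proof -
    \<comment> \<open>The segment from \<open>\<Psi> x0\<close> to \<open>\<Psi> x\<close> stays in
      the ball and in a level set of \<open>?L\<close>, so \<open>\<theta>\<close> maps it to a path
      in the fiber.\<close>
    let ?w = "\<Psi> x - \<Psi> x0"
    let ?z = "\<lambda>t. \<Psi> x0 + t *\<^sub>R ?w"
    have Lw: "?L ?w = 0" using x(2) by (simp add: linear_diff[OF lin[OF S(2)]] L\<Psi>)
    have zV: "?z t \<in> V" if "t \<in> {0..1}" for t
    proof -
      have "norm (t *\<^sub>R ?w) \<le> norm ?w" using that by (simp add: mult_left_le_one_le)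
      also have "\<dots> < e" using x(1) by (simp add: N_def dist_norm norm_minus_commute)
      finally show ?thesis using e(2) by (auto simp: dist_norm)
    qed
    have "((\<lambda>t. l (\<theta> (?z t))) has_derivative (\<lambda>h. 0)) (at t within {0..1})" if t: "t \<in> {0..1}" for t
    proof -
      have dz: "(?z has_derivative (\<lambda>h. h *\<^sub>R ?w)) (at t)" by (auto intro!: derivative_eq_intros)
      note d1 = has_derivative_compose[OF d\<theta>[OF zV[OF t]] smooth_on_has_derivative[OF \<phi> \<theta>(1)[OF zV[OF t]]]]
      \<comment> \<open>Differentiating \<open>\<phi> (\<theta> y) = ?L y\<close> shows that the
        derivative of \<open>\<theta>\<close> maps the kernel of \<open>?L\<close> to vertical
        vectors, on which the derivative of \<open>l\<close> vanishes.\<close>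
      have "(?L has_derivative (\<lambda>h. ?D (\<theta> (?z t)) (\<theta>' (?z t) h))) (at (?z t))"
        by (rule has_derivative_transform_within_open[OF d1 V(1) zV[OF t]]) (metis L\<Psi> \<theta>(2))
      moreover have "(?L has_derivative ?L) (at (?z t))"
        by (rule bounded_linear_imp_has_derivative[OF bL])
      ultimately have eq: "(\<lambda>h. ?D (\<theta> (?z t)) (\<theta>' (?z t) h)) = ?L" by (rule has_derivative_unique)
      have "FD l (\<theta> (?z t)) (\<theta>' (?z t) ?w) = 0"
        by (rule dl[OF \<theta>(1)[OF zV[OF t]]]) (use fun_cong[OF eq, of ?w] Lw in simp)
      moreover have lt: "linear (\<theta>' (?z t))" using d\<theta>[OF zV[OF t]] has_derivative_linear by blast
      moreover have ll: "linear (FD l (\<theta> (?z t)))"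
        by (rule smooth_on_linear_frechet[OF l \<theta>(1)[OF zV[OF t]]])
      ultimately have 0: "(\<lambda>h. FD l (\<theta> (?z t)) (\<theta>' (?z t) (h *\<^sub>R ?w))) = (\<lambda>h. 0)"
        by (simp add: linear_scale)
      have "((\<lambda>t. l (\<theta> (?z t))) has_derivative (\<lambda>h. FD l (\<theta> (?z t)) (\<theta>' (?z t) (h *\<^sub>R ?w)))) (at t)"
        by (rule has_derivative_compose[OF dz has_derivative_compose[OF d\<theta>[OF zV[OF t]]
              smooth_on_has_derivative[OF l \<theta>(1)[OF zV[OF t]]]]])
      then show ?thesis unfolding 0 by (rule has_derivative_at_withinI)
    qed
    then obtain k where k: "\<And>t. t \<in> {0..1} \<Longrightarrow> l (\<theta> (?z t)) = k"
      using has_derivative_zero_constant[of "{0..1::real}" "\<lambda>t. l (\<theta> (?z t))"] by auto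
    have "\<theta> (\<Psi> y) = y" if "y \<in> U" for y using h that unfolding homeomorphism_def by blast
    then have "\<theta> (\<Psi> x) = x" "\<theta> (\<Psi> x0) = x0" using x(1) U(3) by (auto simp: N_def)
    then show ?thesis using k[of 0] k[of 1] by simp
  qed
  ultimately show ?thesis using that by blast
qed

context conformal_coords
begin

text \<open>The integral curve through \<open>x\<close> of the vertical field
  \<open>u - hp y u\<close>, whose value at \<open>x\<close> is \<open>u\<close>, stays in the
  fiber, so the dilation is constant along it.\<close>

lemma dilation_derivative_vertical:
  assumes x: "x \<in> S" and u: "D\<phi> x u = 0"
    and l: "\<And>y. y \<in> S \<Longrightarrow> \<phi> y = \<phi> x \<Longrightarrow> l y = l x"
  shows "FD l x u = 0"
proof -
  define V where "V = (\<lambda>y. u - hp y u)"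
  have sV: "smooth_on S V" unfolding V_def by (intro smooth_on_diff smooth_on_const S hp_smooth)
  have "D\<phi> x (hp x u) = 0" using D\<phi>_hp[OF x] u by simp
  then have "G x (hp x u) (hp x u) = 0" using hp(1)[OF x] unfolding hor_def by blast
  then have Vx: "V x = u" using pG[OF x, of "hp x u"] unfolding V_def by fastforce
  obtain \<epsilon> z where \<epsilon>: "\<epsilon> > 0" and z: "z 0 = x" "\<And>t. \<bar>t\<bar> < \<epsilon> \<Longrightarrow> z t \<in> S"
    "\<And>t. \<bar>t\<bar> < \<epsilon> \<Longrightarrow> (z has_vector_derivative V (z t)) (at t)"
    using ode_local_existence[OF S x sV[unfolded smooth_on_def, THEN spec]] by blast
  let ?J = "{-\<epsilon><..<\<epsilon>}"
  have J: "t \<in> ?J \<Longrightarrow> \<bar>t\<bar> < \<epsilon>" for t by auto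
  have "((\<lambda>t. \<phi> (z t)) has_derivative (\<lambda>h. 0)) (at t within ?J)" if t: "t \<in> ?J" for t
  proof -
    note zS = z(2)[OF J[OF t]]
    have "((\<lambda>t. \<phi> (z t)) has_derivative (\<lambda>h. D\<phi> (z t) (h *\<^sub>R V (z t)))) (at t)"
      by (rule has_derivative_compose[OF z(3)[OF J[OF t], unfolded has_vector_derivative_def]
            smooth_on_has_derivative[OF s\<phi> zS]])
    moreover have "D\<phi> (z t) (h *\<^sub>R V (z t)) = 0" for h
      using hp(2)[OF zS, of u] by (simp add: V_def linear_scale[OF lin\<phi>[OF zS]])
    ultimately show ?thesis by (simp add: has_derivative_at_withinI)
  qed
  then obtain k where k: "\<And>t. t \<in> ?J \<Longrightarrow> \<phi> (z t) = k"
    using has_derivative_zero_constant[of ?J "\<lambda>t. \<phi> (z t)"] by auto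
  have 0: "0 \<in> ?J" using \<epsilon> by simp
  have lc: "l (z t) = l x" if "t \<in> ?J" for t
    using l[OF z(2)[OF J[OF that]]] k[OF that] k[OF 0] z(1) by simp
  have "((\<lambda>t. l (z t)) has_derivative (\<lambda>h. FD l x (h *\<^sub>R V x))) (at 0)"
    by (rule has_derivative_compose[OF z(3)[OF J[OF 0], unfolded has_vector_derivative_def z(1)]])
      (simp add: z(1) smooth_on_has_derivative[OF sl x])
  moreover have "((\<lambda>t. l (z t)) has_derivative (\<lambda>h. 0)) (at 0)"
    by (rule has_derivative_transform_within_open[OF has_derivative_const _ 0]) (auto simp: lc)
  ultimately have "(\<lambda>h. FD l x (h *\<^sub>R V x)) = (\<lambda>h. 0)" by (rule has_derivative_unique)
  from fun_cong[OF this, of 1] show ?thesis by (simp add: Vx)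
qed

lemma G_eq_on_hor:
  assumes "x \<in> S" "hor x a" "hor x b" "\<And>c. hor x c \<Longrightarrow> G x a c = G x b c"
  shows "a = b"
proof -
  have "hor x (a - b)" using assms(2,3) unfolding hor_def by (simp add: bil_simps[OF bG[OF assms(1)]])
  from assms(4)[OF this] have "G x (a - b) (a - b) = 0" by (simp add: bil_simps[OF bG[OF assms(1)]])
  then show ?thesis using pG[OF assms(1), of "a - b"] by fastforce
qed

lemma hor_scaleR: "x \<in> S \<Longrightarrow> hor x a \<Longrightarrow> hor x (r *\<^sub>R a)"
  unfolding hor_def by (simp add: bil_simps[OF bG])

text \<open>K(a, a) and G(a, a) - K(a, a) are the squared lengths of the horizontal and the vertical
  part. The bounds keep the arguments of later square roots and of \<open>arccos\<close> in
  range.\<close>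

lemma G_K_nonneg:
  assumes "x \<in> S"
  shows "K x a a \<ge> 0" "K x a a \<le> G x a a"
proof -
  note b = bil_simps[OF bG[OF assms]]
  have nn: "G x z z \<ge> 0" for z using pG[OF assms, of z] by (cases "z = 0") (auto simp: b)
  have 1: "G x (hp x a) (hp x a) = K x a a" by (simp add: G_hp[OF assms] K_hp[OF assms])
  have "G x (a - hp x a) (a - hp x a) = G x a a - K x a a"
    by (simp add: b 1 symG[OF assms, of a "hp x a"] G_hp[OF assms] K_hp[OF assms])
  then show "K x a a \<ge> 0" "K x a a \<le> G x a a" using nn[of "hp x a"] nn[of "a - hp x a"] 1 by simp_all
qed

end

subsection \<open>Conformal submersions of manifolds\<close>

locale conformal_submersion_of_manifolds =
  fixes A :: "('m::{t2_space, second_countable_topology}, 'a::euclidean_space) chart set"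
    and g :: "('m, 'a) metric"
    and B :: "('n::{t2_space, second_countable_topology}, 'b::euclidean_space) chart set"
    and g' :: "('n, 'b) metric" and F :: "'m \<Rightarrow> 'n" and lam :: "'m \<Rightarrow> real"
  assumes M: "riemannian_manifold A g" and N: "riemannian_manifold B g'"
    and CS: "conformal_submersion A g B g' F lam"
begin

lemma A: "smooth_manifold A" and g: "riemannian_metric A g"
  and B: "smooth_manifold B" and g': "riemannian_metric B g'"
  using M N by (simp_all add: riemannian_manifold_def)

lemma F: "smooth_map A B F" and lam: "smooth_fun A lam" and lam_pos: "lam p > 0"
  and F_surj: "pushforward A B F p ` tangent_space A p = tangent_space B (F p)"
  and F_conformal: "X \<in> horizontal A g B F p \<Longrightarrow> Y \<in> horizontal A g B F p \<Longrightarrow>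
      g' (F p) (pushforward A B F p X) (pushforward A B F p Y) = (lam p)\<^sup>2 * g p X Y"
  using CS unfolding conformal_submersion_def submersion_def by blast+

definition dom where "dom c d = cmap c ` (cdom c \<inter> F -` cdom d)"

abbreviation rep where "rep c d \<equiv> cmap d \<circ> F \<circ> cinv c"

lemma domD:
  assumes "c \<in> A" "d \<in> B" "y \<in> dom c d"
  shows "c \<in> charts_at A (cinv c y)" "d \<in> charts_at B (F (cinv c y))" "cmap c (cinv c y) = y" "y \<in> cmap c ` cdom c"
  using assms by (auto simp: dom_def charts_at_def cinv_cmap[OF A])

lemma in_dom: "c \<in> charts_at A p \<Longrightarrow> d \<in> charts_at B (F p) \<Longrightarrow> cmap c p \<in> dom c d"
  by (auto simp: dom_def charts_at_def)

lemma vertical_iff: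
  assumes c: "c \<in> charts_at A p" and d: "d \<in> charts_at B (F p)" and v: "v \<in> tangent_space A p"
  shows "v \<in> vertical A B F p \<longleftrightarrow> FD (rep c d) (cmap c p) (v c) = 0"
proof -
  have "pushforward A B F p v = 0 \<longleftrightarrow> pushforward A B F p v d = 0"
    using tangent_eqI[OF B pushforward_tangent[OF A B F v] tangent_0[OF B] d] by (auto simp: zero_fun_def)
  then show ?thesis using v pushforward_coords[OF A B F v c d] by (simp add: vertical_def)
qed

lemma horizontal_iff:
  assumes c: "c \<in> charts_at A p" and d: "d \<in> charts_at B (F p)" and v: "v \<in> tangent_space A p"
  shows "v \<in> horizontal A g B F p \<longleftrightarrow> (\<forall>u. FD (rep c d) (cmap c p) u = 0 \<longrightarrow>
    metric_coords A g c (cmap c p) (v c) u = 0)"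
proof
  assume h: "v \<in> horizontal A g B F p"
  show "\<forall>u. FD (rep c d) (cmap c p) u = 0 \<longrightarrow> metric_coords A g c (cmap c p) (v c) u = 0"
  proof (intro allI impI)
    fix u assume u: "FD (rep c d) (cmap c p) u = 0"
    note t = tvec_of_tangent[OF A c, of u]
    have "tvec_of A c p u \<in> vertical A B F p" using vertical_iff[OF c d t] u by (simp add: tvec_of_self[OF A c])
    then have "g p v (tvec_of A c p u) = 0" using h by (simp add: horizontal_def)
    then show "metric_coords A g c (cmap c p) (v c) u = 0"
      by (simp add: metric_coords_eq[OF A g c v t] tvec_of_self[OF A c])
  qed
next
  assume h: "\<forall>u. FD (rep c d) (cmap c p) u = 0 \<longrightarrow> metric_coords A g c (cmap c p) (v c) u = 0"
  have "g p v u = 0" if u: "u \<in> vertical A B F p" for u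
  proof -
    have t: "u \<in> tangent_space A p" using u by (simp add: vertical_def)
    show ?thesis using h vertical_iff[OF c d t] u by (simp add: metric_coords_eq[OF A g c v t])
  qed
  then show "v \<in> horizontal A g B F p" using v by (simp add: horizontal_def)
qed

lemma conformal_coords:
  assumes c: "c \<in> A" and d: "d \<in> B"
  shows "conformal_coords (dom c d) (cmap d ` cdom d) (metric_coords A g c) (metric_coords B g' d)
    (rep c d) (lam \<circ> cinv c)"
proof
  show "open (dom c d)" unfolding dom_def by (rule open_map_coords[OF A B F c d])
  show "open (cmap d ` cdom d)" by (rule open_cmap_cdom[OF B d])
  show "rep c d ` dom c d \<subseteq> cmap d ` cdom d" by (auto simp: dom_def cinv_cmap[OF A c])
  show "smooth_on (dom c d) (rep c d)" unfolding dom_def by (rule smooth_map_coords[OF A B F c d])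
  have sub: "dom c d \<subseteq> cmap c ` cdom c" by (auto simp: dom_def)
  show "smooth_on (dom c d) (lam \<circ> cinv c)"
    using lam c smooth_on_subset[OF _ sub] unfolding smooth_fun_def by blast
  show "smooth_on (dom c d) (\<lambda>y. metric_coords A g c y u v)" for u v
    by (rule smooth_on_subset[OF metric_coords_smooth[OF A g c] sub])
  show "smooth_on (cmap d ` cdom d) (\<lambda>y. metric_coords B g' d y u v)" for u v
    by (rule metric_coords_smooth[OF B g' d])
  show "y \<in> cmap d ` cdom d \<Longrightarrow> bilinear (metric_coords B g' d y)" for y by (rule metric_coords_bilinear[OF B g' d])
  show "y \<in> cmap d ` cdom d \<Longrightarrow> metric_coords B g' d y u v = metric_coords B g' d y v u" for y u v
    by (rule metric_coords_sym[OF B g' d])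
  fix y u v assume y: "y \<in> dom c d"
  note D = domD[OF c d y]
  show "(lam \<circ> cinv c) y > 0" using lam_pos by simp
  show "bilinear (metric_coords A g c y)" by (rule metric_coords_bilinear[OF A g c D(4)])
  show "metric_coords A g c y u v = metric_coords A g c y v u" by (rule metric_coords_sym[OF A g c D(4)])
  show "u \<noteq> 0 \<Longrightarrow> metric_coords A g c y u u > 0" by (rule metric_coords_pos[OF A g c D(4)])
  show "surj (FD (rep c d) y)"
    unfolding surj_def
  proof
    fix e
    have "tvec_of B d (F (cinv c y)) e \<in> pushforward A B F (cinv c y) ` tangent_space A (cinv c y)"
      unfolding F_surj by (rule tvec_of_tangent[OF B D(2)])
    then obtain w where w: "w \<in> tangent_space A (cinv c y)"
      "tvec_of B d (F (cinv c y)) e = pushforward A B F (cinv c y) w" by blast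
    then have "e = FD (rep c d) y (w c)"
      using pushforward_coords[OF A B F w(1) D(1,2)] tvec_of_self[OF B D(2), of e] D(3) by simp
    then show "\<exists>w. e = FD (rep c d) y w" by blast
  qed
  assume h: "\<And>w. FD (rep c d) y w = 0 \<Longrightarrow> metric_coords A g c y u w = 0"
    "\<And>w. FD (rep c d) y w = 0 \<Longrightarrow> metric_coords A g c y v w = 0"
  let ?p = "cinv c y" and ?u = "tvec_of A c (cinv c y) u" and ?v = "tvec_of A c (cinv c y) v"
  note t = tvec_of_tangent[OF A D(1)] and s = tvec_of_self[OF A D(1)]
  have hz: "?u \<in> horizontal A g B F ?p" "?v \<in> horizontal A g B F ?p"
    using horizontal_iff[OF D(1,2) t] h by (simp_all add: s D(3))
  have "g' (F ?p) (pushforward A B F ?p ?u) (pushforward A B F ?p ?v) =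
      metric_coords B g' d (cmap d (F ?p)) (FD (rep c d) y u) (FD (rep c d) y v)"
    unfolding metric_coords_eq[OF B g' D(2) pushforward_tangent[OF A B F t] pushforward_tangent[OF A B F t]]
    by (simp add: pushforward_coords[OF A B F t D(1,2)] s D(3))
  moreover have "g ?p ?u ?v = metric_coords A g c y u v"
    by (simp add: metric_coords_def)
  ultimately show "metric_coords B g' d (rep c d y) (FD (rep c d) y u)
      (FD (rep c d) y v) = ((lam \<circ> cinv c) y)\<^sup>2 * metric_coords A g c y u v"
    using F_conformal[OF hz] by simp
qed

end

lemma (in conformal_coords) hp_unique:
  assumes "y \<in> S" "hor y b" "D\<phi> y (a - b) = 0"
  shows "hp y a = b"
proof (rule G_eq_on_hor[OF assms(1) hp(1)[OF assms(1)] assms(2)])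
  fix c
  have "K y a c = K y b c"
    using assms(3) by (simp add: K_def linear_diff[OF lin\<phi>[OF assms(1)]])
  then show "G y (hp y a) c = G y b c"
    using G_hp[OF assms(1), of a c] G_hp[OF assms(1), of b c] hp_hor[OF assms(1,2)] by simp
qed

lemma has_real_derivative_bilinear_along:
  fixes H :: "'s::real_normed_vector \<Rightarrow> 'a::euclidean_space \<Rightarrow> 'b::euclidean_space \<Rightarrow> real"
  assumes S: "open S" "x t \<in> S" and H: "\<And>y. y \<in> S \<Longrightarrow> bilinear (H y)"
    and dH: "\<And>i j. (\<lambda>y. H y i j) differentiable (at (x t))"
    and x: "(x has_vector_derivative x') (at t)" and a: "(a has_vector_derivative a') (at t)"
    and b: "(b has_vector_derivative b') (at t)"
  shows "((\<lambda>s. H (x s) (a s) (b s)) has_real_derivative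
    FD (\<lambda>y. H y (a t) (b t)) (x t) x' + H (x t) a' (b t) + H (x t) (a t) b') (at t)"
proof -
  have l: "linear (FD (\<lambda>y. H y (a t) (b t)) (x t))"
    using dH linear_frechet_derivative by blast
  have "(\<lambda>h. FD (\<lambda>y. H y (a t) (b t)) (x t) (h *\<^sub>R x') + H (x t) (h *\<^sub>R a') (b t) +
      H (x t) (a t) (h *\<^sub>R b')) =
    (*) (FD (\<lambda>y. H y (a t) (b t)) (x t) x' + H (x t) a' (b t) + H (x t) (a t) b')"
    by (rule ext) (simp add: linear_scale[OF l] bilinear_lmul[OF H[OF S(2)]] bilinear_rmul[OF H[OF S(2)]] algebra_simps)
  with has_derivative_bilinear_field[OF S H dH x[unfolded has_vector_derivative_def]
      a[unfolded has_vector_derivative_def] b[unfolded has_vector_derivative_def]]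
  show ?thesis unfolding has_field_derivative_def by (simp only:)
qed

lemma DERIV_zero_constant_on:
  fixes h :: "real \<Rightarrow> real"
  assumes "open I" "is_interval I" "\<And>t. t \<in> I \<Longrightarrow> (h has_real_derivative 0) (at t)"
  shows "h constant_on I"
proof -
  have "(h has_derivative (\<lambda>x. 0)) (at t within I)" if "t \<in> I" for t
    using assms(3)[OF that] by (simp add: has_field_derivative_def has_derivative_at_withinI lambda_zero[symmetric])
  then show ?thesis
    using has_derivative_zero_constant[of I h] is_interval_convex[OF assms(2)] unfolding constant_on_def by blast
qed

subsection \<open>Gradients\<close>

lemma gradient_spec:
  assumes A: "smooth_manifold A" and g: "riemannian_metric A g" and f: "smooth_fun A f"
  shows "gradient A g f p \<in> tangent_space A p"
    "v \<in> tangent_space A p \<Longrightarrow> g p (gradient A g f p) v = dfun A f p v"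
proof -
  define c where "c = chart_at A p"
  have c: "c \<in> charts_at A p" unfolding c_def by (rule chart_at_in[OF A])
  note x = charts_at_cmap[OF A g c] and cA = charts_atD(1)[OF c]
  have "linear (FD (f \<circ> cinv c) (cmap c p))"
    using f cA x smooth_on_linear_frechet unfolding smooth_fun_def by blast
  from bilinear_pos_def_solve[OF metric_coords_bilinear[OF A g cA x] metric_coords_pos[OF A g cA x] this]
  obtain w where w: "\<And>z. metric_coords A g c (cmap c p) w z = FD (f \<circ> cinv c) (cmap c p) z"
    by metis
  let ?w = "tvec_of A c p w"
  note t = tvec_of_tangent[OF A c, of w]
  have sol: "g p ?w v = dfun A f p v" if "v \<in> tangent_space A p" for v
    by (simp add: metric_coords_eq[OF A g c t that] tvec_of_self[OF A c] w dfun_coords[OF A f that c])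
  have "w' = ?w" if w': "w' \<in> tangent_space A p" "\<forall>v\<in>tangent_space A p. g p w' v = dfun A f p v" for w'
  proof (rule ccontr)
    assume "w' \<noteq> ?w"
    note d = tangent_diff[OF A w'(1) t]
    have "g p (w' - ?w + ?w) (w' - ?w) = g p (w' - ?w) (w' - ?w) + g p ?w (w' - ?w)"
      by (rule metric_add_left[OF A g d t d])
    then have "g p (w' - ?w) (w' - ?w) = 0" using w'(2) sol d by simp
    then show False using metric_pos[OF A g d] \<open>w' \<noteq> ?w\<close> by simp
  qed
  then have "gradient A g f p = ?w" unfolding gradient_def using sol t by (intro the_equality) blast+
  then show "gradient A g f p \<in> tangent_space A p"
    "v \<in> tangent_space A p \<Longrightarrow> g p (gradient A g f p) v = dfun A f p v" using t sol by simp_all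
qed

text \<open>In a chart the gradient solves the linear system with the metric as matrix and the
  differential of \<open>f\<close> on the right.\<close>

lemma gradient_smooth:
  assumes A: "smooth_manifold A" and g: "riemannian_metric A g" and f: "smooth_fun A f"
  shows "smooth_vfield A (gradient A g f)"
  unfolding smooth_vfield_def
proof (intro conjI allI ballI gradient_spec[OF A g f])
  fix c assume c: "c \<in> A"
  have sf: "smooth_on (cmap c ` cdom c) (f \<circ> cinv c)" using f c by (simp add: smooth_fun_def)
  show "smooth_on (cmap c ` cdom c) (\<lambda>x. gradient A g f (cinv c x) c)"
  proof (rule smooth_on_solve[OF open_cmap_cdom[OF A c] metric_coords_bilinear[OF A g c] metric_coords_pos[OF A g c]
        metric_coords_smooth[OF A g c] smooth_on_frechet_derivative[OF sf]])
    fix x z assume x: "x \<in> cmap c ` cdom c"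
    note c' = charts_at_cinv[OF A g c x]
    show "metric_coords A g c x (gradient A g f (cinv c x) c) z = FD (f \<circ> cinv c) x z"
      using gradient_spec(2)[OF A g f tvec_of_tangent[OF A c', of z]]
      by (simp add: metric_coords_eq[OF A g c' gradient_spec(1)[OF A g f] tvec_of_tangent[OF A c']]
          tvec_of_self[OF A c'] dfun_coords[OF A f tvec_of_tangent[OF A c'] c'] cmap_cinv[OF A c x])
  qed
qed

lemma smooth_vfield_minus:
  assumes A: "smooth_manifold A" and X: "smooth_vfield A X"
  shows "smooth_vfield A (\<lambda>p. - X p)"
  using X unfolding smooth_vfield_def
  by (auto simp: fun_Compl_def intro!: tangent_minus[OF A, unfolded fun_Compl_def] smooth_on_minus open_cmap_cdom[OF A])

subsection \<open>The Clairaut condition in a pair of charts\<close>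

locale chart_pair = conformal_submersion_of_manifolds +
  fixes c d
  assumes cA: "c \<in> A" and dB: "d \<in> B"
begin

sublocale cc: conformal_coords "dom c d" "cmap d ` cdom d" "metric_coords A g c" "metric_coords B g' d"
    "rep c d" "lam \<circ> cinv c"
  by (rule conformal_coords[OF cA dB])

context
  fixes p
  assumes cp: "c \<in> charts_at A p" and dp: "d \<in> charts_at B (F p)"
begin

lemma xd: "cmap c p \<in> dom c d"
  by (rule in_dom[OF cp dp])

lemmas tvc = tvec_of_tangent[OF A cp] and tvs = tvec_of_self[OF A cp]

lemma horizontal_coords: "v \<in> tangent_space A p \<Longrightarrow> v \<in> horizontal A g B F p \<longleftrightarrow> cc.hor (cmap c p) (v c)"
  unfolding cc.hor_def by (rule horizontal_iff[OF cp dp])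

lemma hproj_coords:
  assumes v: "v \<in> tangent_space A p"
  shows "hproj A g B F p v = tvec_of A c p (cc.hp (cmap c p) (v c))"
  unfolding hproj_def
proof (rule the_equality)
  let ?w = "tvec_of A c p (cc.hp (cmap c p) (v c))"
  have "v - ?w \<in> vertical A B F p"
    unfolding vertical_iff[OF cp dp tangent_diff[OF A v tvc]]
    using cc.hp(2)[OF xd, of "v c"] by (simp add: tvs fun_diff_def)
  then show "?w \<in> horizontal A g B F p \<and> v - ?w \<in> vertical A B F p"
    by (simp add: horizontal_coords tvc tvs cc.hp(1)[OF xd])
  fix w assume w: "w \<in> horizontal A g B F p \<and> v - w \<in> vertical A B F p"
  then have t: "w \<in> tangent_space A p" by (simp add: horizontal_def)
  have "cc.hp (cmap c p) (v c) = w c"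
    using w vertical_iff[OF cp dp tangent_diff[OF A v t]] horizontal_coords[OF t]
    by (intro cc.hp_unique[OF xd]) (auto simp: fun_diff_def)
  then show "w = ?w" using tvec_of_coord[OF A t cp] by simp
qed

text \<open>A vector has inner product K(v, v) with its horizontal part, and so has that part with
  itself; hence the cosine of the angle is the root of K / G.\<close>

lemma sin_horizontal_angle:
  assumes v: "v \<in> tangent_space A p"
  shows "sin (horizontal_angle A g B F p v) = (if v = 0 then 1 else
    sqrt ((metric_coords A g c (cmap c p) (v c) (v c) - cc.K (cmap c p) (v c) (v c)) /
      metric_coords A g c (cmap c p) (v c) (v c)))"
proof -
  let ?G = "metric_coords A g c (cmap c p)" and ?K = "cc.K (cmap c p) (v c) (v c)"
  let ?h = "cc.hp (cmap c p) (v c)"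
  have 1: "g p v (hproj A g B F p v) = ?K"
    using metric_coords_eq[OF A g cp v tvc, of ?h] cc.symG[OF xd, of "v c" ?h] cc.G_hp[OF xd, of "v c" "v c"]
    by (simp add: hproj_coords[OF v] tvs)
  have 2: "g p (hproj A g B F p v) (hproj A g B F p v) = ?K"
    using metric_coords_eq[OF A g cp tvc tvc, of ?h ?h] cc.G_hp[OF xd, of "v c" ?h] cc.K_hp[OF xd]
    by (simp add: hproj_coords[OF v] tvs)
  have 3: "g p v v = ?G (v c) (v c)" by (rule metric_coords_eq[OF A g cp v v])
  note nn = cc.G_K_nonneg[OF xd, of "v c"]
  have ang: "horizontal_angle A g B F p v = arccos (?K / (sqrt (?G (v c) (v c)) * sqrt ?K))"
    by (simp add: horizontal_angle_def gangle_def gnorm_def 1 2 3)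
  show ?thesis
  proof (cases "v = 0")
    case True
    then have "v c = 0" by (simp add: zero_fun_def)
    then have "?G (v c) (v c) = 0" by (simp add: bilinear_lzero[OF cc.bG[OF xd]])
    \<comment> \<open>The denominator is 0, so \<open>arccos\<close> is taken at 0 and the angle is
      \<pi>/2. The quotient formula would give 0 here, hence the case distinction.\<close>
    then have "sin (horizontal_angle A g B F p v) = 1" by (simp add: ang)
    then show ?thesis using True by simp
  next
    case False
    have pos: "?G (v c) (v c) > 0" using metric_pos[OF A g v False] by (simp add: 3)
    \<comment> \<open>For a vertical vector \<open>?K = 0\<close> and both sides are 0; otherwise a
      factor \<open>sqrt ?K\<close> cancels.\<close>
    have e: "?K / (sqrt (?G (v c) (v c)) * sqrt ?K) = sqrt (?K / ?G (v c) (v c))"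
    proof (cases "?K = 0")
      case False
      then have "sqrt ?K \<noteq> 0" by simp
      have "?K / (sqrt (?G (v c) (v c)) * sqrt ?K) = (sqrt ?K * sqrt ?K) / (sqrt (?G (v c) (v c)) * sqrt ?K)"
        using nn by simp
      also have "\<dots> = sqrt ?K / sqrt (?G (v c) (v c))" by (rule nonzero_mult_divide_mult_cancel_right[OF \<open>sqrt ?K \<noteq> 0\<close>])
      finally show ?thesis by (simp add: real_sqrt_divide)
    qed simp
    have q: "0 \<le> ?K / ?G (v c) (v c)" "?K / ?G (v c) (v c) \<le> 1" using nn pos by simp_all
    have "sin (arccos (sqrt (?K / ?G (v c) (v c)))) = sqrt (1 - (sqrt (?K / ?G (v c) (v c)))\<^sup>2)"
    proof (rule sin_arccos)
      have "0 \<le> sqrt (?K / ?G (v c) (v c))" by (rule real_sqrt_ge_zero[OF q(1)])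
      then show "- 1 \<le> sqrt (?K / ?G (v c) (v c))" by linarith
      show "sqrt (?K / ?G (v c) (v c)) \<le> 1" using q(2) by simp
    qed
    also have "(sqrt (?K / ?G (v c) (v c)))\<^sup>2 = ?K / ?G (v c) (v c)" by (rule real_sqrt_pow2[OF q(1)])
    also have "1 - ?K / ?G (v c) (v c) = (?G (v c) (v c) - ?K) / ?G (v c) (v c)"
      using pos by (simp add: diff_divide_distrib)
    finally show ?thesis using False by (simp only: ang e if_False)
  qed
qed

abbreviation \<Gamma> where "\<Gamma> \<equiv> christoffel A g c p"

lemmas christoffel_facts = christoffel_spec[OF A g cp]

lemmas NK_vertical_field' = cc.NK_vertical_field[OF xd christoffel_facts]

text \<open>The second fundamental form, tested against a horizontal vector, is
  \<open>- cc.NK\<close>. The chart \<open>c\<close> is the one in which \<open>cov_deriv\<close> is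
  computed.\<close>

lemma cov_deriv_vertical:
  assumes c: "c = chart_at A p"
    and U: "U p \<in> vertical A B F p" and V: "smooth_vfield A V" "\<And>q. V q \<in> vertical A B F q"
    and a: "cc.hor (cmap c p) a"
  shows "cov_deriv A g U V p \<in> tangent_space A p"
    "metric_coords A g c (cmap c p) (cov_deriv A g U V p c) a = - cc.NK (cmap c p) \<Gamma> (U p c) (V p c) a"
proof -
  let ?V = "\<lambda>y. V (cinv c y) c"
  have V0: "?V (cmap c p) = V p c" by (simp add: cinv_cmap[OF A charts_atD[OF cp]])
  have eq: "cov_deriv A g U V p = tvec_of A c p (FD ?V (cmap c p) (U p c) + \<Gamma> (U p c) (V p c))"
    by (simp add: cov_deriv_def Let_def c)
  then show "cov_deriv A g U V p \<in> tangent_space A p" using tvc by simp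
  have "smooth_on (cmap c ` cdom c) ?V" using V(1) cA by (simp add: smooth_vfield_def)
  then have dV: "(?V has_derivative FD ?V (cmap c p)) (at (cmap c p))"
    by (rule smooth_on_has_derivative) (use charts_atD(2)[OF cp] in blast)
  have vV: "FD (rep c d) y (?V y) = 0" if y: "y \<in> dom c d" for y
  proof -
    have "V (cinv c y) \<in> tangent_space A (cinv c y)" using V(2) by (simp add: vertical_def)
    from vertical_iff[OF domD(1,2)[OF cA dB y] this] show ?thesis
      using V(2) by (simp add: domD(3)[OF cA dB y])
  qed
  have vU: "FD (rep c d) (cmap c p) (U p c) = 0"
    using vertical_iff[OF cp dp, of "U p"] U by (simp add: vertical_def)
  have "cc.NK (cmap c p) \<Gamma> (U p c) (?V (cmap c p)) a =
      - metric_coords A g c (cmap c p) (FD ?V (cmap c p) (U p c) + \<Gamma> (U p c) (?V (cmap c p))) a"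
    by (rule NK_vertical_field'[OF dV cc.S xd vV vU a])
  then show "metric_coords A g c (cmap c p) (cov_deriv A g U V p c) a = - cc.NK (cmap c p) \<Gamma> (U p c) (V p c) a"
    by (simp add: eq tvs V0)
qed

end

end

context chart_pair
begin

subsection \<open>Extending a vertical vector to a vertical field\<close>

text \<open>Umbilicity is a statement about global vertical fields. The vertical part of the
  constant coordinate field \<open>u c\<close> is cut off by a bump function that vanishes outside a
  small ball in the chart image, and extended by 0.\<close>

lemma vertical_field_extension:
  assumes cp: "c \<in> charts_at A p" and dp: "d \<in> charts_at B (F p)"
    and u: "u \<in> vertical A B F p"
  obtains U where "smooth_vfield A U" "\<And>q. U q \<in> vertical A B F q" "U p = u"
proof -
  let ?D = "dom c d" and ?x = "cmap c p"
  define Q where "Q = cdom c \<inter> F -` cdom d"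
  have Q: "open Q" unfolding Q_def by (intro open_Int open_cdom[OF A cA] open_vimage_chart[OF A B F dB])
  have DO: "?D = cmap c ` Q" by (simp add: dom_def Q_def)
  have qO: "c \<in> charts_at A q" "d \<in> charts_at B (F q)" "cmap c q \<in> ?D" if "q \<in> Q" for q
    using that cA dB by (auto simp: Q_def dom_def charts_at_def)
  have xD: "?x \<in> ?D" by (rule in_dom[OF cp dp])
  have ut: "u \<in> tangent_space A p" using u by (simp add: vertical_def)
  obtain r where r: "r > 0" "cball ?x r \<subseteq> ?D" using cc.S xD open_contains_cball by blast
  obtain \<psi> :: "_ \<Rightarrow> real" where \<psi>: "smooth_on UNIV \<psi>" "\<psi> ?x = 1" "\<And>y. y \<notin> ball ?x r \<Longrightarrow> \<psi> y = 0"
    using smooth_bump[OF r(1)] by blast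
  define V where "V = (\<lambda>y. \<psi> y *\<^sub>R (u c - cc.hp y (u c)))"
  have sV: "smooth_on ?D V"
    unfolding V_def
    by (intro smooth_on_scaleR smooth_on_diff smooth_on_const cc.hp_smooth cc.S smooth_on_subset[OF \<psi>(1) subset_UNIV])
  define U where "U = (\<lambda>q. if q \<in> Q then tvec_of A c q (V (cmap c q)) else 0)"
  \<comment> \<open>\<open>C\<close> is compact, hence closed as the manifold is Hausdorff. So
    \<open>Q\<close> and \<open>- C\<close> form an open cover, and the field vanishes on
    \<open>- C\<close>.\<close>
  define C where "C = cinv c ` cball ?x r"
  have rc: "cball ?x r \<subseteq> cmap c ` cdom c" using r(2) by (auto simp: dom_def)
  have "compact C"
    unfolding C_def by (intro compact_continuous_image continuous_on_subset[OF continuous_on_cinv[OF A cA] rc] compact_cball)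
  then have C: "open (- C)" by (simp add: compact_imp_closed open_Compl)
  have CO: "C \<subseteq> Q"
    unfolding C_def
  proof (rule image_subsetI)
    fix y assume "y \<in> cball ?x r"
    then have y: "y \<in> ?D" using r(2) by blast
    show "cinv c y \<in> Q"
      using charts_atD(2)[OF domD(1)[OF cA dB y]] charts_atD(2)[OF domD(2)[OF cA dB y]] by (simp add: Q_def)
  qed
  have U0: "U q = 0" if "q \<notin> C" for q
  proof (cases "q \<in> Q")
    case True
    have "cmap c q \<notin> cball ?x r"
    proof
      assume "cmap c q \<in> cball ?x r"
      then have "cinv c (cmap c q) \<in> C" unfolding C_def by (rule imageI)
      then show False using that cinv_cmap[OF A charts_atD[OF qO(1)[OF True]]] by simp
    qed
    then have "V (cmap c q) = 0" using \<psi>(3)[of "cmap c q"] by (simp add: V_def)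
    then show ?thesis using True tvec_of_0[OF A qO(1)[OF True]] by (simp add: U_def)
  qed (simp add: U_def)
  have Ut: "U q \<in> tangent_space A q" for q
    using tvec_of_tangent[OF A qO(1)] tangent_0[OF A] by (simp add: U_def)
  have "U q \<in> vertical A B F q" for q
  proof (cases "q \<in> Q")
    case True
    have "FD (rep c d) (cmap c q) (V (cmap c q)) = 0"
      using cc.hp(2)[OF qO(3)[OF True], of "u c"] by (simp add: V_def linear_scale[OF cc.lin\<phi>[OF qO(3)[OF True]]])
    then show ?thesis
      unfolding vertical_iff[OF qO(1,2)[OF True] Ut]
      using True by (simp add: U_def tvec_of_self[OF A qO(1)[OF True]])
  next
    case False
    have "pushforward A B F q (0 *\<^sub>R 0) = 0 *\<^sub>R pushforward A B F q 0"
      by (rule linear_pushforward(2)[OF A B F])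
    then show ?thesis using False tangent_0[OF A] by (simp add: U_def vertical_def)
  qed
  moreover have "U p = u"
  proof -
    have "p \<in> Q" using charts_atD(2)[OF cp] charts_atD(2)[OF dp] by (simp add: Q_def)
    moreover have "cc.hp ?x (u c) = 0"
      using vertical_iff[OF cp dp ut] u
      by (intro cc.hp_unique[OF xD]) (simp_all add: cc.hor_def bilinear_lzero[OF cc.bG[OF xD]])
    ultimately show ?thesis by (simp add: U_def V_def \<psi>(2) tvec_of_coord[OF A ut cp])
  qed
  moreover have "smooth_vfield A U"
    unfolding smooth_vfield_def
  proof (intro conjI allI ballI Ut)
    fix e assume e: "e \<in> A"
    let ?E1 = "cmap e ` (cdom e \<inter> Q)" and ?E2 = "cmap e ` (cdom e \<inter> - C)"
    let ?\<tau> = "cmap e \<circ> cinv c" and ?\<tau>' = "cmap c \<circ> cinv e"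
    let ?W = "cmap c ` (cdom c \<inter> (Q \<inter> cdom e))"
    have o1: "open ?E1" and o2: "open ?E2" and oW: "open ?W"
      by (intro open_cmap_image[OF A] e cA Q C open_Int open_cdom[OF A])+
    have "Q \<union> - C = UNIV" using CO by blast
    then have "cmap e ` cdom e = \<Union>{?E1, ?E2}" by blast
    moreover have "smooth_on ?E2 (\<lambda>x. U (cinv e x) e)"
    proof (rule iffD2[OF smooth_on_cong[OF o2] smooth_on_const[OF o2, of 0]])
      fix x assume "x \<in> ?E2"
      then have "U (cinv e x) = 0" by (intro U0) (auto simp: cinv_cmap[OF A e])
      then show "U (cinv e x) e = 0" by (simp add: zero_fun_def)
    qed
    moreover have "smooth_on ?E1 (\<lambda>x. U (cinv e x) e)"
    proof -
      \<comment> \<open>On \<open>?E1\<close> the components in \<open>e\<close> are those in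
        \<open>c\<close>, moved by the derivative of the transition map and composed with the
        inverse transition; only the first factor has a moving direction to be expanded in
        \<open>Basis\<close>.\<close>
      have sub: "?W \<subseteq> cmap c ` (cdom c \<inter> cdom e)" "?W \<subseteq> ?D" by (auto simp: DO)
      have s\<tau>: "smooth_on ?W ?\<tau>" by (rule smooth_on_subset[OF transition_smooth[OF A cA e] sub(1)])
      have s1: "smooth_on ?W (\<lambda>z. \<Sum>b\<in>Basis. (V z \<bullet> b) *\<^sub>R FD ?\<tau> z b)"
        by (intro smooth_on_sum smooth_on_scaleR smooth_on_inner smooth_on_const oW finite_Basis
            smooth_on_frechet_derivative[OF s\<tau>] smooth_on_subset[OF sV sub(2)])
      have e1: "FD ?\<tau> z (V z) = (\<Sum>b\<in>Basis. (V z \<bullet> b) *\<^sub>R FD ?\<tau> z b)"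
        if "z \<in> ?W" for z
        by (rule linear_expand[OF smooth_on_linear_frechet[OF s\<tau> that]])
      have sm: "smooth_on ?W (\<lambda>z. FD ?\<tau> z (V z))"
        by (rule iffD2[OF smooth_on_cong[OF oW] s1]) (rule e1)
      have "smooth_on ?E1 ?\<tau>'"
        by (rule smooth_on_subset[OF transition_smooth[OF A e cA]]) (auto simp: Q_def)
      moreover have "?\<tau>' ` ?E1 \<subseteq> ?W"
        using e by (auto simp: cinv_cmap[OF A e] Q_def)
      ultimately have s2: "smooth_on ?E1 (\<lambda>x. FD ?\<tau> (?\<tau>' x) (V (?\<tau>' x)))"
        by (intro smooth_on_compose[OF o1 oW _ sm])
      have e2: "U (cinv e x) e = FD ?\<tau> (?\<tau>' x) (V (?\<tau>' x))" if "x \<in> ?E1" for x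
      proof -
        have q: "cinv e x \<in> Q" "e \<in> charts_at A (cinv e x)" using that e by (auto simp: cinv_cmap[OF A e] charts_at_def)
        then show ?thesis by (simp add: U_def tvec_of_def)
      qed
      show ?thesis by (rule iffD2[OF smooth_on_cong[OF o1] s2]) (rule e2)
    qed
    ultimately show "smooth_on (cmap e ` cdom e) (\<lambda>x. U (cinv e x) e)"
      using smooth_on_Union[of "{?E1, ?E2}" "\<lambda>x. U (cinv e x) e"] o1 o2 by auto
  qed
  ultimately show ?thesis using that by blast
qed

end

subsection \<open>The dilation along the fibers\<close>

context conformal_submersion_of_manifolds
begin

lemma dilation_locally_constant:
  assumes v: "\<And>p u. u \<in> vertical A B F p \<Longrightarrow> dfun A lam p u = 0"
  obtains Q where "open Q" "p \<in> Q" "\<And>p'. p' \<in> Q \<Longrightarrow> F p' = F p \<Longrightarrow> lam p' = lam p"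
proof -
  define c d where "c = chart_at A p" and "d = chart_at B (F p)"
  have cp: "c \<in> charts_at A p" and dp: "d \<in> charts_at B (F p)"
    unfolding c_def d_def by (rule chart_at_in[OF A], rule chart_at_in[OF B])
  note cA = charts_atD(1)[OF cp] and dB = charts_atD(1)[OF dp]
  interpret chart_pair A g B g' F lam c d by unfold_locales (rule cA, rule dB)
  note xD = in_dom[OF cp dp]
  have dl: "FD (lam \<circ> cinv c) y u = 0"
    if y: "y \<in> dom c d" and u: "FD (rep c d) y u = 0" for y u
  proof -
    note D = domD[OF cA dB y]
    let ?u = "tvec_of A c (cinv c y) u"
    note t = tvec_of_tangent[OF A D(1), of u]
    have "?u \<in> vertical A B F (cinv c y)"
      using u by (simp add: vertical_iff[OF D(1,2) t] tvec_of_self[OF A D(1)] D(3))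
    from v[OF this] show ?thesis
      by (simp add: dfun_coords[OF A lam t D(1)] tvec_of_self[OF A D(1)] D(3))
  qed
  obtain N where N: "open N" "cmap c p \<in> N" "N \<subseteq> dom c d"
    "\<And>x. x \<in> N \<Longrightarrow> rep c d x = rep c d (cmap c p) \<Longrightarrow> (lam \<circ> cinv c) x = (lam \<circ> cinv c) (cmap c p)"
    using submersion_locally_constant_on_fiber[OF cc.S xD cc.s\<phi> cc.surj[OF xD] cc.sl dl] by blast
  show ?thesis
  proof
    show "open (cdom c \<inter> cmap c -` N)"
      using continuous_on_open_vimage[OF open_cdom[OF A cA], of "cmap c"] continuous_on_cmap[OF A cA] N(1)
      by (simp add: Int_commute)
    show "p \<in> cdom c \<inter> cmap c -` N" using N(2) charts_atD(2)[OF cp] by simp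
    fix p' assume p': "p' \<in> cdom c \<inter> cmap c -` N" "F p' = F p"
    then show "lam p' = lam p"
      using N(4)[of "cmap c p'"] charts_atD(2)[OF cp] by (simp add: cinv_cmap[OF A cA])
  qed
qed

text \<open>By \<open>dilation_locally_constant\<close> the dilation is locally constant on the
  fiber as a subspace, and a locally constant function on a connected set is constant.\<close>

lemma dilation_constant_on_fibers:
  assumes v: "\<And>p u. u \<in> vertical A B F p \<Longrightarrow> dfun A lam p u = 0" and conn: "connected (F -` {q})"
  shows "lam constant_on (F -` {q})"
proof -
  have "\<forall>p\<in>F -` {q}. eventually (\<lambda>p'. lam p = lam p') (at p within F -` {q})"
  proof
    fix p assume p: "p \<in> F -` {q}"
    obtain Q where Q: "open Q" "p \<in> Q" "\<And>p'. p' \<in> Q \<Longrightarrow> F p' = F p \<Longrightarrow> lam p' = lam p"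
      using dilation_locally_constant[OF v] by blast
    have "lam p = lam p'" if "p' \<in> Q" "p' \<in> F -` {q}" for p'
      by (rule Q(3)[symmetric, OF that(1)]) (use p that(2) in simp)
    then show "eventually (\<lambda>p'. lam p = lam p') (at p within F -` {q})"
      unfolding eventually_at_topological using Q(1,2) by blast
  qed
  then have "lam a = lam b" if "a \<in> F -` {q}" "b \<in> F -` {q}" for a b
    using connected_local_const[OF conn that] by blast
  then show ?thesis unfolding constant_on_def by blast
qed

lemma dilation_vertical_derivative:
  assumes const: "\<And>q. lam constant_on (F -` {q})" and u: "u \<in> vertical A B F p"
  shows "dfun A lam p u = 0"
proof -
  define c d where "c = chart_at A p" and "d = chart_at B (F p)"
  have cp: "c \<in> charts_at A p" and dp: "d \<in> charts_at B (F p)"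
    unfolding c_def d_def by (rule chart_at_in[OF A], rule chart_at_in[OF B])
  note cA = charts_atD(1)[OF cp] and dB = charts_atD(1)[OF dp]
  interpret chart_pair A g B g' F lam c d by unfold_locales (rule cA, rule dB)
  have ut: "u \<in> tangent_space A p" using u by (simp add: vertical_def)
  have "FD (lam \<circ> cinv c) (cmap c p) (u c) = 0"
  proof (rule cc.dilation_derivative_vertical[OF in_dom[OF cp dp]])
    show "FD (rep c d) (cmap c p) (u c) = 0" using vertical_iff[OF cp dp ut] u by blast
    fix y assume y: "y \<in> dom c d" "rep c d y = rep c d (cmap c p)"
    note D = domD[OF cA dB y(1)]
    have "F (cinv c y) = F p"
      using y(2) cinv_cmap[OF B charts_atD[OF D(2)]] cinv_cmap[OF B charts_atD[OF dp]]
      by (metis cinv_cmap[OF A charts_atD[OF cp]] comp_apply)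
    moreover obtain k where "\<And>p'. F p' = F p \<Longrightarrow> lam p' = k"
      using const[of "F p"] unfolding constant_on_def by auto
    ultimately show "(lam \<circ> cinv c) y = (lam \<circ> cinv c) (cmap c p)"
      by (simp add: cinv_cmap[OF A charts_atD[OF cp]])
  qed
  then show ?thesis by (simp add: dfun_coords[OF A lam ut cp])
qed

end

subsection \<open>The Clairaut condition at a point\<close>

text \<open>The right side of the theorem localised at a point: the vanishing of the two
  differentials on vertical vectors stands for the gradient being horizontal and the dilation being
  constant along fibers. \<open>U\<close> and \<open>V\<close> remain global fields, as in
  \<open>fibers_totally_umbilical\<close>.\<close>

definition (in conformal_submersion_of_manifolds) clairaut_at :: "('m \<Rightarrow> real) \<Rightarrow> 'm \<Rightarrow> bool" where
  "clairaut_at f p \<longleftrightarrow>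
     (\<forall>u\<in>vertical A B F p. dfun A f p u = 0 \<and> dfun A lam p u = 0) \<and>
     (\<forall>U V. smooth_vfield A U \<and> (\<forall>q. U q \<in> vertical A B F q) \<and>
            smooth_vfield A V \<and> (\<forall>q. V q \<in> vertical A B F q) \<longrightarrow>
        hproj A g B F p (cov_deriv A g U V p) = g p (U p) (V p) *\<^sub>R - gradient A g f p)"

lemma (in conformal_submersion_of_manifolds) gradient_horizontal_iff:
  assumes f: "smooth_fun A f"
  shows "gradient A g f p \<in> horizontal A g B F p \<longleftrightarrow> (\<forall>u\<in>vertical A B F p. dfun A f p u = 0)"
  using gradient_spec[OF A g f] by (auto simp: horizontal_def vertical_def)

context chart_pair
begin

context
  fixes p f
  assumes cp: "c \<in> charts_at A p" and dp: "d \<in> charts_at B (F p)" and f: "smooth_fun A f"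
begin

abbreviation Df where "Df \<equiv> FD (f \<circ> cinv c) (cmap c p)"

lemmas tv = tvec_of_tangent[OF A cp] and ts = tvec_of_self[OF A cp] and px = in_dom[OF cp dp]

lemma f_coords_has_derivative: "((f \<circ> cinv c) has_derivative Df) (at (cmap c p))"
  using f cA charts_atD(2)[OF cp]
  by (intro smooth_on_has_derivative[of "cmap c ` cdom c"]) (auto simp: smooth_fun_def)

lemma gradient_coords: "metric_coords A g c (cmap c p) (gradient A g f p c) a = Df a"
  using gradient_spec(2)[OF A g f tv, of a]
  by (simp add: metric_coords_eq[OF A g cp gradient_spec(1)[OF A g f] tv] ts dfun_coords[OF A f tv cp])

lemma vertical_derivatives_iff:
  "(\<forall>u\<in>vertical A B F p. dfun A f p u = 0 \<and> dfun A lam p u = 0) \<longleftrightarrow>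
   (\<forall>u. cc.D\<phi> (cmap c p) u = 0 \<longrightarrow> Df u = 0 \<and> FD (lam \<circ> cinv c) (cmap c p) u = 0)"
proof (intro iffI allI ballI impI)
  fix u assume *: "\<forall>u\<in>vertical A B F p. dfun A f p u = 0 \<and> dfun A lam p u = 0" and u: "cc.D\<phi> (cmap c p) u = 0"
  have "tvec_of A c p u \<in> vertical A B F p" using vertical_iff[OF cp dp tv] u by (simp add: ts)
  from bspec[OF * this] show "Df u = 0 \<and> FD (lam \<circ> cinv c) (cmap c p) u = 0"
    by (simp add: dfun_coords[OF A f tv cp] dfun_coords[OF A lam tv cp] ts)
next
  fix u assume *: "\<forall>u. cc.D\<phi> (cmap c p) u = 0 \<longrightarrow> Df u = 0 \<and> FD (lam \<circ> cinv c) (cmap c p) u = 0"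
    and u: "u \<in> vertical A B F p"
  have ut: "u \<in> tangent_space A p" using u by (simp add: vertical_def)
  have "cc.D\<phi> (cmap c p) (u c) = 0" using vertical_iff[OF cp dp ut] u by blast
  with * show "dfun A f p u = 0 \<and> dfun A lam p u = 0"
    by (simp add: dfun_coords[OF A f ut cp] dfun_coords[OF A lam ut cp])
qed

lemma cov_deriv_hproj:
  assumes c: "c = chart_at A p" and U: "U p \<in> vertical A B F p"
    and V: "smooth_vfield A V" "\<And>q. V q \<in> vertical A B F q" and a: "cc.hor (cmap c p) a"
  shows "hproj A g B F p (cov_deriv A g U V p) = tvec_of A c p (cc.hp (cmap c p) (cov_deriv A g U V p c))"
    "metric_coords A g c (cmap c p) (cc.hp (cmap c p) (cov_deriv A g U V p c)) a =
      - cc.NK (cmap c p) (christoffel A g c p) (U p c) (V p c) a"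
proof -
  note C = cov_deriv_vertical[where U = U and V = V, OF cp dp c U V a]
  show "hproj A g B F p (cov_deriv A g U V p) = tvec_of A c p (cc.hp (cmap c p) (cov_deriv A g U V p c))"
    by (rule hproj_coords[OF cp dp C(1)])
  show "metric_coords A g c (cmap c p) (cc.hp (cmap c p) (cov_deriv A g U V p c)) a =
      - cc.NK (cmap c p) (christoffel A g c p) (U p c) (V p c) a"
    using C(2) cc.G_hp[OF px] cc.K_hor[OF px a] by simp
qed

text \<open>Equal fields \<open>U\<close> and \<open>V\<close> extending a vertical vector give the
  quadratic condition of \<open>clairaut_pointwise\<close>; polarization recovers all pairs of
  fields.\<close>

lemma clairaut_at_iff:
  assumes c: "c = chart_at A p"
  shows "clairaut_at f p \<longleftrightarrow>
    (\<forall>v. 2 * Df v * (metric_coords A g c (cmap c p) v v - cc.K (cmap c p) v v) =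
      cc.NK (cmap c p) (christoffel A g c p) v v v)"
proof -
  let ?G = "metric_coords A g c (cmap c p)" and ?NK = "cc.NK (cmap c p) (christoffel A g c p)"
  let ?hor = "cc.hor (cmap c p)" and ?grad = "gradient A g f p"
  note ch = christoffel_spec[OF A g cp]
  have l: "linear Df" using f_coords_has_derivative has_derivative_linear by blast
  \<comment> \<open>The equivalence is claimed when df vanishes on vertical vectors: then the
    gradient is horizontal, and horizontal vectors can be compared by testing against horizontal
    ones.\<close>
  have "(\<forall>U V. smooth_vfield A U \<and> (\<forall>q. U q \<in> vertical A B F q) \<and>
            smooth_vfield A V \<and> (\<forall>q. V q \<in> vertical A B F q) \<longrightarrow>
        hproj A g B F p (cov_deriv A g U V p) = g p (U p) (V p) *\<^sub>R - ?grad) \<longleftrightarrow>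
      (\<forall>u a. cc.D\<phi> (cmap c p) u = 0 \<longrightarrow> ?hor a \<longrightarrow> ?NK u u a = Df a * ?G u u)"
    if v: "\<forall>u\<in>vertical A B F p. dfun A f p u = 0"
  proof (intro iffI allI impI)
    fix u a
    assume *: "\<forall>U V. smooth_vfield A U \<and> (\<forall>q. U q \<in> vertical A B F q) \<and>
            smooth_vfield A V \<and> (\<forall>q. V q \<in> vertical A B F q) \<longrightarrow>
        hproj A g B F p (cov_deriv A g U V p) = g p (U p) (V p) *\<^sub>R - ?grad"
      and u: "cc.D\<phi> (cmap c p) u = 0" and a: "?hor a"
    have "tvec_of A c p u \<in> vertical A B F p" using vertical_iff[OF cp dp tv] u by (simp add: ts)
    then obtain U where U: "smooth_vfield A U" "\<And>q. U q \<in> vertical A B F q" "U p = tvec_of A c p u"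
      using vertical_field_extension[OF cp dp] by blast
    have "hproj A g B F p (cov_deriv A g U U p) = g p (U p) (U p) *\<^sub>R - ?grad" using * U(1,2) by blast
    then have "cc.hp (cmap c p) (cov_deriv A g U U p c) = (g p (U p) (U p) *\<^sub>R - ?grad) c"
      unfolding cov_deriv_hproj(1)[where U = U and V = U, OF c U(2) U(1,2) a] using ts by metis
    also have "\<dots> = (- ?G u u) *\<^sub>R ?grad c"
      by (simp add: U(3) metric_coords_eq[OF A g cp tv tv] ts scaleR_fun_def fun_Compl_def)
    finally have "?G ((- ?G u u) *\<^sub>R ?grad c) a = - ?NK u u a"
      using cov_deriv_hproj(2)[where U = U and V = U, OF c U(2) U(1,2) a] by (simp add: U(3) ts)
    then show "?NK u u a = Df a * ?G u u"
      unfolding bilinear_lmul[OF cc.bG[OF px]] gradient_coords by (simp add: mult.commute)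
  next
    fix U V
    assume *: "\<forall>u a. cc.D\<phi> (cmap c p) u = 0 \<longrightarrow> ?hor a \<longrightarrow> ?NK u u a = Df a * ?G u u"
      and UV: "smooth_vfield A U \<and> (\<forall>q. U q \<in> vertical A B F q) \<and>
            smooth_vfield A V \<and> (\<forall>q. V q \<in> vertical A B F q)"
    have Ut: "U p \<in> tangent_space A p" "V p \<in> tangent_space A p" using UV by (auto simp: vertical_def)
    have Uv: "cc.D\<phi> (cmap c p) (U p c) = 0" "cc.D\<phi> (cmap c p) (V p c) = 0"
      using vertical_iff[OF cp dp] Ut UV by blast+
    have "?grad \<in> horizontal A g B F p" using gradient_horizontal_iff[OF f] v by blast
    then have gh: "?hor (?grad c)" using horizontal_coords[OF cp dp gradient_spec(1)[OF A g f]] by blast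
    \<comment> \<open>Supplies a horizontal vector for the premise of
      \<open>cov_deriv_hproj\<close>.\<close>
    have "?hor 0" by (simp add: cc.hor_def bilinear_lzero[OF cc.bG[OF px]])
    note H = cov_deriv_hproj[where U = U and V = V, OF c]
    have "cc.hp (cmap c p) (cov_deriv A g U V p c) = (- g p (U p) (V p)) *\<^sub>R ?grad c"
    proof (rule cc.G_eq_on_hor[OF px cc.hp(1)[OF px] cc.hor_scaleR[OF px gh]])
      fix b assume b: "?hor b"
      have "?NK (U p c) (V p c) b = Df b * ?G (U p c) (V p c)"
        by (rule cc.second_fundamental_polarization[OF px ch _ Uv]) (use * b in blast)
      then have "?G (cc.hp (cmap c p) (cov_deriv A g U V p c)) b = - (Df b * ?G (U p c) (V p c))"
        using H(2)[of b] UV b by simp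
      then show "?G (cc.hp (cmap c p) (cov_deriv A g U V p c)) b = ?G ((- g p (U p) (V p)) *\<^sub>R ?grad c) b"
        unfolding bilinear_lmul[OF cc.bG[OF px]] gradient_coords by (simp add: metric_coords_eq[OF A g cp Ut])
    qed
    also have "\<dots> = (g p (U p) (V p) *\<^sub>R - ?grad) c" by (simp add: scaleR_fun_def fun_Compl_def)
    finally have "tvec_of A c p (cc.hp (cmap c p) (cov_deriv A g U V p c)) =
        tvec_of A c p ((g p (U p) (V p) *\<^sub>R - ?grad) c)" by simp
    moreover have "g p (U p) (V p) *\<^sub>R - ?grad \<in> tangent_space A p"
      by (intro tangent_scaleR[OF A] tangent_minus[OF A] gradient_spec(1)[OF A g f])
    moreover have "hproj A g B F p (cov_deriv A g U V p) = tvec_of A c p (cc.hp (cmap c p) (cov_deriv A g U V p c))"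
      using H(1) UV \<open>?hor 0\<close> by blast
    ultimately show "hproj A g B F p (cov_deriv A g U V p) = g p (U p) (V p) *\<^sub>R - ?grad"
      using tvec_of_coord[OF A _ cp] by metis
  qed
  then show ?thesis
    unfolding cc.clairaut_pointwise[OF px ch l] clairaut_at_def vertical_derivatives_iff[symmetric] by blast
qed

end

subsection \<open>The Clairaut condition along a geodesic\<close>

context
  fixes I \<alpha> t
  assumes geo: "geodesic A g I \<alpha>" and tI: "t \<in> I" and c: "c = chart_at A (\<alpha> t)"
    and d: "d \<in> charts_at B (F (\<alpha> t))"
begin

lemma ct: "c \<in> charts_at A (\<alpha> t)" unfolding c by (rule chart_at_in[OF A])

lemma I: "open I" and sc: "smooth_curve A I \<alpha>"
  using geo by (auto simp: geodesic_def)

abbreviation "vel \<equiv> velocity A \<alpha>"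

lemma vel_tangent: "s \<in> I \<Longrightarrow> vel s \<in> tangent_space A (\<alpha> s)"
  by (rule velocity_tangent[OF A I sc])

text \<open>The charts are fixed at time \<open>t\<close>; on this open neighbourhood of
  \<open>t\<close> both remain valid, which suffices for derivatives at \<open>t\<close>.\<close>

definition J where "J = I \<inter> \<alpha> -` (cdom c \<inter> F -` cdom d)"

lemma J: "open J" "t \<in> J" "s \<in> J \<Longrightarrow> s \<in> I" "s \<in> J \<Longrightarrow> c \<in> charts_at A (\<alpha> s)"
  "s \<in> J \<Longrightarrow> d \<in> charts_at B (F (\<alpha> s))"
proof -
  have "open (cdom c \<inter> F -` cdom d)" by (intro open_Int open_cdom[OF A cA] open_vimage_chart[OF A B F dB])
  then show "open J"
    unfolding J_def using sc I by (metis Int_commute continuous_on_open_vimage smooth_curve_def)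
  show "t \<in> J" using tI charts_atD(2)[OF ct] charts_atD(2)[OF d] by (simp add: J_def)
qed (auto simp: J_def charts_at_def cA dB)

lemmas xt = in_dom[OF ct d] and cht = christoffel_spec[OF A g ct]

lemma dx: "((\<lambda>s. cmap c (\<alpha> s)) has_vector_derivative vel t c) (at t)"
  using velocity_coords(1)[OF A I sc ct tI] by (simp add: comp_def)

lemma dv: "((\<lambda>s. vel s c) has_vector_derivative - christoffel A g c (\<alpha> t) (vel t c) (vel t c)) (at t)"
  using geodesic_acceleration[OF A geo tI] by (simp add: c)

text \<open>The acceleration is minus the Christoffel term, so by compatibility the two acceleration
  terms cancel the derivative of the metric.\<close>

lemma energy_derivative: "((\<lambda>s. g (\<alpha> s) (vel s) (vel s)) has_real_derivative 0) (at t)"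
proof -
  note b = cc.bG[OF xt]
  have "((\<lambda>s. metric_coords A g c (cmap c (\<alpha> s)) (vel s c) (vel s c)) has_real_derivative 0) (at t)"
    using has_real_derivative_bilinear_along[OF cc.S xt cc.bG smooth_on_differentiable[OF cc.sG xt] dx dv dv]
    by (simp add: cht(3) bilinear_lneg[OF b] bilinear_rneg[OF b])
  then show ?thesis
    by (rule has_field_derivative_transform_within_open[OF _ J(1,2)])
      (metis metric_coords_eq[OF A g] J(3,4) vel_tangent)
qed

text \<open>Along a geodesic the acceleration terms are exactly the Christoffel terms of
  \<open>NK\<close>, so the ordinary derivative of K(v, v) is the covariant one.\<close>

lemma K_derivative: "((\<lambda>s. cc.K (cmap c (\<alpha> s)) (vel s c) (vel s c)) has_real_derivative
    cc.NK (cmap c (\<alpha> t)) (christoffel A g c (\<alpha> t)) (vel t c) (vel t c) (vel t c)) (at t)"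
proof -
  note b = cc.K_bilinear[OF xt]
  show ?thesis
    using has_real_derivative_bilinear_along[OF cc.S xt cc.K_bilinear smooth_on_differentiable[OF cc.K_smooth xt] dx dv dv]
    by (simp add: cc.NK_def[OF xt cht] cc.DK_def[OF xt cht] bilinear_lneg[OF b] bilinear_rneg[OF b])
qed

lemma f_derivative:
  assumes f: "smooth_fun A f"
  shows "((\<lambda>s. f (\<alpha> s)) has_real_derivative
    FD (f \<circ> cinv c) (cmap c (\<alpha> t)) (vel t c)) (at t)"
proof -
  note df = f_coords_has_derivative[OF ct d f]
  have "(\<lambda>h. FD (f \<circ> cinv c) (cmap c (\<alpha> t)) (h *\<^sub>R vel t c)) =
      (*) (FD (f \<circ> cinv c) (cmap c (\<alpha> t)) (vel t c))"
    by (rule ext) (simp add: linear_scale[OF has_derivative_linear[OF df]])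
  then have "((\<lambda>s. (f \<circ> cinv c) (cmap c (\<alpha> s))) has_real_derivative
    FD (f \<circ> cinv c) (cmap c (\<alpha> t)) (vel t c)) (at t)"
    using has_derivative_compose[OF dx[unfolded has_vector_derivative_def] df]
    unfolding has_field_derivative_def by (simp only:)
  then show ?thesis
    by (rule has_field_derivative_transform_within_open[OF _ J(1,2)])
      (simp add: cinv_cmap[OF A charts_atD[OF J(4)]])
qed

text \<open>The square is differentiated because sin \<omega> contains a root that need not be
  differentiable where the velocity is horizontal. With the energy fixed at \<open>k\<close>, the
  square is e^(2f) (k - K) / k.\<close>

lemma clairaut_square_derivative:
  assumes f: "smooth_fun A f" and k: "k > 0" "\<And>s. s \<in> I \<Longrightarrow> g (\<alpha> s) (vel s) (vel s) = k"
  shows "((\<lambda>s. (exp (f (\<alpha> s)) * sin (horizontal_angle A g B F (\<alpha> s) (vel s)))\<^sup>2) has_real_derivative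
    (exp (f (\<alpha> t)))\<^sup>2 / k *
      (2 * FD (f \<circ> cinv c) (cmap c (\<alpha> t)) (vel t c) *
        (metric_coords A g c (cmap c (\<alpha> t)) (vel t c) (vel t c) - cc.K (cmap c (\<alpha> t)) (vel t c) (vel t c)) -
       cc.NK (cmap c (\<alpha> t)) (christoffel A g c (\<alpha> t)) (vel t c) (vel t c) (vel t c))) (at t)"
proof -
  let ?K = "\<lambda>s. cc.K (cmap c (\<alpha> s)) (vel s c) (vel s c)"
  have Gk: "metric_coords A g c (cmap c (\<alpha> s)) (vel s c) (vel s c) = k" if "s \<in> J" for s
    using metric_coords_eq[OF A g J(4)[OF that] vel_tangent vel_tangent] k(2) J(3)[OF that] by simp
  have sq: "(exp (f (\<alpha> s)) * sin (horizontal_angle A g B F (\<alpha> s) (vel s)))\<^sup>2 = (exp (f (\<alpha> s)))\<^sup>2 * ((k - ?K s) / k)"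
    if s: "s \<in> J" for s
  proof -
    have "vel s c \<noteq> 0"
      using Gk[OF s] k(1) bilinear_lzero[OF cc.bG[OF in_dom[OF J(4,5)[OF s]]]] by force
    then have "vel s \<noteq> 0" by (auto simp: zero_fun_def)
    then have "sin (horizontal_angle A g B F (\<alpha> s) (vel s)) = sqrt ((k - ?K s) / k)"
      using sin_horizontal_angle[OF J(4,5)[OF s] vel_tangent[OF J(3)[OF s]]] by (simp add: Gk[OF s])
    moreover have "(k - ?K s) / k \<ge> 0"
      using cc.G_K_nonneg(2)[OF in_dom[OF J(4,5)[OF s]], of "vel s c"] k(1) by (simp add: Gk[OF s])
    ultimately show ?thesis by (simp add: power_mult_distrib)
  qed
  have "((\<lambda>s. (exp (f (\<alpha> s)))\<^sup>2 * ((k - ?K s) / k)) has_real_derivative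
    (exp (f (\<alpha> t)))\<^sup>2 / k *
      (2 * FD (f \<circ> cinv c) (cmap c (\<alpha> t)) (vel t c) * (k - ?K t) -
       cc.NK (cmap c (\<alpha> t)) (christoffel A g c (\<alpha> t)) (vel t c) (vel t c) (vel t c))) (at t)"
    using k(1) by (auto intro!: derivative_eq_intros f_derivative[OF f] K_derivative simp: field_simps power2_eq_square)
  then have "((\<lambda>s. (exp (f (\<alpha> s)) * sin (horizontal_angle A g B F (\<alpha> s) (vel s)))\<^sup>2) has_real_derivative
    (exp (f (\<alpha> t)))\<^sup>2 / k *
      (2 * FD (f \<circ> cinv c) (cmap c (\<alpha> t)) (vel t c) * (k - ?K t) -
       cc.NK (cmap c (\<alpha> t)) (christoffel A g c (\<alpha> t)) (vel t c) (vel t c) (vel t c))) (at t)"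
    by (rule has_field_derivative_transform_within_open[OF _ J(1,2)]) (simp add: sq)
  then show ?thesis by (simp add: Gk[OF J(2)])
qed

end

end

section \<open>From the condition at all points to all geodesics, and back\<close>

lemma constant_on_of_square:
  fixes h :: "'x \<Rightarrow> real"
  assumes "(\<lambda>t. (h t)\<^sup>2) constant_on I" "\<And>t. t \<in> I \<Longrightarrow> h t \<ge> 0"
  shows "h constant_on I"
proof -
  obtain k where "\<And>t. t \<in> I \<Longrightarrow> (h t)\<^sup>2 = k" using assms(1) unfolding constant_on_def by blast
  then have "h t = sqrt k" if "t \<in> I" for t using assms(2) that by (metis real_sqrt_abs abs_of_nonneg)
  then show ?thesis unfolding constant_on_def by blast
qed

context conformal_submersion_of_manifolds
begin

lemma chart_pair_at: "chart_pair A g B g' F lam (chart_at A p) (chart_at B q)"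
  by unfold_locales (rule charts_atD(1)[OF chart_at_in[OF A]], rule charts_atD(1)[OF chart_at_in[OF B]])

lemma energy_constant:
  assumes geo: "geodesic A g I \<alpha>"
  obtains k where "\<And>t. t \<in> I \<Longrightarrow> g (\<alpha> t) (velocity A \<alpha> t) (velocity A \<alpha> t) = k"
proof -
  have "((\<lambda>s. g (\<alpha> s) (velocity A \<alpha> s) (velocity A \<alpha> s)) has_real_derivative 0) (at t)" if t: "t \<in> I" for t
    by (rule chart_pair.energy_derivative[OF chart_pair_at geo t refl chart_at_in[OF B]])
  then have "(\<lambda>t. g (\<alpha> t) (velocity A \<alpha> t) (velocity A \<alpha> t)) constant_on I"
    using geo by (intro DERIV_zero_constant_on) (auto simp: geodesic_def)
  then show ?thesis using that unfolding constant_on_def by blast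
qed

lemma sin_horizontal_angle_nonneg:
  assumes "v \<in> tangent_space A p"
  shows "sin (horizontal_angle A g B F p v) \<ge> 0"
proof -
  interpret cp: chart_pair A g B g' F lam "chart_at A p" "chart_at B (F p)" by (rule chart_pair_at)
  note c = chart_at_in[OF A, of p] and d = chart_at_in[OF B, of "F p"]
  note nn = cp.cc.G_K_nonneg[OF in_dom[OF c d], of "v (chart_at A p)"]
  then show ?thesis unfolding cp.sin_horizontal_angle[OF c d assms] by simp
qed

lemma geodesic_velocity_tangent:
  assumes "geodesic A g I \<alpha>" "t \<in> I"
  shows "velocity A \<alpha> t \<in> tangent_space A (\<alpha> t)"
  using assms velocity_tangent[OF A] unfolding geodesic_def by blast

lemma clairaut_constant:
  assumes cl: "\<And>p. clairaut_at f p" and f: "smooth_fun A f" and geo: "geodesic A g I \<alpha>"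
  shows "(\<lambda>t. exp (f (\<alpha> t)) * sin (horizontal_angle A g B F (\<alpha> t) (velocity A \<alpha> t))) constant_on I"
proof -
  have I: "open I" "is_interval I" using geo by (auto simp: geodesic_def)
  note vt = geodesic_velocity_tangent[OF geo]
  obtain k where k: "\<And>t. t \<in> I \<Longrightarrow> g (\<alpha> t) (velocity A \<alpha> t) (velocity A \<alpha> t) = k"
    using energy_constant[OF geo] by blast
  show ?thesis
  proof (cases "k > 0")
    case True
    show ?thesis
    proof (rule constant_on_of_square[OF DERIV_zero_constant_on[OF I]])
      fix t assume t: "t \<in> I"
      show "exp (f (\<alpha> t)) * sin (horizontal_angle A g B F (\<alpha> t) (velocity A \<alpha> t)) \<ge> 0"
        using sin_horizontal_angle_nonneg[OF vt[OF t]] by simp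
      define c where "c = chart_at A (\<alpha> t)"
      define d where "d = chart_at B (F (\<alpha> t))"
      interpret cp: chart_pair A g B g' F lam c d unfolding c_def d_def by (rule chart_pair_at)
      have ct: "c \<in> charts_at A (\<alpha> t)" and dt: "d \<in> charts_at B (F (\<alpha> t))"
        unfolding c_def d_def by (rule chart_at_in[OF A], rule chart_at_in[OF B])
      note C = cp.clairaut_at_iff[OF ct dt f c_def, THEN iffD1, OF cl, rule_format]
      show "((\<lambda>t. (exp (f (\<alpha> t)) * sin (horizontal_angle A g B F (\<alpha> t) (velocity A \<alpha> t)))\<^sup>2) has_real_derivative 0) (at t)"
        using cp.clairaut_square_derivative[OF geo t c_def dt f True k] unfolding C by simp
    qed
  next
    case False
    \<comment> \<open>With zero energy all velocities vanish: the sine is 1 by convention, and f is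
      constant along the curve because its derivative is df(0) = 0.\<close>
    have v0: "velocity A \<alpha> t = 0" if t: "t \<in> I" for t
      using metric_pos[OF A g vt[OF t]] k[OF t] False by auto
    have "((\<lambda>t. f (\<alpha> t)) has_real_derivative 0) (at t)" if t: "t \<in> I" for t
    proof -
      define c where "c = chart_at A (\<alpha> t)"
      define d where "d = chart_at B (F (\<alpha> t))"
      interpret cp: chart_pair A g B g' F lam c d unfolding c_def d_def by (rule chart_pair_at)
      have ct: "c \<in> charts_at A (\<alpha> t)" and dt: "d \<in> charts_at B (F (\<alpha> t))"
        unfolding c_def d_def by (rule chart_at_in[OF A], rule chart_at_in[OF B])
      have "velocity A \<alpha> t c = 0" by (simp add: v0[OF t] zero_fun_def)
      then show ?thesis
        using cp.f_derivative[OF geo t c_def dt f] linear_0[OF has_derivative_linear[OF cp.f_coords_has_derivative[OF ct dt f]]]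
        by simp
    qed
    then have "(\<lambda>t. f (\<alpha> t)) constant_on I" by (rule DERIV_zero_constant_on[OF I])
    moreover have "sin (horizontal_angle A g B F (\<alpha> t) (velocity A \<alpha> t)) = 1" if t: "t \<in> I" for t
      using chart_pair.sin_horizontal_angle[OF chart_pair_at chart_at_in[OF A] chart_at_in[OF B] vt[OF t]]
      by (simp only: v0[OF t] if_True simp_thms)
    ultimately show ?thesis unfolding constant_on_def by auto
  qed
qed

text \<open>For \<open>v\<close> nonzero, the geodesic with this velocity at time 0 makes the
  derivative of the square vanish there, and the prefactor e^(2f) / k is positive.\<close>

lemma clairaut_at_of_geodesics:
  assumes cl: "\<And>I \<alpha>. geodesic A g I \<alpha> \<Longrightarrow>
      (\<lambda>t. exp (f (\<alpha> t)) * sin (horizontal_angle A g B F (\<alpha> t) (velocity A \<alpha> t))) constant_on I"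
    and f: "smooth_fun A f"
  shows "clairaut_at f p"
proof -
  define c where "c = chart_at A p"
  define d where "d = chart_at B (F p)"
  interpret cp: chart_pair A g B g' F lam c d unfolding c_def d_def by (rule chart_pair_at)
  have ct: "c \<in> charts_at A p" and dt: "d \<in> charts_at B (F p)"
    unfolding c_def d_def by (rule chart_at_in[OF A], rule chart_at_in[OF B])
  let ?G = "metric_coords A g c (cmap c p)" and ?K = "cp.cc.K (cmap c p)"
  let ?Df = "FD (f \<circ> cinv c) (cmap c p)"
  let ?NK = "cp.cc.NK (cmap c p) (christoffel A g c p)"
  have "2 * ?Df v * (?G v v - ?K v v) = ?NK v v v" for v
  proof (cases "v = 0")
    case True
    note x = in_dom[OF ct dt]
    have "?NK 0 0 0 = 0"
      using cp.cc.NK_linear(3)[OF x christoffel_spec[OF A g ct], of 0 0 0 0] by simp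
    then show ?thesis
      using True by (simp add: bilinear_lzero[OF cp.cc.bG[OF x]] bilinear_lzero[OF cp.cc.K_bilinear[OF x]])
  next
    case False
    let ?v = "tvec_of A c p v"
    have vc: "?v c = v" by (rule tvec_of_self[OF A ct])
    obtain I \<alpha> where geo: "geodesic A g I \<alpha>" and 0: "0 \<in> I" and \<alpha>0: "\<alpha> 0 = p" "velocity A \<alpha> 0 = ?v"
      using geodesic_exists[OF A g tvec_of_tangent[OF A ct]] by blast
    obtain k where k: "\<And>t. t \<in> I \<Longrightarrow> g (\<alpha> t) (velocity A \<alpha> t) (velocity A \<alpha> t) = k"
      using energy_constant[OF geo] by blast
    have "?v \<noteq> 0" using vc False by (auto simp: zero_fun_def)
    then have kp: "k > 0" using metric_pos[OF A g tvec_of_tangent[OF A ct] \<open>?v \<noteq> 0\<close>] k[OF 0] by (simp add: \<alpha>0)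
    let ?h = "\<lambda>t. exp (f (\<alpha> t)) * sin (horizontal_angle A g B F (\<alpha> t) (velocity A \<alpha> t))"
    have d1: "((\<lambda>t. (?h t)\<^sup>2) has_real_derivative
        (exp (f p))\<^sup>2 / k * (2 * ?Df v * (?G v v - ?K v v) - ?NK v v v)) (at 0)"
      using cp.clairaut_square_derivative[OF geo 0 _ _ f kp k] dt by (simp add: \<alpha>0 vc c_def[symmetric])
    obtain h0 where "\<And>t. t \<in> I \<Longrightarrow> ?h t = h0" using cl[OF geo] unfolding constant_on_def by blast
    then have "((\<lambda>t. (?h t)\<^sup>2) has_real_derivative 0) (at 0)"
      using geo 0 unfolding geodesic_def
      by (intro has_field_derivative_transform_within_open[OF DERIV_const[of "h0\<^sup>2"], of I]) auto
    from DERIV_unique[OF d1 this] show ?thesis using kp by simp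
  qed
  then show ?thesis using cp.clairaut_at_iff[OF ct dt f c_def] by blast
qed

text \<open>The quantifier over points is distributed over the clauses; connectedness of the fibers
  enters in the clause on the dilation.\<close>

lemma clairaut_at_iff_umbilical:
  assumes f: "smooth_fun A f" and conn: "\<And>q. connected (F -` {q})"
  shows "(\<forall>p. clairaut_at f p) \<longleftrightarrow>
    (\<forall>p. gradient A g f p \<in> horizontal A g B F p) \<and>
    fibers_totally_umbilical A g B F (\<lambda>p. - gradient A g f p) \<and>
    (\<forall>q. lam constant_on (F -` {q}))"
proof -
  have neg: "- gradient A g f p \<in> horizontal A g B F p" if h: "gradient A g f p \<in> horizontal A g B F p" for p
  proof -
    note t = gradient_spec(1)[OF A g f, of p]
    have "g p (- gradient A g f p) u = 0" if u: "u \<in> vertical A B F p" for u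
    proof -
      have "u \<in> tangent_space A p" "g p (gradient A g f p) u = 0"
        using u h by (auto simp: vertical_def horizontal_def)
      with metric_scaleR_left[OF A g t, of u "-1"] show ?thesis by simp
    qed
    then show ?thesis using tangent_minus[OF A t] by (simp add: horizontal_def)
  qed
  have lam: "(\<forall>p. \<forall>u\<in>vertical A B F p. dfun A lam p u = 0) \<longleftrightarrow> (\<forall>q. lam constant_on (F -` {q}))"
    using dilation_constant_on_fibers[OF _ conn] dilation_vertical_derivative by blast
  show ?thesis
    unfolding fibers_totally_umbilical_def clairaut_at_def lam[symmetric]
    using smooth_vfield_minus[OF A gradient_smooth[OF A g f]] neg by (auto simp: gradient_horizontal_iff[OF f])
qed

end

theorem theorem5:
  fixes A :: "('m::{t2_space, second_countable_topology}, 'a::euclidean_space) chart set"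
    and g :: "('m, 'a) metric"
    and B :: "('n::{t2_space, second_countable_topology}, 'b::euclidean_space) chart set"
    and g' :: "('n, 'b) metric"
    and F :: "'m \<Rightarrow> 'n"
    and lam f :: "'m \<Rightarrow> real"
  assumes "riemannian_manifold A g"
    and "riemannian_manifold B g'"
    and "conformal_submersion A g B g' F lam"
    and "\<forall>q. connected (F -` {q})"
    and "smooth_fun A f"
  shows "clairaut_conformal_submersion A g B g' F lam (\<lambda>p. exp (f p)) \<longleftrightarrow>
           (\<forall>p. gradient A g f p \<in> horizontal A g B F p) \<and>
           fibers_totally_umbilical A g B F (\<lambda>p. - gradient A g f p) \<and>
           (\<forall>q. lam constant_on (F -` {q}))"
proof -
  interpret conformal_submersion_of_manifolds A g B g' F lam
    by unfold_locales (rule assms)+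
  have "smooth_on (cmap c ` cdom c) ((\<lambda>p. exp (f p)) \<circ> cinv c)" if c: "c \<in> A" for c
  proof -
    have "smooth_on (cmap c ` cdom c) (f \<circ> cinv c)" using assms(5) c by (simp add: smooth_fun_def)
    then show ?thesis
      using smooth_on_compose[OF open_cmap_cdom[OF A c] open_UNIV _ smooth_on_exp] by (simp add: comp_def)
  qed
  then have sexp: "smooth_fun A (\<lambda>p. exp (f p))" by (simp add: smooth_fun_def)
  have "clairaut_conformal_submersion A g B g' F lam (\<lambda>p. exp (f p)) \<longleftrightarrow> (\<forall>p. clairaut_at f p)"
    unfolding clairaut_conformal_submersion_def
    using CS sexp clairaut_constant[OF _ assms(5)] clairaut_at_of_geodesics[OF _ assms(5)] by auto
  then show ?thesis using clairaut_at_iff_umbilical[OF assms(5)] assms(4) by simp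
qed

end
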